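(* Assume $G$ is semisimple of adjoint type. The morphism $$\tau:R_T^\wedge\otimes_{(R_T^\wedge)^W}R_T^\wedge\to \mathrm{Fun}(W,R_T^\wedge),\qquad a\otimes b\mapsto\big(w\mapsto a\cdot w^{-1}(b)\big)$$ is injective, and its image consists exactly of the functions $f:W\to R_T^\wedge$ such that $f(w)\equiv f(ws_{\alpha^\vee})\pmod{1-e^{\alpha^\vee}}$ for every $w\in W$ and every coroot $\alpha^\vee$ (with $s_{\alpha^\vee}$ the associated reflection).
   Context: $G$ complex semisimple adjoint, $T$ maximal torus, $W$ Weyl group, $\Bbbk$ any field. $R_T=\Bbbk[X_*(T)]$ with basis $e^\lambda$; $R_T^\wedge$ its completion at the augmentation ideal; $W$ acts on $R_T^\wedge$. $\mathrm{Fun}(W,R_T^\wedge)$ is the ring of functions $W\to R_T^\wedge$. *)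

theory Defs
  imports "HOL-Analysis.Analysis" "HOL-Library.Function_Algebras"
begin

text \<open>A (reduced, crystallographic) root system Phi in a Euclidean space 'v, spanning 'v
  (semisimplicity). Coroots and reflections are taken with respect to the inner product.\<close>

definition root_refl :: "'v::euclidean_space \<Rightarrow> 'v \<Rightarrow> 'v" where
  "root_refl \<alpha> v = v - ((2 * (v \<bullet> \<alpha>)) / (\<alpha> \<bullet> \<alpha>)) *\<^sub>R \<alpha>"

definition coroot :: "'v::euclidean_space \<Rightarrow> 'v" where
  "coroot \<alpha> = (2 / (\<alpha> \<bullet> \<alpha>)) *\<^sub>R \<alpha>"

definition root_system :: "'v::euclidean_space set \<Rightarrow> bool" where
  "root_system \<Phi> \<longleftrightarrow> finite \<Phi> \<and> 0 \<notin> \<Phi> \<and> span \<Phi> = UNIV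
     \<and> (\<forall>\<alpha>\<in>\<Phi>. \<forall>\<beta>\<in>\<Phi>. root_refl \<alpha> \<beta> \<in> \<Phi>)
     \<and> (\<forall>\<alpha>\<in>\<Phi>. \<forall>\<beta>\<in>\<Phi>. (2 * (\<beta> \<bullet> \<alpha>)) / (\<alpha> \<bullet> \<alpha>) \<in> \<int>)
     \<and> (\<forall>\<alpha>\<in>\<Phi>. \<forall>c::real. c *\<^sub>R \<alpha> \<in> \<Phi> \<longrightarrow> c = 1 \<or> c = -1)"

inductive_set weyl :: "'v::euclidean_space set \<Rightarrow> ('v \<Rightarrow> 'v) set" for \<Phi> where
  weyl_id: "id \<in> weyl \<Phi>"
| weyl_step: "w \<in> weyl \<Phi> \<Longrightarrow> \<alpha> \<in> \<Phi> \<Longrightarrow> root_refl \<alpha> \<circ> w \<in> weyl \<Phi>"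

text \<open>Cocharacter lattice of the adjoint torus: the coweight lattice (dual of the root lattice).\<close>
definition cochar :: "'v::euclidean_space set \<Rightarrow> 'v set" where
  "cochar \<Phi> = {l. \<forall>\<alpha>\<in>\<Phi>. \<alpha> \<bullet> l \<in> \<int>}"

text \<open>Elements: finitely supported functions X_*(T) \<rightarrow> k (extended by 0), e^\<lambda> = indicator of \<lambda>.\<close>
definition RT :: "'v::euclidean_space set \<Rightarrow> ('v \<Rightarrow> 'k::field) set" where
  "RT \<Phi> = {f. finite {l. f l \<noteq> 0} \<and> {l. f l \<noteq> 0} \<subseteq> cochar \<Phi>}"

definition conv :: "('v::euclidean_space \<Rightarrow> 'k::field) \<Rightarrow> ('v \<Rightarrow> 'k) \<Rightarrow> 'v \<Rightarrow> 'k" where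
  "conv f g = (\<lambda>\<nu>. \<Sum>l\<in>{l. f l \<noteq> 0}. f l * g (\<nu> - l))"

definition ex :: "'v::euclidean_space \<Rightarrow> 'v \<Rightarrow> 'k::field" where
  "ex l = (\<lambda>\<nu>. if \<nu> = l then 1 else 0)"

definition aug :: "('v::euclidean_space \<Rightarrow> 'k::field) \<Rightarrow> 'k" where
  "aug f = (\<Sum>l\<in>{l. f l \<noteq> 0}. f l)"

definition Iaug :: "'v::euclidean_space set \<Rightarrow> ('v \<Rightarrow> 'k::field) set" where
  "Iaug \<Phi> = {f \<in> RT \<Phi>. aug f = 0}"

inductive_set addspan :: "('v \<Rightarrow> 'k::field) set \<Rightarrow> ('v \<Rightarrow> 'k) set" for S where
  addspan_zero: "0 \<in> addspan S"
| addspan_gen: "x \<in> S \<Longrightarrow> x \<in> addspan S"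
| addspan_add: "x \<in> addspan S \<Longrightarrow> y \<in> addspan S \<Longrightarrow> x + y \<in> addspan S"

fun Ipow :: "'v::euclidean_space set \<Rightarrow> nat \<Rightarrow> ('v \<Rightarrow> 'k::field) set" where
  "Ipow \<Phi> 0 = RT \<Phi>"
| "Ipow \<Phi> (Suc n) = addspan {conv x y | x y. x \<in> Iaug \<Phi> \<and> y \<in> Ipow \<Phi> n}"

text \<open>An element of the completion is a compatible family of cosets c n \<in> R_T / I^n.\<close>
type_synonym ('v, 'k) cel = "nat \<Rightarrow> ('v \<Rightarrow> 'k) set"

definition coset :: "'v::euclidean_space set \<Rightarrow> nat \<Rightarrow> ('v \<Rightarrow> 'k::field) \<Rightarrow> ('v \<Rightarrow> 'k) set" where
  "coset \<Phi> n x = {z \<in> RT \<Phi>. z - x \<in> Ipow \<Phi> n}"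

definition Rhat :: "'v::euclidean_space set \<Rightarrow> ('v, 'k::field) cel set" where
  "Rhat \<Phi> = {c. (\<forall>n. \<exists>x\<in>RT \<Phi>. c n = coset \<Phi> n x) \<and> (\<forall>n. c (Suc n) \<subseteq> c n)}"

definition hemb :: "'v::euclidean_space set \<Rightarrow> ('v \<Rightarrow> 'k::field) \<Rightarrow> ('v, 'k) cel" where
  "hemb \<Phi> x = (\<lambda>n. coset \<Phi> n x)"

definition hadd :: "'v::euclidean_space set \<Rightarrow> ('v, 'k::field) cel \<Rightarrow> ('v, 'k) cel \<Rightarrow> ('v, 'k) cel" where
  "hadd \<Phi> c d = (\<lambda>n. {z \<in> RT \<Phi>. \<exists>x\<in>c n. \<exists>y\<in>d n. z - (x + y) \<in> Ipow \<Phi> n})"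

definition hsub :: "'v::euclidean_space set \<Rightarrow> ('v, 'k::field) cel \<Rightarrow> ('v, 'k) cel \<Rightarrow> ('v, 'k) cel" where
  "hsub \<Phi> c d = (\<lambda>n. {z \<in> RT \<Phi>. \<exists>x\<in>c n. \<exists>y\<in>d n. z - (x - y) \<in> Ipow \<Phi> n})"

definition hmul :: "'v::euclidean_space set \<Rightarrow> ('v, 'k::field) cel \<Rightarrow> ('v, 'k) cel \<Rightarrow> ('v, 'k) cel" where
  "hmul \<Phi> c d = (\<lambda>n. {z \<in> RT \<Phi>. \<exists>x\<in>c n. \<exists>y\<in>d n. z - conv x y \<in> Ipow \<Phi> n})"

definition hzero :: "'v::euclidean_space set \<Rightarrow> ('v, 'k::field) cel" where
  "hzero \<Phi> = hemb \<Phi> (\<lambda>_. 0)"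

definition hone :: "'v::euclidean_space set \<Rightarrow> ('v, 'k::field) cel" where
  "hone \<Phi> = hemb \<Phi> (ex 0)"

definition hint :: "'v::euclidean_space set \<Rightarrow> int \<Rightarrow> ('v, 'k::field) cel" where
  "hint \<Phi> m = hemb \<Phi> (\<lambda>\<nu>. if \<nu> = 0 then of_int m else 0)"

text \<open>The action of w^{-1} (w \<in> W) on R_T^\<and>: on R_T it sends e^\<mu> to e^{w^{-1} \<mu>},
  i.e. f \<mapsto> f \<circ> w; it is applied levelwise.\<close>
definition hpull :: "('v \<Rightarrow> 'v) \<Rightarrow> ('v, 'k) cel \<Rightarrow> ('v, 'k) cel" where
  "hpull w c = (\<lambda>n. (\<lambda>f. f \<circ> w) ` c n)"

definition Rinv :: "'v::euclidean_space set \<Rightarrow> ('v, 'k::field) cel set" where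
  "Rinv \<Phi> = {c \<in> Rhat \<Phi>. \<forall>w\<in>weyl \<Phi>. hpull w c = c}"

definition hsum :: "'v::euclidean_space set \<Rightarrow> ('a \<Rightarrow> ('v, 'k::field) cel) \<Rightarrow> 'a set \<Rightarrow> ('v, 'k) cel" where
  "hsum \<Phi> g S = Finite_Set.fold (\<lambda>p acc. hadd \<Phi> (g p) acc) (hzero \<Phi>) S"

text \<open>Formal Z-linear combinations of pairs (a,b) (a,b \<in> R^\<and>), i.e. the free abelian group
  on R^\<and> \<times> R^\<and>; the tensor product is its quotient by the subgroup TRel generated
  by the A-bilinearity relations, A = (R^\<and>)^W.\<close>
type_synonym ('v, 'k) fsum = "(('v, 'k) cel \<times> ('v, 'k) cel) \<Rightarrow> int"

definition fsupp :: "('v, 'k) fsum \<Rightarrow> (('v, 'k) cel \<times> ('v, 'k) cel) set" where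
  "fsupp F = {p. F p \<noteq> 0}"

definition formal :: "'v::euclidean_space set \<Rightarrow> ('v, 'k::field) fsum set" where
  "formal \<Phi> = {F. finite (fsupp F) \<and> fsupp F \<subseteq> Rhat \<Phi> \<times> Rhat \<Phi>}"

definition delta :: "(('v, 'k) cel \<times> ('v, 'k) cel) \<Rightarrow> ('v, 'k) fsum" where
  "delta p = (\<lambda>q. if q = p then 1 else 0)"

inductive_set TRel :: "'v::euclidean_space set \<Rightarrow> ('v, 'k::field) fsum set" for \<Phi> where
  TRel_zero: "0 \<in> TRel \<Phi>"
| TRel_addl: "a \<in> Rhat \<Phi> \<Longrightarrow> a' \<in> Rhat \<Phi> \<Longrightarrow> b \<in> Rhat \<Phi> \<Longrightarrow>
     delta (hadd \<Phi> a a', b) - delta (a, b) - delta (a', b) \<in> TRel \<Phi>"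
| TRel_addr: "a \<in> Rhat \<Phi> \<Longrightarrow> b \<in> Rhat \<Phi> \<Longrightarrow> b' \<in> Rhat \<Phi> \<Longrightarrow>
     delta (a, hadd \<Phi> b b') - delta (a, b) - delta (a, b') \<in> TRel \<Phi>"
| TRel_bal: "c \<in> Rinv \<Phi> \<Longrightarrow> a \<in> Rhat \<Phi> \<Longrightarrow> b \<in> Rhat \<Phi> \<Longrightarrow>
     delta (hmul \<Phi> c a, b) - delta (a, hmul \<Phi> c b) \<in> TRel \<Phi>"
| TRel_diff: "x \<in> TRel \<Phi> \<Longrightarrow> y \<in> TRel \<Phi> \<Longrightarrow> x - y \<in> TRel \<Phi>"

definition tau :: "'v::euclidean_space set \<Rightarrow> ('v, 'k::field) fsum \<Rightarrow> ('v \<Rightarrow> 'v) \<Rightarrow> ('v, 'k) cel" where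
  "tau \<Phi> F w = hsum \<Phi> (\<lambda>(a, b). hmul \<Phi> (hint \<Phi> (F (a, b))) (hmul \<Phi> a (hpull w b))) (fsupp F)"

end

theory Submission
  imports Defs "HOL-Library.Poly_Mapping" "Jordan_Normal_Form.Determinant"
begin

text \<open>
  Let \<open>J(x)\<close> be the alternating sum of the \<open>W\<close>-conjugates of \<open>x\<close>, divided by the Weyl denominator.
  Steinberg's weights give elements of \<open>R_T\<close> whose Gram matrix for the form \<open>J(xy)\<close> is unitriangular
  (after a sign) over the invariants, hence elements \<open>stb t\<close> with a dual family \<open>std t\<close>. Reading this duality as an
  identity between square matrices and commuting the factors, the tensor \<open>\<Sum>t. stb t \<otimes> std t\<close> is
  supported on the diagonal of \<open>W \<times> W\<close>, where it equals the denominator up to sign.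

  A family \<open>f\<close> satisfying the congruences is therefore the image of \<open>\<Sum>t. g t \<otimes> std t\<close>, where \<open>g t\<close> is the
  alternating sum of \<open>f(w) w\<^sup>-\<^sup>1(stb t)\<close> divided by the denominator; this division is possible because the
  factors \<open>1 - e\<^sup>\<alpha>\<close>, for distinct positive coroots, are coprime in the completion. For
  \<open>f(w) = w\<^sup>-\<^sup>1(b)\<close> the \<open>g t\<close> are invariant, and moving them across the tensor sign gives injectivity.

  Coprimality in the completion is proved in all characteristics at once: choose an integral functional that
  kills one coroot but not the other, and expand in powers of \<open>gx y0 - 1\<close>, where \<open>y0\<close> has value 1 under
  this functional.
\<close>

text \<open>Adjointness enters in one way: the cocharacters are all the coweights, so the
  fundamental coweights and \<rho> are exponents in R_T, and with them the Weyl denominator and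
  Steinberg's elements exist there. Averaging over W is impossible because the order of W may vanish
  in the field; dividing alternating sums by the denominator takes its place and is exact over every
  field. J kills each monomial whose exponent is fixed by a reflection, and this sparsity is what
  makes the Gram matrix triangular. The obstacle is the completion: regularity and coprimality in
  R_T do not pass to it by themselves. The proof needs them in a uniform form: for each n there is
  an m such that, if (1 - e^\<alpha>) z lies in an ideal modulo the m-th power of the augmentation
  ideal, then z lies in it modulo the n-th power. Quotients found level by level can then be glued.
  The completion consists of families of cosets and is not a ring type. All algebra is therefore
  done with Cauchy sequences (\<open>Cs\<close>) inside the ring of all sequences, up to null
  sequences (\<open>Ns\<close>); classes return only in the final translation.\<close>

abbreviation keys :: "('a \<Rightarrow>\<^sub>0 'b::zero) \<Rightarrow> 'a set" where "keys \<equiv> Poly_Mapping.keys"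
abbreviation lookup :: "('a \<Rightarrow>\<^sub>0 'b::zero) \<Rightarrow> 'a \<Rightarrow> 'b" where "lookup \<equiv> Poly_Mapping.lookup"

section \<open>Group algebras of subgroups of a real vector space\<close>

lemma poly_mapping_additive_induct [case_names single add]:
  fixes p :: "'a \<Rightarrow>\<^sub>0 'b::comm_monoid_add"
  assumes single: "\<And>l a. P (Poly_Mapping.single l a)" and add: "\<And>p q. P p \<Longrightarrow> P q \<Longrightarrow> P (p + q)"
  shows "P p"
proof (induction p rule: update_induct)
  case const
  then show ?case using single[of undefined 0] by simp
next
  case (update f a b)
  have "Poly_Mapping.update a b f = f + Poly_Mapping.single a b"
    using update(1) by (intro poly_mapping_eqI) (auto simp: lookup_update lookup_add lookup_single when_def in_keys_iff)
  then show ?case using update add single by metis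
qed

lemma poly_mapping_mult_hom:
  fixes f :: "('a::comm_monoid_add \<Rightarrow>\<^sub>0 'b::comm_semiring_1) \<Rightarrow> 'c::comm_semiring_1"
  assumes add: "\<And>p q. f (p + q) = f p + f q"
    and single: "\<And>l m a b. f (Poly_Mapping.single (l + m) (a * b)) = f (Poly_Mapping.single l a) * f (Poly_Mapping.single m b)"
  shows "f (p * q) = f p * f q"
proof (induction p rule: poly_mapping_additive_induct)
  case (single l a)
  show ?case
    by (induction q rule: poly_mapping_additive_induct)
       (simp_all add: mult_single assms distrib_left)
next
  case (add p p')
  then show ?case by (simp add: distrib_right assms(1))
qed

text \<open>The additive map with prescribed values on monomials. The coefficient is an argument of
  \<open>h\<close>, so the target can be any commutative monoid and needs no scalars.\<close>

definition lin :: "('a \<Rightarrow> 'b \<Rightarrow> 'c::comm_monoid_add) \<Rightarrow> ('a \<Rightarrow>\<^sub>0 'b::comm_monoid_add) \<Rightarrow> 'c" where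
  "lin h p = (\<Sum>l\<in>keys p. h l (lookup p l))"

lemma lin_superset:
  assumes "finite S" "keys p \<subseteq> S" "\<And>l. h l 0 = 0"
  shows "lin h p = (\<Sum>l\<in>S. h l (lookup p l))"
  unfolding lin_def using assms by (intro sum.mono_neutral_left) (auto simp: in_keys_iff)

lemma lin_add:
  assumes "\<And>l. h l 0 = 0" "\<And>l a b. h l (a + b) = h l a + h l b"
  shows "lin h (p + q) = lin h p + lin h q"
proof -
  let ?S = "keys p \<union> keys q"
  have "lin h x = (\<Sum>l\<in>?S. h l (lookup x l))" if "x \<in> {p, q, p + q}" for x
    using that keys_add[of p q] by (intro lin_superset assms(1)) auto
  then show ?thesis by (simp add: lookup_add assms(2) sum.distrib)
qed

lemma lin_single: "h l 0 = 0 \<Longrightarrow> lin h (Poly_Mapping.single l a) = h l a"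
  by (auto simp: lin_def)

definition gx :: "'v \<Rightarrow> ('v \<Rightarrow>\<^sub>0 'k::comm_ring_1)" where
  "gx l = Poly_Mapping.single l 1"

lemma gx_add: "gx (l + m) = gx l * gx m"
  by (simp add: gx_def mult_single)

lemma gx_0 [simp]: "gx 0 = 1"
  by (simp add: gx_def)

lemma gx_minus: "gx (- l) * gx l = (1 :: 'v::ab_group_add \<Rightarrow>\<^sub>0 'k::comm_ring_1)"
  by (simp flip: gx_add)

definition subgp :: "'v::ab_group_add set \<Rightarrow> bool" where
  "subgp Y \<longleftrightarrow> 0 \<in> Y \<and> (\<forall>x\<in>Y. \<forall>y\<in>Y. x - y \<in> Y)"

lemma subgp_0: "subgp Y \<Longrightarrow> 0 \<in> Y"
  and subgp_diff: "subgp Y \<Longrightarrow> x \<in> Y \<Longrightarrow> y \<in> Y \<Longrightarrow> x - y \<in> Y"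
  by (auto simp: subgp_def)

lemma subgp_minus: "subgp Y \<Longrightarrow> x \<in> Y \<Longrightarrow> - x \<in> Y"
  using subgp_diff[of Y 0 x] subgp_0[of Y] by simp

lemma subgp_add: "subgp Y \<Longrightarrow> x \<in> Y \<Longrightarrow> y \<in> Y \<Longrightarrow> x + y \<in> Y"
  using subgp_diff[of Y x "- y"] subgp_minus[of Y y] by simp

text \<open>The group algebra of a subgroup is kept as a subset of the group algebra of the whole
  vector space. One ring type then serves the lattice, the kernels of functionals on it, and
  exponents such as half coroots that may lie outside the lattice.\<close>

definition GR :: "'v set \<Rightarrow> ('v \<Rightarrow>\<^sub>0 'k::zero) set" where
  "GR Y = {p. keys p \<subseteq> Y}"

lemma GR_0: "0 \<in> GR Y"
  by (simp add: GR_def)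

lemma GR_add: "p \<in> GR Y \<Longrightarrow> q \<in> GR Y \<Longrightarrow> p + q \<in> GR Y" for p :: "_ \<Rightarrow>\<^sub>0 'k::monoid_add"
  using keys_add[of p q] by (auto simp: GR_def)

lemma GR_minus: "p \<in> GR Y \<Longrightarrow> - p \<in> GR Y" for p :: "_ \<Rightarrow>\<^sub>0 'k::ab_group_add"
  by (auto simp: GR_def in_keys_iff)

lemma GR_diff: "p \<in> GR Y \<Longrightarrow> q \<in> GR Y \<Longrightarrow> p - q \<in> GR Y" for p :: "_ \<Rightarrow>\<^sub>0 'k::ab_group_add"
  using GR_add[of p Y "- q"] GR_minus[of q Y] by simp

lemma GR_sum: "(\<And>i. i \<in> I \<Longrightarrow> f i \<in> GR Y) \<Longrightarrow> sum f I \<in> GR Y" for f :: "_ \<Rightarrow> _ \<Rightarrow>\<^sub>0 'k::comm_monoid_add"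
  by (induction I rule: infinite_finite_induct) (auto simp: GR_0 GR_add)

lemma GR_single: "l \<in> Y \<Longrightarrow> Poly_Mapping.single l a \<in> GR Y"
  by (auto simp: GR_def)

lemma GR_gx: "l \<in> Y \<Longrightarrow> gx l \<in> GR Y"
  by (simp add: gx_def GR_single)

lemma GR_1: "subgp Y \<Longrightarrow> (1 :: _ \<Rightarrow>\<^sub>0 'k::comm_ring_1) \<in> GR Y"
  using GR_gx[of 0 Y] by (simp add: subgp_0)

lemma GR_mult: "subgp Y \<Longrightarrow> p \<in> GR Y \<Longrightarrow> q \<in> GR Y \<Longrightarrow> p * q \<in> GR Y" for p :: "_ \<Rightarrow>\<^sub>0 'k::comm_ring_1"
  using keys_mult[of p q] subgp_add by (fastforce simp: GR_def)

lemma GR_mono: "Y \<subseteq> Z \<Longrightarrow> GR Y \<subseteq> GR Z"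
  by (auto simp: GR_def)

lemma GR_induct [consumes 1, case_names single zero add]:
  fixes p :: "'a \<Rightarrow>\<^sub>0 'b::comm_monoid_add"
  assumes p: "p \<in> GR Y"
    and single: "\<And>l a. l \<in> Y \<Longrightarrow> P (Poly_Mapping.single l a)" and zero: "P 0"
    and add: "\<And>p q. p \<in> GR Y \<Longrightarrow> q \<in> GR Y \<Longrightarrow> P p \<Longrightarrow> P q \<Longrightarrow> P (p + q)"
  shows "P p"
proof -
  have *: "P (\<Sum>l\<in>S. Poly_Mapping.single l (lookup p l)) \<and> (\<Sum>l\<in>S. Poly_Mapping.single l (lookup p l)) \<in> GR Y"
    if "finite S" "S \<subseteq> Y" for S
    using that by (induction S) (auto simp: zero GR_0 add single GR_single GR_add)
  have "p = (\<Sum>l\<in>keys p. Poly_Mapping.single l (lookup p l))"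
    by (rule poly_mapping_eqI) (auto simp: lookup_sum lookup_single when_def in_keys_iff sum.If_cases)
  with * show ?thesis using p by (metis GR_def finite_keys mem_Collect_eq)
qed

section \<open>Powers of the augmentation ideal\<close>

definition augm :: "('v \<Rightarrow>\<^sub>0 'k::comm_ring_1) \<Rightarrow> 'k" where
  "augm = lin (\<lambda>l a. a)"

lemma augm_add: "augm (p + q) = augm p + augm q"
  by (simp add: augm_def lin_add)

lemma augm_single [simp]: "augm (Poly_Mapping.single l a) = a"
  by (simp add: augm_def lin_single)

lemma augm_gx [simp]: "augm (gx l) = 1"
  by (simp add: gx_def)

lemma augm_0 [simp]: "augm 0 = 0"
  by (simp add: augm_def lin_def)

lemma augm_minus: "augm (- p) = - augm p"
  using augm_add[of p "- p"] by (simp add: eq_neg_iff_add_eq_0 add.commute)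

lemma augm_diff: "augm (p - q) = augm p - augm q"
  using augm_add[of p "- q"] by (simp add: augm_minus)

lemma augm_mult: "augm (p * q) = augm p * augm q" for p :: "'v::comm_monoid_add \<Rightarrow>\<^sub>0 'k::comm_ring_1"
  by (rule poly_mapping_mult_hom[where f = augm]) (auto simp: augm_add)

lemma augm_1 [simp]: "augm (1 :: 'v::zero \<Rightarrow>\<^sub>0 'k::comm_ring_1) = 1"
  using augm_gx[of "0::'v"] by (simp add: gx_def)

inductive_set gspan :: "('v \<Rightarrow>\<^sub>0 'k::comm_ring_1) set \<Rightarrow> ('v \<Rightarrow>\<^sub>0 'k) set" for S where
  gspan_zero: "0 \<in> gspan S"
| gspan_gen: "x \<in> S \<Longrightarrow> x \<in> gspan S"
| gspan_add: "x \<in> gspan S \<Longrightarrow> y \<in> gspan S \<Longrightarrow> x + y \<in> gspan S"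

text \<open>Follows \<open>Ipow\<close> clause by clause, so that the two can be compared by
  induction. Closing under sums alone is enough in \<open>gspan\<close>: scalars and signs are
  absorbed into the factor \<open>x\<close>.\<close>

fun GI :: "'v::ab_group_add set \<Rightarrow> nat \<Rightarrow> ('v \<Rightarrow>\<^sub>0 'k::comm_ring_1) set" where
  "GI Y 0 = GR Y"
| "GI Y (Suc n) = gspan {x * y | x y. x \<in> GR Y \<and> augm x = 0 \<and> y \<in> GI Y n}"

lemma GI_0: "0 \<in> GI Y n"
  by (cases n) (auto simp: GR_0 gspan_zero)

lemma GI_add: "p \<in> GI Y n \<Longrightarrow> q \<in> GI Y n \<Longrightarrow> p + q \<in> GI Y n"
  by (cases n) (auto simp: GR_add gspan_add)

lemma GI_Suc_mult: "x \<in> GR Y \<Longrightarrow> augm x = 0 \<Longrightarrow> y \<in> GI Y n \<Longrightarrow> x * y \<in> GI Y (Suc n)"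
  by (auto intro: gspan_gen)

lemma GI_Suc_induct [consumes 1, case_names zero mult add]:
  assumes "p \<in> GI Y (Suc n)" "P 0"
    "\<And>x y. x \<in> GR Y \<Longrightarrow> augm x = 0 \<Longrightarrow> y \<in> GI Y n \<Longrightarrow> P (x * y)"
    "\<And>p q. p \<in> GI Y (Suc n) \<Longrightarrow> q \<in> GI Y (Suc n) \<Longrightarrow> P p \<Longrightarrow> P q \<Longrightarrow> P (p + q)"
  shows "P p"
  using assms(1) unfolding GI.simps
  by (induction rule: gspan.induct) (use assms in auto)

context
  fixes Y :: "'v::ab_group_add set"
  assumes Y: "subgp Y"
begin

lemma GI_mult: "r \<in> GR Y \<Longrightarrow> p \<in> GI Y n \<Longrightarrow> r * p \<in> GI Y n"
proof (cases n)
  case (Suc m)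
  assume "p \<in> GI Y n" "r \<in> GR Y"
  then have "r * p \<in> GI Y (Suc m)"
    unfolding Suc
  proof (induction rule: GI_Suc_induct)
    case (mult x y)
    have "(r * x) * y \<in> GI Y (Suc m)"
      using mult by (intro GI_Suc_mult) (auto simp: GR_mult[OF Y] augm_mult)
    then show ?case by (simp add: mult.assoc)
  qed (auto simp: GI_0 GI_add distrib_left simp del: GI.simps)
  then show ?thesis by (simp add: Suc)
qed (simp add: GR_mult[OF Y])

lemma GI_minus: "p \<in> GI Y n \<Longrightarrow> - p \<in> GI Y n"
  using GI_mult[of "- 1" p n] GR_minus[OF GR_1[OF Y]] by simp

lemma GI_diff: "p \<in> GI Y n \<Longrightarrow> q \<in> GI Y n \<Longrightarrow> p - q \<in> GI Y n"
  using GI_add[of p Y n "- q"] GI_minus[of q n] by simp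

lemma GI_sum: "(\<And>i. i \<in> I \<Longrightarrow> f i \<in> GI Y n) \<Longrightarrow> sum f I \<in> GI Y n"
  by (induction I rule: infinite_finite_induct) (auto simp: GI_0 GI_add)

lemma GI_Suc_subset: "p \<in> GI Y (Suc n) \<Longrightarrow> p \<in> GI Y n"
  by (induction rule: GI_Suc_induct) (auto simp: GI_0 GI_add GI_mult simp del: GI.simps)

lemma GI_antimono: "m \<le> n \<Longrightarrow> p \<in> GI Y n \<Longrightarrow> p \<in> GI Y m"
  by (induction rule: inc_induct) (auto dest: GI_Suc_subset simp del: GI.simps)

lemma GI_GR: "p \<in> GI Y n \<Longrightarrow> p \<in> GR Y"
  using GI_antimono[of 0 n p] by simp

lemma GI_mult_add: "p \<in> GI Y m \<Longrightarrow> q \<in> GI Y n \<Longrightarrow> p * q \<in> GI Y (m + n)"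
proof (induction m arbitrary: p)
  case 0
  then show ?case by (simp add: GI_mult)
next
  case (Suc m)
  from Suc.prems(1) show ?case
  proof (induction rule: GI_Suc_induct)
    case (mult x y)
    have "x * (y * q) \<in> GI Y (Suc (m + n))"
      using mult Suc by (intro GI_Suc_mult) auto
    then show ?case by (simp add: mult.assoc)
  qed (auto simp: GI_0 GI_add distrib_right simp del: GI.simps)
qed

lemma GI_1: "p \<in> GR Y \<Longrightarrow> augm p = 0 \<Longrightarrow> p \<in> GI Y 1"
  using GI_Suc_mult[of p Y 1 0] GR_1[OF Y] by auto

lemma GI_power: "p \<in> GR Y \<Longrightarrow> augm p = 0 \<Longrightarrow> p ^ n \<in> GI Y n"
proof (induction n)
  case (Suc n)
  then show ?case using GI_Suc_mult[of p Y "p ^ n" n] by simp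
qed (simp add: GR_1[OF Y])

end

lemma GI_mono:
  assumes "Y \<subseteq> Z" "p \<in> GI Y n"
  shows "p \<in> GI Z n"
  using assms(2)
proof (induction n arbitrary: p)
  case 0
  then show ?case using GR_mono[OF assms(1)] by auto
next
  case (Suc n)
  from Suc.prems show ?case
  proof (induction rule: GI_Suc_induct)
    case (mult x y)
    then show ?case using Suc.IH GR_mono[OF assms(1)] by (intro GI_Suc_mult) auto
  qed (auto simp: GI_0 GI_add simp del: GI.simps)
qed

text \<open>The ideal of \<open>1 - gx b\<close> enlarged by a power of the augmentation ideal. For
  b = 0 only that power remains, so one theorem about \<open>Mod\<close> covers both coprimality and
  regularity.\<close>

definition Mod :: "'v::ab_group_add set \<Rightarrow> 'v \<Rightarrow> nat \<Rightarrow> ('v \<Rightarrow>\<^sub>0 'k::comm_ring_1) set" where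
  "Mod Y b n = {(1 - gx b) * y + i | y i. y \<in> GR Y \<and> i \<in> GI Y n}"

lemma ModI: "p = (1 - gx b) * y + i \<Longrightarrow> y \<in> GR Y \<Longrightarrow> i \<in> GI Y n \<Longrightarrow> p \<in> Mod Y b n"
  by (auto simp: Mod_def)

lemma Mod_zero [simp]: "Mod Y 0 n = GI Y n"
  by (auto simp: Mod_def intro: GR_0)

context
  fixes Y :: "'v::ab_group_add set" and b :: 'v
  assumes Y: "subgp Y" and b: "b \<in> Y"
begin

lemma GI_Mod: "p \<in> GI Y n \<Longrightarrow> p \<in> Mod Y b n"
  by (rule ModI[of _ _ 0 p]) (auto intro: GR_0)

lemma Mod_add: "p \<in> Mod Y b n \<Longrightarrow> q \<in> Mod Y b n \<Longrightarrow> p + q \<in> Mod Y b n"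
proof -
  assume "p \<in> Mod Y b n" "q \<in> Mod Y b n"
  then obtain y i y' i' where *: "p = (1 - gx b) * y + i" "q = (1 - gx b) * y' + i'"
    and mem: "y \<in> GR Y" "i \<in> GI Y n" "y' \<in> GR Y" "i' \<in> GI Y n"
    by (auto simp: Mod_def)
  show ?thesis
    unfolding * by (rule ModI[of _ _ "y + y'" "i + i'"]) (auto simp: GR_add GI_add mem algebra_simps)
qed

lemma Mod_mult_GI: "r \<in> GI Y m \<Longrightarrow> p \<in> Mod Y b n \<Longrightarrow> r * p \<in> Mod Y b (m + n)"
proof -
  assume r: "r \<in> GI Y m" and "p \<in> Mod Y b n"
  then obtain y i where *: "p = (1 - gx b) * y + i" and mem: "y \<in> GR Y" "i \<in> GI Y n"
    by (auto simp: Mod_def)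
  have "r * p = (1 - gx b) * (r * y) + r * i"
    by (simp add: * algebra_simps)
  then show ?thesis
    by (rule ModI) (use mem in \<open>auto simp: GR_mult[OF Y] GI_mult_add[OF Y] r GI_GR[OF Y r]\<close>)
qed

lemma Mod_mult: "r \<in> GR Y \<Longrightarrow> p \<in> Mod Y b n \<Longrightarrow> r * p \<in> Mod Y b n"
  using Mod_mult_GI[of r 0 p n] by simp

lemma Mod_minus: "p \<in> Mod Y b n \<Longrightarrow> - p \<in> Mod Y b n"
  using Mod_mult[of "- 1" p n] GR_minus[OF GR_1[OF Y]] by simp

lemma Mod_diff: "p \<in> Mod Y b n \<Longrightarrow> q \<in> Mod Y b n \<Longrightarrow> p - q \<in> Mod Y b n"
  using Mod_add[of p n "- q"] Mod_minus[of q n] by simp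

lemma Mod_0: "0 \<in> Mod Y b n"
  by (rule GI_Mod[OF GI_0])

lemma Mod_sum: "(\<And>i. i \<in> I \<Longrightarrow> f i \<in> Mod Y b n) \<Longrightarrow> sum f I \<in> Mod Y b n"
  by (induction I rule: infinite_finite_induct) (auto simp: Mod_0 Mod_add)

lemma Mod_antimono: "m \<le> n \<Longrightarrow> p \<in> Mod Y b n \<Longrightarrow> p \<in> Mod Y b m"
  using GI_antimono[OF Y] by (fastforce simp: Mod_def)

lemma Mod_trivial: "p \<in> GR Y \<Longrightarrow> p \<in> Mod Y b 0"
  by (rule GI_Mod) simp

end

section \<open>Binomial series with integral exponents\<close>

notation fps_nth (infixl "$\<^sub>f" 75)

text \<open>The series (1 + X)^i for an integer exponent. Its coefficients are the binomial
  coefficients read in the field, obtained without dividing by factorials, hence meaningful in every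
  characteristic.\<close>

definition binom :: "int \<Rightarrow> 'k::field fps" where
  "binom i = (if i \<ge> 0 then (1 + fps_X) ^ nat i else inverse (1 + fps_X) ^ nat (- i))"

lemma one_X_inverse: "inverse (1 + fps_X) * (1 + fps_X) = (1 :: 'k::field fps)"
  by (rule inverse_mult_eq_1) simp

lemma binom_0 [simp]: "binom 0 = 1"
  by (simp add: binom_def)

lemma binom_Suc: "binom (i + 1) = (1 + fps_X) * (binom i :: 'k::field fps)"
proof (cases "i \<ge> 0")
  case True
  then show ?thesis by (simp add: binom_def nat_add_distrib)
next
  case False
  then obtain n where i: "i = - int (Suc n)"
    by (cases i rule: int_cases) auto
  have "(1 + fps_X) * inverse (1 + fps_X) = (1 :: 'k fps)"
    using one_X_inverse by (simp add: mult.commute)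
  then show ?thesis
    by (cases n) (simp_all add: i binom_def nat_add_distrib flip: mult.assoc)
qed

lemma binom_pred: "binom (i - 1) = inverse (1 + fps_X) * (binom i :: 'k::field fps)"
proof -
  have "inverse (1 + fps_X) * binom i = (inverse (1 + fps_X) * (1 + fps_X)) * (binom (i - 1) :: 'k fps)"
    using binom_Suc[of "i - 1", where 'k = 'k] by (simp add: mult.assoc)
  then show ?thesis by (simp add: one_X_inverse)
qed

lemma binom_add: "binom (i + j) = binom i * (binom j :: 'k::field fps)"
proof (induction i rule: int_induct[where k = 0])
  case (step1 i)
  have "binom (i + 1 + j) = (1 + fps_X) * (binom (i + j) :: 'k fps)"
    using binom_Suc[of "i + j"] by (simp add: algebra_simps)
  then show ?case using step1 by (simp add: binom_Suc)
next
  case (step2 i)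
  have "binom (i - 1 + j) = inverse (1 + fps_X) * (binom (i + j) :: 'k fps)"
    using binom_pred[of "i + j"] by (simp add: algebra_simps)
  then show ?case using step2 by (simp add: binom_pred)
qed simp

lemma binom_nth_0 [simp]: "binom i $\<^sub>f 0 = (1 :: 'k::field)"
  by (auto simp: binom_def fps_nth_power_0)

lemma binom_nth_Suc: "binom (i + 1) $\<^sub>f Suc n = (binom i $\<^sub>f Suc n + binom i $\<^sub>f n :: 'k::field)"
  by (simp add: binom_Suc distrib_right)

text \<open>For i > 0 the coefficient of X^i is 1 in every characteristic, whereas the linear
  coefficient i may vanish. A negative exponent is reduced to a positive one by inverting.\<close>

lemma binom_neq_1:
  assumes "i \<noteq> 0"
  shows "binom i \<noteq> (1 :: 'k::field fps)"
proof -
  have *: "binom (int (Suc n)) \<noteq> (1 :: 'k fps)" for n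
  proof -
    have "binom (int m) $\<^sub>f k = (of_nat (m choose k) :: 'k)" for m k
    proof (induction m arbitrary: k)
      case 0
      then show ?case by (cases k) auto
    next
      case (Suc m)
      have "int (Suc m) = int m + 1" by simp
      then show ?case using Suc by (cases k) (simp_all only: binom_nth_Suc binom_nth_0, simp_all)
    qed
    from this[of "Suc n" "Suc n"] show ?thesis
      by (metis binomial_n_n fps_one_nth nat.distinct(1) of_nat_1 zero_neq_one)
  qed
  show ?thesis
  proof (cases "i > 0")
    case True
    then show ?thesis using *[of "nat (i - 1)"] by simp
  next
    case False
    then have "binom (- i) \<noteq> (1 :: 'k fps)" using assms *[of "nat (- i - 1)"] by simp
    moreover have "binom (- i) * binom i = (1 :: 'k fps)" using binom_add[of "- i" i] by simp
    ultimately show ?thesis by auto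
  qed
qed

section \<open>Coprimality up to powers of the augmentation ideal\<close>

text \<open>Value 1 at \<open>y0\<close> splits Y as the kernel of \<open>\<phi>\<close> plus the
  multiples of \<open>y0\<close>. The group algebra of Y thus becomes Laurent polynomials in
  \<open>gx y0\<close> over that of the kernel.\<close>

locale height =
  fixes Y :: "'v::real_vector set" and \<phi> :: "'v \<Rightarrow> int" and y0 :: 'v and kt :: "'k::field itself"
  assumes Y: "subgp Y"
    and \<phi>_add: "x \<in> Y \<Longrightarrow> y \<in> Y \<Longrightarrow> \<phi> (x + y) = \<phi> x + \<phi> y"
    and y0: "y0 \<in> Y" "\<phi> y0 = 1"
begin

definition K :: "'v set" where "K = {l \<in> Y. \<phi> l = 0}"

definition \<pi> :: "'v \<Rightarrow> 'v" where "\<pi> l = l - of_int (\<phi> l) *\<^sub>R y0"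

lemma \<phi>_0 [simp]: "\<phi> 0 = 0"
  using \<phi>_add[of 0 0] subgp_0[OF Y] by simp

lemma \<phi>_minus: "x \<in> Y \<Longrightarrow> \<phi> (- x) = - \<phi> x"
  using \<phi>_add[of x "- x"] subgp_minus[OF Y, of x] by simp

lemma \<phi>_diff: "x \<in> Y \<Longrightarrow> y \<in> Y \<Longrightarrow> \<phi> (x - y) = \<phi> x - \<phi> y"
  using \<phi>_add[of x "- y"] subgp_minus[OF Y, of y] \<phi>_minus[of y] by simp

lemma scale_y0: "of_int i *\<^sub>R y0 \<in> Y \<and> \<phi> (of_int i *\<^sub>R y0) = i"
proof (induction i rule: int_induct[where k = 0])
  case (step1 i)
  then show ?case using y0 by (simp add: scaleR_add_left \<phi>_add subgp_add[OF Y])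
next
  case (step2 i)
  then show ?case using y0 by (simp add: scaleR_diff_left \<phi>_diff subgp_diff[OF Y])
qed (simp add: subgp_0[OF Y])

lemma subgp_K: "subgp K"
  using subgp_0[OF Y] subgp_diff[OF Y] \<phi>_diff by (auto simp: subgp_def K_def)

lemma K_sub: "K \<subseteq> Y"
  by (auto simp: K_def)

lemma \<pi>_K: "l \<in> Y \<Longrightarrow> \<pi> l \<in> K"
  using scale_y0[of "\<phi> l"] by (auto simp: K_def \<pi>_def subgp_diff[OF Y] \<phi>_diff)

lemma \<pi>_add: "l \<in> Y \<Longrightarrow> m \<in> Y \<Longrightarrow> \<pi> (l + m) = \<pi> l + \<pi> m"
  by (simp add: \<pi>_def \<phi>_add algebra_simps)

text \<open>The expansion in powers of \<open>T = gx y0 - 1\<close>: the coefficient of \<open>T ^ i\<close>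
  in \<open>gx l = gx (\<pi> l) * (1 + T) ^ \<phi> l\<close>. In characteristic p these coefficients
  play the part of divided derivatives.\<close>

definition hasse :: "('v \<Rightarrow>\<^sub>0 'k) \<Rightarrow> ('v \<Rightarrow>\<^sub>0 'k) fps" where
  "hasse = lin (\<lambda>l a. Abs_fps (\<lambda>i. Poly_Mapping.single (\<pi> l) (a * binom (\<phi> l) $\<^sub>f i)))"

lemma hasse_add: "hasse (p + q) = hasse p + hasse q"
  unfolding hasse_def by (rule lin_add) (auto simp: fps_eq_iff single_add distrib_right)

lemma hasse_single: "hasse (Poly_Mapping.single l a) $\<^sub>f i = Poly_Mapping.single (\<pi> l) (a * binom (\<phi> l) $\<^sub>f i)"
  unfolding hasse_def by (subst lin_single) (auto simp: fps_eq_iff)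

lemma hasse_0 [simp]: "hasse 0 = 0"
  by (simp add: hasse_def lin_def)

lemma hasse_minus: "hasse (- p) = - hasse p"
  using hasse_add[of p "- p"] by (simp add: eq_neg_iff_add_eq_0 add.commute)

lemma hasse_diff: "hasse (p - q) = hasse p - hasse q"
  using hasse_add[of p "- q"] by (simp add: hasse_minus)

lemma hasse_1: "hasse 1 = 1"
proof -
  have "hasse 1 $\<^sub>f i = 1 $\<^sub>f i" for i
    using hasse_single[of 0 1 i] by (cases i) (auto simp: \<pi>_def)
  then show ?thesis by (simp add: fps_eq_iff)
qed

text \<open>On monomials this is additivity of \<open>\<pi>\<close> combined with
  \<open>binom_add\<close>: the Leibniz rule for divided derivatives. Exponents must lie in Y, where
  \<open>\<phi>\<close> is known to be additive.\<close>

lemma hasse_mult: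
  assumes "p \<in> GR Y" "q \<in> GR Y"
  shows "hasse (p * q) = hasse p * hasse q"
  using assms(1)
proof (induction rule: GR_induct)
  case (single l a)
  show ?case
    using assms(2)
  proof (induction rule: GR_induct)
    case s: (single m b)
    have "hasse (Poly_Mapping.single l a * Poly_Mapping.single m b) $\<^sub>f n
      = (hasse (Poly_Mapping.single l a) * hasse (Poly_Mapping.single m b)) $\<^sub>f n" for n
    proof -
      have "hasse (Poly_Mapping.single l a * Poly_Mapping.single m b) $\<^sub>f n
          = Poly_Mapping.single (\<pi> l + \<pi> m) (\<Sum>i = 0..n. (a * b) * (binom (\<phi> l) $\<^sub>f i * binom (\<phi> m) $\<^sub>f (n - i)))"
        using single s by (simp add: mult_single hasse_single \<pi>_add \<phi>_add binom_add fps_mult_nth sum_distrib_left)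
      also have "\<dots> = (\<Sum>i = 0..n. Poly_Mapping.single (\<pi> l + \<pi> m) ((a * b) * (binom (\<phi> l) $\<^sub>f i * binom (\<phi> m) $\<^sub>f (n - i))))"
        by (rule poly_mapping_eqI) (simp add: lookup_sum lookup_single when_def)
      also have "\<dots> = (hasse (Poly_Mapping.single l a) * hasse (Poly_Mapping.single m b)) $\<^sub>f n"
        by (simp add: fps_mult_nth hasse_single mult_single mult_ac)
      finally show ?thesis .
    qed
    then show ?case by (simp add: fps_eq_iff)
  qed (auto simp: hasse_add distrib_left)
qed (auto simp: hasse_add distrib_right)

lemma hasse_GR: "p \<in> GR Y \<Longrightarrow> hasse p $\<^sub>f i \<in> GR K"
  by (induction rule: GR_induct) (auto simp: hasse_add GR_add hasse_single GR_single \<pi>_K GR_0)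

lemma hasse_K: "p \<in> GR K \<Longrightarrow> hasse p = fps_const p"
proof (induction rule: GR_induct)
  case (single l a)
  then show ?case
    by (auto simp: fps_eq_iff hasse_single K_def \<pi>_def)
qed (auto simp: hasse_add simp flip: fps_const_add)

lemma augm_hasse: "p \<in> GR Y \<Longrightarrow> augm (hasse p $\<^sub>f 0) = augm p"
  by (induction rule: GR_induct) (auto simp: hasse_add augm_add hasse_single)

text \<open>Each coefficient index costs at most one power. In a product x * y with x of
  augmentation 0, the constant coefficient of x contributes a power of its own; any later
  coefficient of x contributes none, but lowers the index taken from y by at least one.\<close>

lemma hasse_GI: "p \<in> GI Y n \<Longrightarrow> hasse p $\<^sub>f i \<in> GI K (n - i)"
proof (induction n arbitrary: p i)
  case 0
  then show ?case by (simp add: hasse_GR)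
next
  case (Suc n)
  from Suc.prems show ?case
  proof (induction rule: GI_Suc_induct)
    case (mult x y)
    have yY: "y \<in> GR Y" by (rule GI_GR[OF Y mult(3)])
    have "hasse x $\<^sub>f j * hasse y $\<^sub>f (i - j) \<in> GI K (Suc n - i)" if "j \<le> i" for j
    proof (cases j)
      case 0
      have "hasse x $\<^sub>f 0 \<in> GI K 1"
        using mult by (intro GI_1[OF subgp_K]) (auto simp: hasse_GR augm_hasse)
      then have "hasse x $\<^sub>f 0 * hasse y $\<^sub>f i \<in> GI K (1 + (n - i))"
        by (intro GI_mult_add[OF subgp_K] Suc.IH mult)
      then have "hasse x $\<^sub>f 0 * hasse y $\<^sub>f i \<in> GI K (Suc n - i)"
        by (rule GI_antimono[OF subgp_K, rotated]) arith
      then show ?thesis by (simp only: 0 minus_nat.diff_0)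
    next
      case (Suc j')
      have "hasse x $\<^sub>f j * hasse y $\<^sub>f (i - j) \<in> GI K (n - (i - j))"
        by (intro GI_mult[OF subgp_K] hasse_GR Suc.IH mult)
      then show ?thesis
        by (rule GI_antimono[OF subgp_K, rotated]) (use Suc that in arith)
    qed
    then show ?case
      using mult yY by (auto simp: hasse_mult fps_mult_nth intro!: GI_sum[OF subgp_K] simp del: GI.simps)
  qed (auto simp: GI_0 GI_add hasse_add simp del: GI.simps)
qed

abbreviation T :: "'v \<Rightarrow>\<^sub>0 'k" where "T \<equiv> gx y0 - 1"

lemma T_GR: "T \<in> GR Y"
  by (intro GR_diff GR_gx y0 GR_1 Y)

lemma T_power: "T ^ n \<in> GI Y n"
  by (intro GI_power[OF Y] T_GR) (simp add: augm_diff)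

text \<open>The expansion of (1 + T)^a truncated at T^n. It propagates from a to a + 1 by Pascal's
  rule and back again because \<open>gx y0\<close> is a unit.\<close>

lemma expand_gx: "gx (of_int a *\<^sub>R y0) - (\<Sum>i<n. Poly_Mapping.single 0 (binom a $\<^sub>f i) * T ^ i) \<in> GI Y n"
proof (cases n)
  case 0
  then show ?thesis using scale_y0[of a] by (simp add: GR_gx)
next
  case (Suc m)
  define D where "D a = (gx (of_int a *\<^sub>R y0) - (\<Sum>i<n. Poly_Mapping.single 0 (binom a $\<^sub>f i) * T ^ i) :: 'v \<Rightarrow>\<^sub>0 'k)" for a
  \<comment> \<open>With n = Suc m, multiplication by 1 + T pushes only the last retained term
    beyond the truncation; that overflow is a multiple of T^n and so lies in the n-th power.\<close>
  have step: "D (a + 1) = gx y0 * D a + Poly_Mapping.single 0 (binom a $\<^sub>f m) * T ^ n" for a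
  proof -
    let ?c = "\<lambda>i. Poly_Mapping.single 0 (binom a $\<^sub>f i) :: 'v \<Rightarrow>\<^sub>0 'k"
    have "(\<Sum>i<n. Poly_Mapping.single 0 (binom (a + 1) $\<^sub>f i) * T ^ i)
        = 1 + (\<Sum>i<m. (?c (Suc i) + ?c i) * T ^ Suc i)"
      unfolding Suc sum.lessThan_Suc_shift by (simp add: binom_nth_Suc single_add)
    also have "\<dots> = (1 + (\<Sum>i<m. ?c (Suc i) * T ^ Suc i)) + (\<Sum>i<m. ?c i * T ^ Suc i)"
      by (simp add: sum.distrib distrib_right)
    also have "1 + (\<Sum>i<m. ?c (Suc i) * T ^ Suc i) = (\<Sum>i<n. ?c i * T ^ i)"
      unfolding Suc sum.lessThan_Suc_shift by simp
    also have "(\<Sum>i<m. ?c i * T ^ Suc i) = T * (\<Sum>i<n. ?c i * T ^ i) - ?c m * T ^ n"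
      unfolding Suc sum.lessThan_Suc sum_distrib_left by (simp add: sum_distrib_left algebra_simps)
    finally show ?thesis
      by (simp add: D_def scaleR_add_left gx_add algebra_simps)
  qed
  have tail: "Poly_Mapping.single 0 c * T ^ n \<in> GI Y n" for c
    by (intro GI_mult[OF Y] GR_single subgp_0[OF Y] T_power)
  have "D a \<in> GI Y n"
  proof (induction a rule: int_induct[where k = 0])
    case base
    have "(\<Sum>i<n. Poly_Mapping.single 0 (binom 0 $\<^sub>f i) * T ^ i) = (1 :: 'v \<Rightarrow>\<^sub>0 'k)"
      unfolding Suc sum.lessThan_Suc_shift by simp
    then show ?case by (simp add: D_def GI_0)
  next
    case (step1 i)
    then show ?case
      unfolding step by (intro GI_add tail GI_mult[OF Y] GR_gx y0)
  next
    case (step2 i)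
    have "gx (- y0) * (gx y0 * D (i - 1)) = D (i - 1)"
      by (simp add: gx_minus flip: mult.assoc)
    moreover have "gx y0 * D (i - 1) = D i - Poly_Mapping.single 0 (binom (i - 1) $\<^sub>f m) * T ^ n"
      using step[of "i - 1"] by simp
    moreover have "gx (- y0) * (D i - Poly_Mapping.single 0 (binom (i - 1) $\<^sub>f m) * T ^ n) \<in> GI Y n"
      by (intro GI_mult[OF Y] GR_gx subgp_minus[OF Y] y0 GI_diff[OF Y] step2 tail)
    ultimately show ?case by simp
  qed
  then show ?thesis by (simp add: D_def)
qed

lemma expand: "p \<in> GR Y \<Longrightarrow> p - (\<Sum>i<n. hasse p $\<^sub>f i * T ^ i) \<in> GI Y n"
proof (induction rule: GR_induct)
  case (single l a)
  have "Poly_Mapping.single (\<pi> l) a * (gx (of_int (\<phi> l) *\<^sub>R y0) - (\<Sum>i<n. Poly_Mapping.single 0 (binom (\<phi> l) $\<^sub>f i) * T ^ i)) \<in> GI Y n"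
    using \<pi>_K[OF single] K_sub by (intro GI_mult[OF Y] GR_single expand_gx) auto
  moreover have "Poly_Mapping.single (\<pi> l) a * gx (of_int (\<phi> l) *\<^sub>R y0) = Poly_Mapping.single l a"
    by (simp add: gx_def mult_single \<pi>_def)
  ultimately show ?case
    by (simp add: right_diff_distrib gx_def mult_single \<pi>_def sum_distrib_left hasse_single flip: mult.assoc)
next
  case (add p q)
  from GI_add[OF this(3,4)] show ?case
    by (simp add: hasse_add distrib_right sum.distrib algebra_simps)
qed (simp add: GI_0)

context
  fixes b assumes b: "b \<in> K"
begin

text \<open>Since b lies in the kernel, \<open>1 - gx b\<close> is a constant series, and taking
  coefficients commutes with multiplying by it.\<close>

lemma hasse_Mod: "p \<in> Mod Y b n \<Longrightarrow> hasse p $\<^sub>f i \<in> Mod K b (n - i)"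
proof -
  assume "p \<in> Mod Y b n"
  then obtain y j where *: "p = (1 - gx b) * y + j" and mem: "y \<in> GR Y" "j \<in> GI Y n"
    by (auto simp: Mod_def)
  have gb: "(1 - gx b :: 'v \<Rightarrow>\<^sub>0 'k) \<in> GR K"
    by (intro GR_diff GR_1 subgp_K GR_gx b)
  then have "1 - gx b \<in> (GR Y :: ('v \<Rightarrow>\<^sub>0 'k) set)" using GR_mono[OF K_sub] by auto
  then have "hasse p $\<^sub>f i = (1 - gx b) * hasse y $\<^sub>f i + hasse j $\<^sub>f i"
    using mem by (simp add: * hasse_add hasse_mult hasse_K[OF gb])
  then show ?thesis
    by (rule ModI) (use mem in \<open>auto simp: hasse_GR hasse_GI\<close>)
qed

text \<open>Converse of \<open>hasse_Mod\<close>: the factor \<open>T ^ i\<close> restores the i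
  powers that the i-th coefficient may be missing.\<close>

lemma Mod_hasse:
  assumes p: "p \<in> GR Y" and h: "\<And>i. i < n \<Longrightarrow> hasse p $\<^sub>f i \<in> Mod K b (n - i)"
  shows "p \<in> Mod Y b n"
proof -
  have bY: "b \<in> Y" using b K_sub by auto
  have "hasse p $\<^sub>f i * T ^ i \<in> Mod Y b n" if i: "i < n" for i
  proof -
    have "hasse p $\<^sub>f i \<in> Mod Y b (n - i)"
      using h[OF i] GI_mono[OF K_sub] GR_mono[OF K_sub] by (fastforce simp: Mod_def)
    then have "T ^ i * hasse p $\<^sub>f i \<in> Mod Y b (i + (n - i))"
      by (intro Mod_mult_GI[OF Y] T_power bY)
    then show ?thesis using i by (simp add: mult.commute)
  qed
  then have "(\<Sum>i<n. hasse p $\<^sub>f i * T ^ i) \<in> Mod Y b n"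
    by (intro Mod_sum[OF Y bY]) auto
  from Mod_add[OF Y bY GI_Mod[OF Y bY expand[OF p, of n]] this] show ?thesis by simp
qed

text \<open>Let u = \<open>gx (\<pi> a)\<close>. Because \<open>\<phi> a\<close> is nonzero, some
  coefficient c E of (1 + T)^(\<phi> a) with E > 0 is nonzero. Comparing coefficients at l + E in (1
  - gx a) z expresses c E * u * z_l through (1 - u) * z_(l+E), the coefficients z_i with i < l, and
  a known term. As 1 - u has augmentation 0, it gains one power, so precision is raised step by
  step.\<close>

theorem Mod_coprime:
  assumes a: "a \<in> Y" "\<phi> a \<noteq> 0"
  shows "\<exists>m. \<forall>z\<in>GR Y. (1 - gx a) * z \<in> (Mod Y b m :: ('v \<Rightarrow>\<^sub>0 'k) set) \<longrightarrow> z \<in> Mod Y b n"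
proof -
  have K: "subgp K" by (rule subgp_K)
  define c where "c j = (binom (\<phi> a) $\<^sub>f j :: 'k)" for j
  have "\<exists>j>0. c j \<noteq> 0"
  proof (rule ccontr)
    assume "\<not> ?thesis"
    then have "binom (\<phi> a) $\<^sub>f n = (1 :: 'k fps) $\<^sub>f n" for n
      by (cases n) (auto simp: c_def)
    then have "binom (\<phi> a) = (1 :: 'k fps)"
      by (rule fps_ext)
    then show False using binom_neq_1[OF a(2)] by blast
  qed
  \<comment> \<open>In characteristic 0 this index is 1. In characteristic p the first coefficients
    can vanish, and the comparison must start at the first one that does not.\<close>
  define E where "E = (LEAST j. 0 < j \<and> c j \<noteq> 0)"
  from \<open>\<exists>j>0. c j \<noteq> 0\<close> have E: "E > 0" "c E \<noteq> 0"
    using LeastI_ex[of "\<lambda>j. 0 < j \<and> c j \<noteq> 0"] by (auto simp: E_def)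
  have least: "c j = 0" if "0 < j" "j < E" for j
    using not_less_Least[of j "\<lambda>j. 0 < j \<and> c j \<noteq> 0"] that by (auto simp: E_def)
  \<comment> \<open>Double induction: outer on the precision e, inner on the index l. Each gain of
    precision looks E indices further up, which explains the allowance e + l + e * E.\<close>
  have rec: "z\<^sub>l \<in> Mod K b e"
    if z: "z \<in> GR Y" "(1 - gx a) * z \<in> Mod Y b m" and m: "e + l + e * E \<le> m" and zl: "z\<^sub>l = hasse z $\<^sub>f l"
    for z m e l z\<^sub>l
    using m unfolding zl
  proof (induction e arbitrary: l)
    case 0
    show ?case by (intro Mod_trivial[OF K b] hasse_GR z)
  next
    case (Suc e)
    show ?case
      using Suc.prems
    proof (induction l rule: less_induct)
      case (less l)
      let ?z = "\<lambda>i. hasse z $\<^sub>f i"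
      let ?u = "gx (\<pi> a) :: 'v \<Rightarrow>\<^sub>0 'k"
      let ?s = "\<lambda>j. Poly_Mapping.single (\<pi> a) (c j) * ?z (l + E - j)"
      have hgx: "hasse (1 - gx a) $\<^sub>f j = (if j = 0 then 1 else 0) - Poly_Mapping.single (\<pi> a) (c j)" for j
        by (simp add: hasse_diff hasse_1 gx_def hasse_single c_def)
      have "hasse ((1 - gx a) * z) $\<^sub>f (l + E) = (\<Sum>j = 0..l + E. hasse (1 - gx a) $\<^sub>f j * ?z (l + E - j))"
        using a z by (simp add: hasse_mult GR_diff GR_1 GR_gx Y fps_mult_nth)
      also have "\<dots> = (\<Sum>j = 0..l + E. (if j = 0 then ?z (l + E) else 0) - ?s j)"
        by (intro sum.cong) (auto simp: hgx left_diff_distrib)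
      also have "\<dots> = ?z (l + E) - (\<Sum>j = 0..l + E. ?s j)"
        by (simp add: sum_subtractf)
      also have "(\<Sum>j = 0..l + E. ?s j) = (\<Sum>j\<in>{0, E} \<union> {E<..l + E}. ?s j)"
      proof (rule sum.mono_neutral_right)
        show "\<forall>i\<in>{0..l + E} - ({0, E} \<union> {E<..l + E}). ?s i = 0"
        proof
          fix i assume "i \<in> {0..l + E} - ({0, E} \<union> {E<..l + E})"
          then have "0 < i" "i < E" by auto
          then show "?s i = 0" by (simp add: least)
        qed
      qed auto
      also have "\<dots> = ?s 0 + ?s E + (\<Sum>j\<in>{E<..l + E}. ?s j)"
        using E by (subst sum.union_disjoint) auto
      finally have eqE: "?s E = (1 - ?u) * ?z (l + E) - hasse ((1 - gx a) * z) $\<^sub>f (l + E) - (\<Sum>j\<in>{E<..l + E}. ?s j)"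
        by (simp add: c_def gx_def left_diff_distrib)
      \<comment> \<open>The only place where precision grows: precision e at index l + E, from the
        outer hypothesis, plus one power from 1 - u.\<close>
      have "(1 - ?u) * ?z (l + E) \<in> Mod K b (Suc e)"
      proof -
        have "1 - ?u \<in> GI K 1"
          by (intro GI_1 K GR_diff GR_1 GR_gx \<pi>_K a) (simp add: augm_diff)
        moreover have "?z (l + E) \<in> Mod K b e"
          using less.prems by (intro Suc.IH) auto
        ultimately show ?thesis using Mod_mult_GI[OF K b] by fastforce
      qed
      moreover have "hasse ((1 - gx a) * z) $\<^sub>f (l + E) \<in> Mod K b (Suc e)"
        using less.prems by (intro Mod_antimono[OF K b _ hasse_Mod[OF z(2)]]) auto
      moreover have "(\<Sum>j\<in>{E<..l + E}. ?s j) \<in> Mod K b (Suc e)"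
        using less.prems by (intro Mod_sum Mod_mult[OF K b] K b GR_single \<pi>_K a less.IH) auto
      ultimately have sE: "?s E \<in> Mod K b (Suc e)"
        unfolding eqE by (intro Mod_diff[OF K b])
      have "Poly_Mapping.single (- \<pi> a) (inverse (c E)) * ?s E = ?z l"
        using E by (simp add: mult_single flip: mult.assoc)
      moreover have "Poly_Mapping.single (- \<pi> a) (inverse (c E)) * ?s E \<in> Mod K b (Suc e)"
        by (intro Mod_mult[OF K b] sE GR_single subgp_minus[OF K] \<pi>_K a)
      ultimately show ?case by simp
    qed
  qed
  show ?thesis
  \<comment> \<open>The allowance of \<open>rec\<close> for precision n at all indices l <
    n.\<close>
  proof (intro exI[of _ "n + n + n * E"] ballI impI)
    fix z :: "'v \<Rightarrow>\<^sub>0 'k"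
    assume z: "z \<in> GR Y" "(1 - gx a) * z \<in> Mod Y b (n + n + n * E)"
    show "z \<in> Mod Y b n"
    proof (rule Mod_hasse[OF z(1)])
      fix i assume i: "i < n"
      have "hasse z $\<^sub>f i \<in> Mod K b n"
        using i by (intro rec[OF z _ refl]) auto
      then show "hasse z $\<^sub>f i \<in> Mod K b (n - i)"
        by (rule Mod_antimono[OF K b, rotated]) simp
    qed
  qed
qed

end

end

section \<open>Linear algebra over commutative rings\<close>

text \<open>From A C = d one gets (C A - d) C = 0, hence det C annihilates C A - d by way of the
  adjugate. And det C is regular because det A * det C is a power of the regular element d.\<close>

lemma mat_flip:
  fixes A C :: "'r::comm_ring_1 mat"
  assumes A: "A \<in> carrier_mat n n" and C: "C \<in> carrier_mat n n" and AC: "A * C = d \<cdot>\<^sub>m 1\<^sub>m n"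
    and d: "\<And>x. d * x = 0 \<Longrightarrow> x = 0"
  shows "C * A = d \<cdot>\<^sub>m 1\<^sub>m n"
proof -
  have nz: "x = 0" if "d ^ m * x = 0" for m x
    using that by (induction m) (auto dest: d simp: mult.assoc)
  have "det A * det C = d ^ n"
    using det_mult[OF A C] AC by simp
  then have detC: "x = 0" if "det C * x = 0" for x
    using that nz[of n x] by (metis mult.assoc mult_zero_right)
  let ?M = "C * A - d \<cdot>\<^sub>m 1\<^sub>m n"
  have M: "?M \<in> carrier_mat n n" using A C by auto
  have adj: "adj_mat C \<in> carrier_mat n n" "C * adj_mat C = det C \<cdot>\<^sub>m 1\<^sub>m n"
    using adj_mat[OF C] by auto
  have "C * A * C = C * (A * C)" using A C by simp
  also have "\<dots> = d \<cdot>\<^sub>m C" using C by (simp add: AC mult_smult_distrib[OF C one_carrier_mat])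
  finally have "?M * C = 0\<^sub>m n n"
    using A C by (subst minus_mult_distrib_mat[of _ n n]) auto
  then have "?M * (C * adj_mat C) = 0\<^sub>m n n"
    using assoc_mult_mat[OF M C adj(1)] left_mult_zero_mat[OF adj(1), of n] by simp
  then have "det C \<cdot>\<^sub>m ?M = 0\<^sub>m n n"
    unfolding adj(2) using M by (subst (asm) mult_smult_distrib[of _ n n]) auto
  then have "(det C \<cdot>\<^sub>m ?M) $$ (i, j) = 0" if "i < n" "j < n" for i j
    using that by simp
  then have "det C * ?M $$ (i, j) = 0" if "i < n" "j < n" for i j
    using that M index_smult_mat(1)[of i ?M j "det C"] by (simp del: index_minus_mat)
  then have "?M $$ (i, j) = 0" if "i < n" "j < n" for i j
    using that detC by blast
  then show ?thesis
    using A C by (intro eq_matI) auto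
qed

text \<open>The same set indexes both sides, so the families are square matrices. It will be applied
  with S = W, which requires exactly one basis element for each element of W.\<close>

lemma sum_flip:
  fixes A C :: "'i \<Rightarrow> 'i \<Rightarrow> 'r::comm_ring_1"
  assumes S: "finite S" and d: "\<And>x. d * x = 0 \<Longrightarrow> x = 0"
    and AC: "\<And>s t. s \<in> S \<Longrightarrow> t \<in> S \<Longrightarrow> (\<Sum>w\<in>S. A s w * C w t) = (if s = t then d else 0)"
    and "u \<in> S" "w \<in> S"
  shows "(\<Sum>t\<in>S. C w t * A t u) = (if w = u then d else 0)"
proof -
  define n where "n = card S"
  obtain e where e: "bij_betw e {0..<n} S"
    using ex_bij_betw_nat_finite[OF S] by (auto simp: n_def)
  have eS: "e i \<in> S" if "i < n" for i using e that by (auto simp: bij_betw_def)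
  have inj: "e i = e j \<longleftrightarrow> i = j" if "i < n" "j < n" for i j
    using e that by (auto simp: bij_betw_def inj_on_def)
  define MA MC where "MA = mat n n (\<lambda>(i, j). A (e i) (e j))" and "MC = mat n n (\<lambda>(i, j). C (e i) (e j))"
  have sum: "(\<Sum>k = 0..<n. f (e k)) = sum f S" for f :: "'i \<Rightarrow> 'r"
    by (rule sum.reindex_bij_betw[OF e])
  have "MA * MC = d \<cdot>\<^sub>m 1\<^sub>m n"
  proof (rule eq_matI)
    fix i j assume "i < dim_row (d \<cdot>\<^sub>m 1\<^sub>m n)" "j < dim_col (d \<cdot>\<^sub>m 1\<^sub>m n)"
    then have ij: "i < n" "j < n" by auto
    then have "(MA * MC) $$ (i, j) = (\<Sum>w\<in>S. A (e i) w * C w (e j))"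
      using sum[of "\<lambda>w. A (e i) w * C w (e j)"] by (simp add: MA_def MC_def scalar_prod_def)
    then show "(MA * MC) $$ (i, j) = (d \<cdot>\<^sub>m 1\<^sub>m n) $$ (i, j)"
      using ij by (simp add: AC eS inj)
  qed (auto simp: MA_def MC_def)
  then have *: "MC * MA = d \<cdot>\<^sub>m 1\<^sub>m n"
    by (rule mat_flip[OF _ _ _ d, rotated 2]) (auto simp: MA_def MC_def)
  obtain i j where ij: "i < n" "j < n" "w = e i" "u = e j"
    using e assms(4,5) by (auto simp: bij_betw_def)
  have "(\<Sum>t\<in>S. C w t * A t u) = (MC * MA) $$ (i, j)"
    using ij sum[of "\<lambda>t. C (e i) t * A t (e j)"] by (simp add: MA_def MC_def scalar_prod_def)
  then show ?thesis using ij by (simp add: * inj)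
qed

section \<open>Divisibility in a quotient of a subring\<close>

text \<open>The ring C / N without forming a quotient: computations stay in the ambient ring type
  and end with a membership in N. The instances are the group algebra with N = {0}, and Cauchy
  sequences with null sequences.\<close>

locale subquot =
  fixes C N :: "'r::comm_ring_1 set"
  assumes C_1: "1 \<in> C" and C_diff: "x \<in> C \<Longrightarrow> y \<in> C \<Longrightarrow> x - y \<in> C"
    and C_mult: "x \<in> C \<Longrightarrow> y \<in> C \<Longrightarrow> x * y \<in> C"
    and N_0: "0 \<in> N" and N_diff: "x \<in> N \<Longrightarrow> y \<in> N \<Longrightarrow> x - y \<in> N"
    and N_mult: "x \<in> C \<Longrightarrow> y \<in> N \<Longrightarrow> x * y \<in> N"
begin

lemma C_0: "0 \<in> C" using C_diff[OF C_1 C_1] by simp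
lemma C_minus: "x \<in> C \<Longrightarrow> - x \<in> C" using C_diff[OF C_0] by simp
lemma C_add: "x \<in> C \<Longrightarrow> y \<in> C \<Longrightarrow> x + y \<in> C" using C_diff[of x "- y"] C_minus[of y] by simp
lemma C_sum: "(\<And>i. i \<in> I \<Longrightarrow> f i \<in> C) \<Longrightarrow> sum f I \<in> C"
  by (induction I rule: infinite_finite_induct) (auto simp: C_0 C_add)
lemma C_prod: "(\<And>i. i \<in> I \<Longrightarrow> f i \<in> C) \<Longrightarrow> prod f I \<in> C"
  by (induction I rule: infinite_finite_induct) (auto simp: C_1 C_mult)
lemma N_minus: "x \<in> N \<Longrightarrow> - x \<in> N" using N_diff[OF N_0] by simp
lemma N_add: "x \<in> N \<Longrightarrow> y \<in> N \<Longrightarrow> x + y \<in> N" using N_diff[of x "- y"] N_minus[of y] by simp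
lemma N_sum: "(\<And>i. i \<in> I \<Longrightarrow> f i \<in> N) \<Longrightarrow> sum f I \<in> N"
  by (induction I rule: infinite_finite_induct) (auto simp: N_0 N_add)

definition divs :: "'r \<Rightarrow> 'r \<Rightarrow> bool" where
  "divs f z \<longleftrightarrow> (\<exists>g\<in>C. z - f * g \<in> N)"

lemma divs_0: "divs f 0"
  unfolding divs_def using C_0 N_0 by (intro bexI[of _ 0]) auto

lemma divs_add: "divs f x \<Longrightarrow> divs f y \<Longrightarrow> divs f (x + y)"
proof -
  assume "divs f x" "divs f y"
  then obtain g h where "g \<in> C" "h \<in> C" "x - f * g \<in> N" "y - f * h \<in> N" by (auto simp: divs_def)
  then show ?thesis
    unfolding divs_def using N_add[of "x - f * g" "y - f * h"]
    by (intro bexI[of _ "g + h"]) (auto simp: C_add algebra_simps)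
qed

lemma divs_mult: "c \<in> C \<Longrightarrow> divs f x \<Longrightarrow> divs f (c * x)"
proof -
  assume c: "c \<in> C" and "divs f x"
  then obtain g where "g \<in> C" "x - f * g \<in> N" by (auto simp: divs_def)
  then show ?thesis
    unfolding divs_def using N_mult[OF c, of "x - f * g"] c
    by (intro bexI[of _ "c * g"]) (auto simp: C_mult algebra_simps)
qed

lemma divs_minus: "divs f x \<Longrightarrow> divs f (- x)"
  using divs_mult[of "- 1" f x] C_minus[OF C_1] by simp

lemma divs_diff: "divs f x \<Longrightarrow> divs f y \<Longrightarrow> divs f (x - y)"
  using divs_add[of f x "- y"] divs_minus[of f y] by simp

lemma divs_sum: "(\<And>i. i \<in> I \<Longrightarrow> divs f (x i)) \<Longrightarrow> divs f (sum x I)"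
  by (induction I rule: infinite_finite_induct) (auto simp: divs_0 divs_add)

lemma divs_N: "n \<in> N \<Longrightarrow> divs f n"
  unfolding divs_def using C_0 by (intro bexI[of _ 0]) auto

lemma divs_unit: "u \<in> C \<Longrightarrow> divs f z \<Longrightarrow> v * u = 1 \<Longrightarrow> v \<in> C \<Longrightarrow> divs (u * f) z"
proof -
  assume u: "u \<in> C" "v * u = 1" "v \<in> C" and "divs f z"
  then obtain g where g: "g \<in> C" "z - f * g \<in> N" by (auto simp: divs_def)
  have "u * f * (v * g) = (v * u) * (f * g)" by (simp add: algebra_simps)
  with g u show ?thesis unfolding divs_def by (intro bexI[of _ "v * g"]) (auto simp: C_mult)
qed

text \<open>The hypothesis \<open>cop\<close> says that \<open>f a\<close> is regular modulo
  \<open>f b\<close>. If z is already \<open>prod f S\<close> times y, then a further factor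
  \<open>f a\<close> of z must divide y, since the factors of \<open>prod f S\<close> can be
  cancelled modulo \<open>f a\<close>.\<close>

lemma divs_prod:
  assumes S: "finite S" and f: "\<And>a. a \<in> S \<Longrightarrow> f a \<in> C" and z: "z \<in> C"
    and cop: "\<And>a b y. a \<in> S \<Longrightarrow> b \<in> S \<Longrightarrow> a \<noteq> b \<Longrightarrow> y \<in> C \<Longrightarrow> divs (f b) (f a * y) \<Longrightarrow> divs (f b) y"
    and div: "\<And>a. a \<in> S \<Longrightarrow> divs (f a) z"
  shows "divs (prod f S) z"
  using S f cop div
proof (induction S)
  case empty
  then show ?case using z N_0 by (auto simp: divs_def intro!: bexI[of _ z])
next
  case (insert a S)
  note cop = insert.prems(2)
  have "divs (prod f S) z"
    using insert.prems by (intro insert.IH) auto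
  then obtain y where y: "y \<in> C" "z - prod f S * y \<in> N" by (auto simp: divs_def)
  have fS: "prod f T \<in> C" if "T \<subseteq> S" for T using insert.prems(1) that by (intro C_prod) auto
  have "divs (f a) z" using insert by blast
  from divs_diff[OF this divs_N[OF y(2)]] have "divs (f a) (prod f S * y)" by simp
  \<comment> \<open>Cancels the factors of the product one at a time; the partial products stay in
    C.\<close>
  moreover have "finite T \<Longrightarrow> T \<subseteq> S \<Longrightarrow> divs (f a) (prod f T * y) \<Longrightarrow> divs (f a) y" for T
  proof (induction T rule: finite_induct)
    case (insert b T)
    have "divs (f a) (f b * (prod f T * y))" using insert by (simp add: mult.assoc)
    then have "divs (f a) (prod f T * y)"
      using insert.prems \<open>a \<notin> S\<close> C_mult[OF fS y(1), of T] by (intro cop[of b a "prod f T * y"]) auto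
    then show ?case using insert by auto
  qed simp
  ultimately have "divs (f a) y" using insert.hyps by blast
  then obtain w where w: "w \<in> C" "y - f a * w \<in> N" by (auto simp: divs_def)
  have "(z - prod f S * y) + prod f S * (y - f a * w) \<in> N"
    by (intro N_add N_mult y w fS) simp
  then show ?case
    using w insert.hyps unfolding divs_def by (intro bexI[of _ w]) (auto simp: algebra_simps)
qed

end

no_notation Matrix.scalar_prod (infix "\<bullet>" 70)

section \<open>Leading terms in the group algebra\<close>

lemma lookup_gx_mult: "lookup (gx m * p) l = lookup p (l - m)"
  for p :: "'v::ab_group_add \<Rightarrow>\<^sub>0 'k::comm_ring_1"
proof (induction p rule: poly_mapping_additive_induct)
  case (single n a)
  show ?case by (auto simp: gx_def mult_single lookup_single when_def algebra_simps)
qed (simp add: distrib_left lookup_add)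

lemma lookup_mult_group: "lookup (p * q) \<nu> = (\<Sum>l\<in>keys p. lookup p l * lookup q (\<nu> - l))"
  for p :: "'v::ab_group_add \<Rightarrow>\<^sub>0 'k::comm_ring_1"
proof -
  have const: "lookup (Poly_Mapping.single 0 a * p) l = a * lookup p l" for a l and p :: "'v \<Rightarrow>\<^sub>0 'k"
    by (induction p rule: poly_mapping_additive_induct)
       (auto simp: mult_single lookup_single when_def distrib_left lookup_add)
  have "lookup (p * q) \<nu> = lin (\<lambda>l a. a * lookup q (\<nu> - l)) p"
  proof (induction p rule: poly_mapping_additive_induct)
    case (single l a)
    have "Poly_Mapping.single l a * q = Poly_Mapping.single 0 a * (gx l * q)"
      by (simp add: gx_def mult_single flip: mult.assoc)
    then show ?case by (simp add: const lookup_gx_mult lin_single)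
  next
    case (add p p')
    then show ?case by (subst lin_add) (auto simp: distrib_right lookup_add)
  qed
  then show ?thesis by (simp add: lin_def)
qed

text \<open>A unique highest exponent in direction \<xi> does the work of a monomial order. The
  value c = 0 is permitted, and then t is no exponent of d.\<close>

definition leading :: "'v::real_inner \<Rightarrow> ('v \<Rightarrow>\<^sub>0 'k::comm_ring_1) \<Rightarrow> 'v \<Rightarrow> 'k \<Rightarrow> bool" where
  "leading \<xi> d t c \<longleftrightarrow> lookup d t = c \<and> (\<forall>k\<in>keys d. k = t \<or> k \<bullet> \<xi> < t \<bullet> \<xi>)"

text \<open>Only d needs a unique top exponent. In q ties at the top are allowed: any other exponent
  k of d would require from q an exponent above the level of l.\<close>

lemma leading_lookup:
  assumes d: "leading \<xi> d t c" and q: "\<And>k. k \<in> keys q \<Longrightarrow> k \<bullet> \<xi> \<le> l \<bullet> \<xi>"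
  shows "lookup (d * q) (t + l) = c * lookup q l"
proof -
  have "lookup d k * lookup q (t + l - k) = (if k = t then c * lookup q l else 0)" if k: "k \<in> keys d" for k
  proof (cases "k = t")
    case False
    then have "k \<bullet> \<xi> < t \<bullet> \<xi>" using d k by (auto simp: leading_def)
    then have "\<not> (t + l - k) \<bullet> \<xi> \<le> l \<bullet> \<xi>" by (simp add: inner_add_left inner_diff_left)
    then have "lookup q (t + l - k) = 0" using q by (metis in_keys_iff)
    then show ?thesis using False by simp
  qed (use d in \<open>auto simp: leading_def\<close>)
  moreover have "c = 0" if "t \<notin> keys d" using d that by (auto simp: leading_def in_keys_iff)
  ultimately show ?thesis
    by (auto simp: lookup_mult_group cong: sum.cong)
qed

lemma leading_mult: "leading \<xi> d t c \<Longrightarrow> leading \<xi> e s b \<Longrightarrow> leading \<xi> (d * e) (t + s) (c * b)"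
proof -
  assume d: "leading \<xi> d t c" and e: "leading \<xi> e s b"
  have "lookup (d * e) (t + s) = c * b"
    using e by (subst leading_lookup[OF d]) (auto simp: leading_def less_imp_le)
  moreover have "k = t + s \<or> k \<bullet> \<xi> < (t + s) \<bullet> \<xi>" if k: "k \<in> keys (d * e)" for k
  proof -
    obtain x y where xy: "k = x + y" "x \<in> keys d" "y \<in> keys e" using keys_mult[of d e] k by auto
    then have "x = t \<or> x \<bullet> \<xi> < t \<bullet> \<xi>" "y = s \<or> y \<bullet> \<xi> < s \<bullet> \<xi>" using d e by (auto simp: leading_def)
    then show ?thesis using xy by (auto simp: inner_add_left)
  qed
  ultimately show ?thesis by (auto simp: leading_def)
qed

lemma leading_gx: "leading \<xi> (gx t :: _ \<Rightarrow>\<^sub>0 'k::field) t 1"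
  by (simp add: leading_def gx_def)

lemma leading_one_minus:
  assumes "a \<bullet> \<xi> < 0"
  shows "leading \<xi> (1 - gx a :: _ \<Rightarrow>\<^sub>0 'k::field) 0 1"
proof -
  have "a \<noteq> 0" using assms by auto
  then show ?thesis
    using assms by (auto simp: leading_def gx_def lookup_minus lookup_one lookup_single when_def in_keys_iff split: if_splits)
qed

lemma leading_minus_one:
  assumes "a \<bullet> \<xi> > 0"
  shows "leading \<xi> (1 - gx a :: _ \<Rightarrow>\<^sub>0 'k::field) a (- 1)"
proof -
  have "a \<noteq> 0" using assms by auto
  then show ?thesis
    using assms by (auto simp: leading_def gx_def lookup_minus lookup_one lookup_single when_def in_keys_iff split: if_splits)
qed

lemma leading_prod:
  assumes "\<And>a. a \<in> S \<Longrightarrow> leading \<xi> (f a :: _ \<Rightarrow>\<^sub>0 'k::field) (t a) (c a)"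
  shows "leading \<xi> (prod f S) (sum t S) (prod c S)"
  using assms leading_gx[of \<xi> 0] by (induction S rule: infinite_finite_induct) (auto simp: leading_mult)

lemma ex_max_key:
  assumes "q \<noteq> (0 :: 'v::real_inner \<Rightarrow>\<^sub>0 'k::zero)"
  shows "\<exists>l\<in>keys q. \<forall>k\<in>keys q. k \<bullet> \<xi> \<le> l \<bullet> \<xi>"
proof -
  have "keys q \<noteq> {}" using assms by (metis lookup_eq_zero_in_keys_contradict lookup_zero poly_mapping_eqI in_keys_iff empty_iff)
  then have "Max ((\<lambda>k. k \<bullet> \<xi>) ` keys q) \<in> (\<lambda>k. k \<bullet> \<xi>) ` keys q"
    by (intro Max_in) auto
  then obtain l where "l \<in> keys q" "Max ((\<lambda>k. k \<bullet> \<xi>) ` keys q) = l \<bullet> \<xi>" by auto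
  moreover have "k \<bullet> \<xi> \<le> Max ((\<lambda>k. k \<bullet> \<xi>) ` keys q)" if "k \<in> keys q" for k
    using that by (intro Max_ge) auto
  ultimately show ?thesis by auto
qed

lemma leading_nonzero_divisor:
  assumes d: "leading \<xi> d t c" and c: "c \<noteq> (0 :: 'k::field)" and 0: "d * q = 0"
  shows "q = 0"
proof (rule ccontr)
  assume "q \<noteq> 0"
  then obtain l where l: "l \<in> keys q" "\<And>k. k \<in> keys q \<Longrightarrow> k \<bullet> \<xi> \<le> l \<bullet> \<xi>" using ex_max_key[of q "\<xi>"] by blast
  have "lookup (d * q) (t + l) = c * lookup q l" by (rule leading_lookup[OF d l(2)])
  then show False using l c by (simp add: 0 in_keys_iff)
qed

text \<open>Comparing the lower ends of d and d * q shows that exponents of q are nonnegative on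
  \<xi>; comparing the upper ends shows that they are nonpositive. So q lives on level 0, where it
  can be read off from the top slice of d * q, which is a single term.\<close>

lemma leading_quotient_1:
  assumes d: "leading \<xi> d t 1" and d': "leading (- \<xi>) d t' c" "c \<noteq> (0 :: 'k::field)"
    and p: "leading \<xi> (d * q) t 1" and low: "\<And>k. k \<in> keys (d * q) \<Longrightarrow> t' \<bullet> \<xi> \<le> k \<bullet> \<xi>"
  shows "q = 1"
proof (cases "q = 0")
  case True
  then show ?thesis using p by (auto simp: leading_def)
next
  case False
  obtain l where l: "l \<in> keys q" "\<And>k. k \<in> keys q \<Longrightarrow> k \<bullet> \<xi> \<le> l \<bullet> \<xi>" using ex_max_key[OF False, of \<xi>] by blast
  obtain m where m: "m \<in> keys q" "\<And>k. k \<in> keys q \<Longrightarrow> k \<bullet> (- \<xi>) \<le> m \<bullet> (- \<xi>)" using ex_max_key[OF False, of "- \<xi>"] by blast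
  have "t' + m \<in> keys (d * q)"
    using leading_lookup[OF d'(1) m(2)] d'(2) m(1) by (simp add: in_keys_iff)
  then have m0: "0 \<le> m \<bullet> \<xi>" using low by (fastforce simp: inner_add_left)
  have "t + l \<in> keys (d * q)"
    using leading_lookup[OF d l(2)] l(1) by (simp add: in_keys_iff)
  then have l0: "l \<bullet> \<xi> \<le> 0" using p by (fastforce simp: leading_def inner_add_left)
  with m0 have level: "k \<bullet> \<xi> = 0" if "k \<in> keys q" for k
    using that l0 l(2)[OF that] m(2)[OF that] by simp
  have eq: "lookup (d * q) (t + k) = lookup q k" if "k \<bullet> \<xi> = 0" for k
    using that by (subst leading_lookup[OF d]) (auto simp: level)
  show ?thesis
  proof (rule poly_mapping_eqI)
    fix k
    consider "k = 0" | "k \<noteq> 0" "k \<in> keys q" | "k \<noteq> 0" "k \<notin> keys q" by blast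
    then show "lookup q k = lookup 1 k"
    proof cases
      case 1
      then show ?thesis using eq[of 0] p by (simp add: leading_def)
    next
      case 2
      then have "t + k \<in> keys (d * q)" using eq level by (simp add: in_keys_iff)
      then show ?thesis using p 2 level by (fastforce simp: leading_def inner_add_left)
    next
      case 3
      then show ?thesis by (simp add: in_keys_iff lookup_one)
    qed
  qed
qed

section \<open>Coprimality in the group algebra\<close>

definition level :: "'v::real_inner \<Rightarrow> real \<Rightarrow> ('v \<Rightarrow>\<^sub>0 'k::comm_ring_1) \<Rightarrow> ('v \<Rightarrow>\<^sub>0 'k)" where
  "level \<gamma> r p = Poly_Mapping.mapp (\<lambda>l a. if l \<bullet> \<gamma> = r then a else 0) p"

lemma lookup_level: "lookup (level \<gamma> r p) l = (if l \<bullet> \<gamma> = r then lookup p l else 0)"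
  by (simp add: level_def lookup_mapp when_def in_keys_iff)

lemma level_GR: "p \<in> GR Y \<Longrightarrow> level \<gamma> r p \<in> GR Y"
  by (auto simp: GR_def in_keys_iff lookup_level split: if_splits)

lemma level_diff: "level \<gamma> r (p - q) = level \<gamma> r p - level \<gamma> r q"
  by (rule poly_mapping_eqI) (simp add: lookup_level lookup_minus)

lemma level_gx_mult: "level \<gamma> r (gx m * p) = gx m * level \<gamma> (r - m \<bullet> \<gamma>) p"
  by (rule poly_mapping_eqI) (auto simp: lookup_level lookup_gx_mult inner_diff_left)

text \<open>Grade by \<gamma>: multiplication by \<open>1 - gx b\<close> preserves levels, while
  \<open>gx a\<close> shifts them. The extreme level of z is therefore itself a multiple of
  \<open>1 - gx b\<close>; removing it leaves fewer exponents. The sign of \<gamma> is chosen so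
  that the shift is upward.\<close>

lemma GR_coprime:
  assumes Y: "subgp Y" and a: "a \<in> Y" and b: "b \<in> Y"
    and \<gamma>: "a \<bullet> \<gamma> \<noteq> 0" "b \<bullet> \<gamma> = 0"
    and z: "z \<in> GR Y" and y: "y \<in> GR Y" and eq: "(1 - gx a) * z = (1 - gx b) * (y :: _ \<Rightarrow>\<^sub>0 'k::field)"
  shows "\<exists>x\<in>GR Y. z = (1 - gx b) * x"
proof -
  have pos: "\<exists>x\<in>GR Y. z = (1 - gx b) * x"
    if "a \<bullet> \<gamma> > 0" "b \<bullet> \<gamma> = 0" "z \<in> GR Y" "y \<in> GR Y" "(1 - gx a) * z = (1 - gx b) * y" for \<gamma> and z y :: "_ \<Rightarrow>\<^sub>0 'k"
    using that(3-)
  proof (induction "card (keys z)" arbitrary: z y rule: less_induct)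
    case less
    show ?case
    proof (cases "z = 0")
      case True
      then show ?thesis by (intro bexI[of _ 0]) (auto simp: GR_0)
    next
      case False
      then obtain l where l: "l \<in> keys z" "\<And>k. k \<in> keys z \<Longrightarrow> k \<bullet> \<gamma> \<le> l \<bullet> \<gamma>" using ex_max_key[OF False, of \<gamma>] by blast
      define M where "M = l \<bullet> \<gamma>"
      \<comment> \<open>Found by comparing both sides of the equation on level M + a \<bullet>
        \<gamma>, where z has no terms and the left side is just
        \<open>- (gx a * level \<gamma> M z)\<close>.\<close>
      define x where "x = - (gx (- a) * level \<gamma> (M + a \<bullet> \<gamma>) y)"
      have xY: "x \<in> GR Y"
        unfolding x_def by (intro GR_minus GR_mult Y GR_gx subgp_minus a level_GR less)
      have "level \<gamma> (M + a \<bullet> \<gamma>) z = 0"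
      proof (rule poly_mapping_eqI)
        fix k show "lookup (level \<gamma> (M + a \<bullet> \<gamma>) z) k = lookup 0 k"
          using l(2)[of k] that(1) by (cases "k \<in> keys z") (auto simp: lookup_level M_def in_keys_iff)
      qed
      then have "- (gx a * level \<gamma> M z) = level \<gamma> (M + a \<bullet> \<gamma>) ((1 - gx a) * z)"
        by (simp add: left_diff_distrib level_diff level_gx_mult)
      also have "\<dots> = (1 - gx b) * level \<gamma> (M + a \<bullet> \<gamma>) y"
        using that(2) unfolding less.prems(3) by (simp add: left_diff_distrib level_diff level_gx_mult)
      finally have neg: "- (gx a * level \<gamma> M z) = (1 - gx b) * level \<gamma> (M + a \<bullet> \<gamma>) y" .
      have "gx (- a) * (gx a * level \<gamma> M z) = - (gx (- a) * (- (gx a * level \<gamma> M z)))"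
        by simp
      also have "\<dots> = (1 - gx b) * x"
        unfolding neg x_def by (simp only: mult_minus_right mult.left_commute[of "gx (- a)" "1 - gx b"])
      finally have "gx (- a) * (gx a * level \<gamma> M z) = (1 - gx b) * x" .
      then have lM: "level \<gamma> M z = (1 - gx b) * x"
        by (simp add: gx_minus flip: mult.assoc)
      have "keys (z - level \<gamma> M z) \<subset> keys z"
        using l(1) by (auto simp: in_keys_iff lookup_minus lookup_level M_def split: if_splits)
      then have "card (keys (z - level \<gamma> M z)) < card (keys z)"
        by (intro psubset_card_mono) auto
      moreover have "(1 - gx a) * (z - level \<gamma> M z) = (1 - gx b) * (y - (1 - gx a) * x)"
        unfolding right_diff_distrib[of _ z] right_diff_distrib[of _ y] less.prems(3) lM
        by (simp only: mult.left_commute[of "1 - gx b" "1 - gx a"])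
      ultimately obtain x' where "x' \<in> GR Y" and x': "z - level \<gamma> M z = (1 - gx b) * x'"
        using less.hyps[of "z - level \<gamma> M z" "y - (1 - gx a) * x"]
          GR_diff[OF less.prems(1) level_GR[OF less.prems(1)]]
          GR_diff[OF less.prems(2) GR_mult[OF Y GR_diff[OF GR_1[OF Y] GR_gx[OF a]] xY]] by blast
      then show ?thesis
        using xY by (intro bexI[of _ "x' + x"]) (auto simp: GR_add distrib_left lM[symmetric] x'[symmetric])
    qed
  qed
  show ?thesis
  proof (cases "a \<bullet> \<gamma> > 0")
    case True
    then show ?thesis using pos[OF _ _ z y eq] \<gamma> by blast
  next
    case False
    then show ?thesis using pos[of "- \<gamma>", OF _ _ z y eq] \<gamma> by simp
  qed
qed

abbreviation finv :: "('a \<Rightarrow> 'b) \<Rightarrow> 'b \<Rightarrow> 'a" where "finv \<equiv> inv_into UNIV"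

section \<open>Reflections\<close>

lemma inner_coroot: "x \<bullet> coroot \<alpha> = 2 * (x \<bullet> \<alpha>) / (\<alpha> \<bullet> \<alpha>)"
  by (simp add: coroot_def)

lemma root_refl_alt: "root_refl \<alpha> v = v - (v \<bullet> coroot \<alpha>) *\<^sub>R \<alpha>"
  by (simp add: root_refl_def inner_coroot)

lemma root_refl_coroot: "root_refl \<alpha> v = v - (v \<bullet> \<alpha>) *\<^sub>R coroot \<alpha>"
  by (simp add: root_refl_def coroot_def)

lemma root_refl_linear: "linear (root_refl \<alpha>)"
  unfolding root_refl_alt[abs_def] by (intro linearI) (auto simp: inner_add_left algebra_simps)

lemma root_refl_self: "\<alpha> \<noteq> 0 \<Longrightarrow> root_refl \<alpha> \<alpha> = - \<alpha>"
  by (simp add: root_refl_def algebra_simps flip: scaleR_2)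

lemma coroot_self: "\<alpha> \<noteq> 0 \<Longrightarrow> \<alpha> \<bullet> coroot \<alpha> = 2"
  by (simp add: inner_coroot)

lemma root_refl_involution: "\<alpha> \<noteq> 0 \<Longrightarrow> root_refl \<alpha> (root_refl \<alpha> v) = v"
  by (simp add: root_refl_alt inner_diff_left coroot_self algebra_simps)

lemma root_refl_involution_comp: "\<alpha> \<noteq> 0 \<Longrightarrow> root_refl \<alpha> \<circ> root_refl \<alpha> = id"
  by (auto simp: root_refl_involution)

lemma root_refl_orth: "\<alpha> \<noteq> 0 \<Longrightarrow> orthogonal_transformation (root_refl \<alpha>)"
  unfolding orthogonal_transformation_def
  by (auto simp: root_refl_linear root_refl_def inner_diff_left inner_diff_right inner_commute field_simps)

lemma root_refl_uminus: "root_refl (- \<alpha>) = root_refl \<alpha>"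
  by (auto simp: root_refl_def)

lemma coroot_uminus: "coroot (- \<alpha>) = - coroot \<alpha>"
  by (simp add: coroot_def)

lemma coroot_orth: "orthogonal_transformation w \<Longrightarrow> coroot (w \<alpha>) = w (coroot \<alpha>)"
  by (auto simp: coroot_def orthogonal_transformation_def linear_cmul)

lemma root_refl_conj:
  assumes "orthogonal_transformation w"
  shows "root_refl (w \<alpha>) (w v) = w (root_refl \<alpha> v)"
  using assms by (auto simp: root_refl_def orthogonal_transformation_def linear_diff linear_cmul)

lemma root_refl_conj_comp:
  assumes "orthogonal_transformation w"
  shows "root_refl (w \<alpha>) \<circ> w = w \<circ> root_refl \<alpha>"
  using root_refl_conj[OF assms] by auto

lemma orth_inner: "orthogonal_transformation w \<Longrightarrow> w x \<bullet> w y = x \<bullet> y"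
  by (simp add: orthogonal_transformation_def)

lemma orth_inv_left: "orthogonal_transformation w \<Longrightarrow> finv w (w x) = x"
  for w :: "'v::euclidean_space \<Rightarrow> 'v"
  by (simp add: orthogonal_transformation_inj)

lemma orth_inv_right: "orthogonal_transformation w \<Longrightarrow> w (finv w x) = x"
  for w :: "'v::euclidean_space \<Rightarrow> 'v"
  by (simp add: orthogonal_transformation_surj surj_f_inv_f)

lemma orth_adjoint: "orthogonal_transformation w \<Longrightarrow> w x \<bullet> y = x \<bullet> finv w y"
  for w :: "'v::euclidean_space \<Rightarrow> 'v"
  by (metis orth_inner orth_inv_right)

lemma inner_self_nonpos: "x \<bullet> x \<le> 0 \<longleftrightarrow> x = 0" for x :: "'v::real_inner"
  using inner_gt_zero_iff[of x] by (auto simp: not_less[symmetric])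

text \<open>Move a vector that is good for F along the new element a: every b with b \<bullet> a
  nonzero forbids one value of the parameter t, and the others keep their value.\<close>

lemma ex_generic_vector:
  fixes F :: "'v::euclidean_space set"
  assumes "finite F" "0 \<notin> F"
  shows "\<exists>\<xi>. \<forall>a\<in>F. a \<bullet> \<xi> \<noteq> 0"
  using assms
proof (induction F)
  case (insert a F)
  then obtain \<xi> where \<xi>: "\<forall>a\<in>F. a \<bullet> \<xi> \<noteq> 0" by auto
  let ?B = "insert (- (a \<bullet> \<xi>) / (a \<bullet> a)) ((\<lambda>b. - (b \<bullet> \<xi>) / (b \<bullet> a)) ` F)"
  have "finite ?B" using insert by simp
  then obtain t where t: "t \<notin> ?B" using ex_new_if_finite[OF infinite_UNIV_char_0] by blast
  have "b \<bullet> (\<xi> + t *\<^sub>R a) \<noteq> 0" if b: "b \<in> insert a F" for b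
  proof
    assume 0: "b \<bullet> (\<xi> + t *\<^sub>R a) = 0"
    show False
    proof (cases "b \<bullet> a = 0")
      case True
      then show False using 0 \<xi> b insert.prems by (auto simp: inner_add_right)
    next
      case False
      then have "t = - (b \<bullet> \<xi>) / (b \<bullet> a)" using 0 by (simp add: inner_add_right field_simps)
      then show False using t b by auto
    qed
  qed
  then show ?case by blast
qed simp

section \<open>Root systems\<close>

locale rootsys =
  fixes \<Phi> :: "'v::euclidean_space set"
  assumes root_system: "root_system \<Phi>"
begin

abbreviation "W \<equiv> weyl \<Phi>"
abbreviation "X \<equiv> cochar \<Phi>"

lemma finite_roots: "finite \<Phi>" and root_nz: "\<alpha> \<in> \<Phi> \<Longrightarrow> \<alpha> \<noteq> 0" and span_roots: "span \<Phi> = UNIV"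
  and root_refl_root: "\<alpha> \<in> \<Phi> \<Longrightarrow> \<beta> \<in> \<Phi> \<Longrightarrow> root_refl \<alpha> \<beta> \<in> \<Phi>"
  and root_int: "\<alpha> \<in> \<Phi> \<Longrightarrow> \<beta> \<in> \<Phi> \<Longrightarrow> \<beta> \<bullet> coroot \<alpha> \<in> \<int>"
  and root_scale: "\<alpha> \<in> \<Phi> \<Longrightarrow> c *\<^sub>R \<alpha> \<in> \<Phi> \<Longrightarrow> c = 1 \<or> c = - 1"
  using root_system by (auto simp: root_system_def inner_coroot)

lemma root_uminus: "\<alpha> \<in> \<Phi> \<Longrightarrow> - \<alpha> \<in> \<Phi>"
  using root_refl_root[of \<alpha> \<alpha>] by (simp add: root_refl_self root_nz)

lemma weyl_orth: "w \<in> W \<Longrightarrow> orthogonal_transformation w"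
proof (induction rule: weyl.induct)
  case weyl_id
  then show ?case by (simp add: id_def)
next
  case (weyl_step w \<alpha>)
  then show ?case
    by (intro orthogonal_transformation_compose root_refl_orth root_nz)
qed

lemma weyl_linear: "w \<in> W \<Longrightarrow> linear w"
  by (simp add: weyl_orth orthogonal_transformation_linear)

lemma weyl_inner: "w \<in> W \<Longrightarrow> w x \<bullet> w y = x \<bullet> y"
  by (rule orth_inner[OF weyl_orth])

lemma weyl_bij: "w \<in> W \<Longrightarrow> bij w"
  by (rule orthogonal_transformation_bij[OF weyl_orth])

lemma weyl_comp: "w \<in> W \<Longrightarrow> u \<in> W \<Longrightarrow> w \<circ> u \<in> W"
proof (induction rule: weyl.induct)
  case (weyl_step w \<alpha>)
  then show ?case using weyl.weyl_step[of "w \<circ> u" \<Phi> \<alpha>] by (simp only: comp_assoc)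
qed simp

lemma weyl_refl: "\<alpha> \<in> \<Phi> \<Longrightarrow> root_refl \<alpha> \<in> W"
  using weyl_step[OF weyl_id] by simp

lemma weyl_inv: "w \<in> W \<Longrightarrow> finv w \<in> W"
proof (induction rule: weyl.induct)
  case weyl_id
  then show ?case by (simp only: inv_id weyl.weyl_id)
next
  case (weyl_step w \<alpha>)
  have "finv (root_refl \<alpha>) = root_refl \<alpha>"
    using weyl_step root_refl_involution_comp[OF root_nz] by (intro inv_unique_comp) auto
  then have "finv (root_refl \<alpha> \<circ> w) = finv w \<circ> root_refl \<alpha>"
    using weyl_step weyl_bij weyl_refl by (simp add: o_inv_distrib)
  then show ?case using weyl_comp[OF weyl_step(3) weyl_refl[OF weyl_step(2)]] by (simp only:)
qed

lemma weyl_inv_left: "w \<in> W \<Longrightarrow> finv w (w x) = x"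
  by (rule orth_inv_left[OF weyl_orth])

lemma weyl_inv_right: "w \<in> W \<Longrightarrow> w (finv w x) = x"
  by (rule orth_inv_right[OF weyl_orth])

lemma weyl_adjoint: "w \<in> W \<Longrightarrow> w x \<bullet> y = x \<bullet> finv w y"
  by (rule orth_adjoint[OF weyl_orth])

lemma weyl_root: "w \<in> W \<Longrightarrow> \<beta> \<in> \<Phi> \<Longrightarrow> w \<beta> \<in> \<Phi>"
  by (induction arbitrary: \<beta> rule: weyl.induct) (auto simp: root_refl_root)

lemma weyl_finite: "finite W"
proof -
  have "inj_on (\<lambda>w. restrict w \<Phi>) W"
  proof (rule inj_onI)
    fix w u assume wu: "w \<in> W" "u \<in> W" and eq: "restrict w \<Phi> = restrict u \<Phi>"
    have "w b = u b" if "b \<in> \<Phi>" for b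
      using fun_cong[OF eq, of b] that by simp
    then have "w x = u x" for x
      using linear_eq_on_span[OF weyl_linear[OF wu(1)] weyl_linear[OF wu(2)], of \<Phi> x] span_roots by blast
    then show "w = u" by auto
  qed
  moreover have "(\<lambda>w. restrict w \<Phi>) ` W \<subseteq> \<Phi> \<rightarrow>\<^sub>E \<Phi>"
    by (auto simp: weyl_root)
  ultimately show ?thesis
    using finite_PiE[OF finite_roots, of "\<lambda>_. \<Phi>"] finite_roots by (meson finite_imageD finite_subset)
qed

lemma subgp_X: "subgp X"
  by (auto simp: subgp_def cochar_def inner_diff_right)

lemma coroot_X: "\<alpha> \<in> \<Phi> \<Longrightarrow> coroot \<alpha> \<in> X"
  by (auto simp: cochar_def root_int)

lemma weyl_X: "w \<in> W \<Longrightarrow> x \<in> X \<Longrightarrow> w x \<in> X"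
  using weyl_adjoint[of w x] weyl_root[OF weyl_inv, of w]
  by (auto simp: cochar_def inner_commute)

section \<open>Positive and simple roots\<close>

definition \<xi> :: 'v where "\<xi> = (SOME \<xi>. \<forall>a\<in>\<Phi>. a \<bullet> \<xi> \<noteq> 0)"

definition P :: "'v set" where "P = {a \<in> \<Phi>. a \<bullet> \<xi> > 0}"

text \<open>Simple roots are the indecomposable positive roots; that they form a basis is derived
  from their obtuse angles.\<close>

definition \<Delta> :: "'v set" where "\<Delta> = {a \<in> P. \<forall>b\<in>P. \<forall>c\<in>P. a \<noteq> b + c}"

lemma \<xi>_generic: "a \<in> \<Phi> \<Longrightarrow> a \<bullet> \<xi> \<noteq> 0"
proof -
  have "\<exists>\<xi>. \<forall>a\<in>\<Phi>. a \<bullet> \<xi> \<noteq> 0" using ex_generic_vector[OF finite_roots] root_nz by blast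
  then have "\<forall>a\<in>\<Phi>. a \<bullet> \<xi> \<noteq> 0" unfolding \<xi>_def by (rule someI_ex)
  then show "a \<in> \<Phi> \<Longrightarrow> a \<bullet> \<xi> \<noteq> 0" by blast
qed

lemma P_root: "a \<in> P \<Longrightarrow> a \<in> \<Phi>" and simple_P: "a \<in> \<Delta> \<Longrightarrow> a \<in> P"
  by (auto simp: P_def \<Delta>_def)

lemma simple_root: "a \<in> \<Delta> \<Longrightarrow> a \<in> \<Phi>"
  by (simp add: P_root simple_P)

lemma finite_P: "finite P" and finite_simple: "finite \<Delta>"
  using finite_roots by (auto simp: P_def \<Delta>_def)

lemma P_cases: "a \<in> \<Phi> \<Longrightarrow> a \<notin> P \<longleftrightarrow> - a \<in> P"
  using \<xi>_generic[of a] root_uminus[of a] by (auto simp: P_def)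

text \<open>Both Cartan integers are positive. If one of them is 1, the difference is, up to sign, a
  reflected root. If both are at least 2, Cauchy-Schwarz becomes an equality, so a and b are
  proportional, which reducedness and the sign of a \<bullet> b exclude.\<close>

lemma root_diff:
  assumes a: "a \<in> \<Phi>" and b: "b \<in> \<Phi>" and ne: "a \<noteq> b" and pos: "a \<bullet> b > 0"
  shows "a - b \<in> \<Phi>"
proof -
  have nz: "a \<bullet> a > 0" "b \<bullet> b > 0" using root_nz a b by auto
  obtain p q where p: "a \<bullet> coroot b = of_int p" and q: "b \<bullet> coroot a = of_int q"
    using root_int[OF a b] root_int[OF b a] by (auto elim!: Ints_cases)
  have "p > 0" "q > 0"
    using p q pos nz by (metis divide_pos_pos inner_commute inner_coroot mult_pos_pos of_int_0_less_iff zero_less_numeral)+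
  consider "p = 1" | "q = 1" | "p \<ge> 2" "q \<ge> 2" using \<open>p > 0\<close> \<open>q > 0\<close> by linarith
  then show ?thesis
  proof cases
    case 1
    then show ?thesis using root_refl_root[OF b a] p by (simp add: root_refl_alt)
  next
    case 2
    then have "b - a \<in> \<Phi>" using root_refl_root[OF a b] q by (simp add: root_refl_alt)
    from root_uminus[OF this] show ?thesis by simp
  next
    case 3
    define c where "c = (a \<bullet> b) / (b \<bullet> b)"
    have "of_int p * of_int q \<ge> (2 * 2 :: real)" using 3 by (intro mult_mono) auto
    then have "4 \<le> (2 * (a \<bullet> b) / (b \<bullet> b)) * (2 * (a \<bullet> b) / (a \<bullet> a))"
      using p q by (simp add: inner_coroot inner_commute)
    then have ineq: "(a \<bullet> a) * (b \<bullet> b) \<le> (a \<bullet> b) * (a \<bullet> b)"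
      using nz by (simp add: field_simps)
    have "(a - c *\<^sub>R b) \<bullet> (a - c *\<^sub>R b) = a \<bullet> a - (a \<bullet> b) * (a \<bullet> b) / (b \<bullet> b)"
      using nz by (simp add: inner_diff_left inner_diff_right inner_commute c_def field_simps)
    also have "\<dots> \<le> 0" using ineq nz by (simp add: field_simps)
    finally have ac: "a = c *\<^sub>R b" by (simp add: inner_self_nonpos)
    then have "c = 1 \<or> c = - 1" using root_scale[OF b, of c] a by simp
    moreover have "c > 0" using pos nz by (simp add: c_def)
    ultimately show ?thesis using ac ne by auto
  qed
qed

text \<open>At an acute angle a - b would be a root, and then one of a, b would be the other plus a
  positive root.\<close>

lemma simple_obtuse: "a \<in> \<Delta> \<Longrightarrow> b \<in> \<Delta> \<Longrightarrow> a \<noteq> b \<Longrightarrow> a \<bullet> b \<le> 0"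
proof (rule ccontr)
  assume ab: "a \<in> \<Delta>" "b \<in> \<Delta>" "a \<noteq> b" and "\<not> a \<bullet> b \<le> 0"
  then have "a - b \<in> \<Phi>" using root_diff simple_root by simp
  then consider "a - b \<in> P" | "b - a \<in> P" using P_cases by fastforce
  then show False
  proof cases
    case 1
    then have "a \<noteq> (a - b) + b" using ab simple_P[OF ab(2)] unfolding \<Delta>_def by blast
    then show False by simp
  next
    case 2
    then have "b \<noteq> (b - a) + a" using ab simple_P[OF ab(1)] unfolding \<Delta>_def by blast
    then show False by simp
  qed
qed

lemma P_nonneg_combination: "a \<in> P \<Longrightarrow> \<exists>c::'v \<Rightarrow> nat. a = (\<Sum>d\<in>\<Delta>. of_nat (c d) *\<^sub>R d)"
proof (induction "card {b \<in> P. b \<bullet> \<xi> < a \<bullet> \<xi>}" arbitrary: a rule: less_induct)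
  case less
  show ?case
  proof (cases "a \<in> \<Delta>")
    case True
    then show ?thesis
      by (intro exI[of _ "\<lambda>d. if d = a then 1 else 0"])
         (simp add: if_distrib[of of_nat] if_distrib[of "\<lambda>r. r *\<^sub>R _"] finite_simple cong: if_cong)
  next
    case False
    then obtain b c where bc: "b \<in> P" "c \<in> P" "a = b + c" using less.prems by (auto simp: \<Delta>_def)
    have sub: "card {x \<in> P. x \<bullet> \<xi> < b \<bullet> \<xi>} < card {x \<in> P. x \<bullet> \<xi> < a \<bullet> \<xi>}"
      if "b \<in> P" "b \<bullet> \<xi> < a \<bullet> \<xi>" for b
      using that finite_P by (intro psubset_card_mono) auto
    have "b \<bullet> \<xi> < a \<bullet> \<xi>" "c \<bullet> \<xi> < a \<bullet> \<xi>" using bc by (auto simp: P_def inner_add_left)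
    then obtain e f :: "'v \<Rightarrow> nat" where "b = (\<Sum>d\<in>\<Delta>. of_nat (e d) *\<^sub>R d)" "c = (\<Sum>d\<in>\<Delta>. of_nat (f d) *\<^sub>R d)"
      using less.hyps[OF sub] bc by metis
    then have "a = (\<Sum>d\<in>\<Delta>. of_nat (e d + f d) *\<^sub>R d)"
      by (simp add: bc scaleR_add_left sum.distrib)
    then show ?thesis by (intro exI[of _ "\<lambda>d. e d + f d"])
  qed
qed

lemma simple_span: "span \<Delta> = UNIV"
proof -
  have P: "a \<in> span \<Delta>" if aP: "a \<in> P" for a
  proof -
    obtain c :: "'v \<Rightarrow> nat" where "a = (\<Sum>d\<in>\<Delta>. of_nat (c d) *\<^sub>R d)" using P_nonneg_combination[OF aP] by blast
    then show ?thesis by (simp only:) (intro span_sum span_scale span_base)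
  qed
  have "\<Phi> \<subseteq> span \<Delta>"
  proof
    fix a assume "a \<in> \<Phi>"
    then show "a \<in> span \<Delta>" using P[of a] span_neg[OF P[of "- a"]] P_cases[of a] by auto
  qed
  then show ?thesis using span_roots span_mono[of \<Phi> "span \<Delta>"] by (auto simp: span_span)
qed

text \<open>Pairwise obtuse vectors in an open half-space are independent. In a relation the part x
  with positive coefficients is minus the rest, so x \<bullet> x is nonpositive and x = 0; pairing x
  with \<xi> then rules out positive coefficients. The same for the negated relation.\<close>

lemma simple_independent: "independent \<Delta>"
proof (rule independent_if_scalars_zero[OF finite_simple])
  fix u :: "'v \<Rightarrow> real" and a assume sum0: "(\<Sum>d\<in>\<Delta>. u d *\<^sub>R d) = 0" and a: "a \<in> \<Delta>"
  have pos: "v d \<le> 0" if v0: "(\<Sum>d\<in>\<Delta>. v d *\<^sub>R d) = 0" and d: "d \<in> \<Delta>" for v :: "'v \<Rightarrow> real" and d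
  proof -
    define A B where "A = {d \<in> \<Delta>. v d > 0}" and "B = {d \<in> \<Delta>. v d \<le> 0}"
    have AB: "A \<union> B = \<Delta>" "A \<inter> B = {}" and fin: "finite A" "finite B"
      using finite_simple by (auto simp: A_def B_def)
    define x where "x = (\<Sum>d\<in>A. v d *\<^sub>R d)"
    have "x + (\<Sum>d\<in>B. v d *\<^sub>R d) = 0"
      unfolding x_def using sum.union_disjoint[OF fin AB(2), of "\<lambda>d. v d *\<^sub>R d"] v0 AB by simp
    then have xB: "x = - (\<Sum>d\<in>B. v d *\<^sub>R d)" by (simp add: eq_neg_iff_add_eq_0)
    have "x \<bullet> x = x \<bullet> - (\<Sum>d\<in>B. v d *\<^sub>R d)" using xB by simp
    also have "\<dots> = - (\<Sum>c\<in>B. \<Sum>d\<in>A. v c * v d * (d \<bullet> c))"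
      by (simp add: x_def inner_sum_left inner_sum_right sum_distrib_left mult_ac)
    also have "\<dots> \<le> 0"
    proof -
      have "v c * v d * (d \<bullet> c) \<ge> 0" if "c \<in> B" "d \<in> A" for c d
      proof -
        have "d \<bullet> c \<le> 0" using that by (intro simple_obtuse) (auto simp: A_def B_def)
        moreover have "v c * v d \<le> 0" using that by (auto simp: A_def B_def mult_nonpos_nonneg)
        ultimately show ?thesis by (rule mult_nonpos_nonpos[rotated])
      qed
      then show ?thesis by (auto intro!: sum_nonneg)
    qed
    finally have "x = 0" by (simp add: inner_self_nonpos)
    then have "(\<Sum>d\<in>A. v d * (d \<bullet> \<xi>)) = 0"
      using inner_sum_left[of "\<lambda>d. v d *\<^sub>R d" A \<xi>] by (simp add: x_def)
    moreover have "v d * (d \<bullet> \<xi>) \<ge> 0" if "d \<in> A" for d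
      using that simple_P by (fastforce simp: A_def P_def)
    ultimately have 0: "v d * (d \<bullet> \<xi>) = 0" if "d \<in> A" for d
      using sum_nonneg_eq_0_iff[OF fin(1), of "\<lambda>d. v d * (d \<bullet> \<xi>)"] that by auto
    show "v d \<le> 0"
    proof (rule ccontr)
      assume "\<not> v d \<le> 0"
      then have "d \<in> A" using d by (auto simp: A_def)
      then show False using 0[of d] \<xi>_generic[OF simple_root[OF d]] by (auto simp: A_def)
    qed
  qed
  have "(\<Sum>d\<in>\<Delta>. (- u d) *\<^sub>R d) = 0" using sum0 by (simp add: sum_negf)
  from pos[OF this a] pos[OF sum0 a] show "u a = 0" by simp
qed

section \<open>Fundamental coweights and half the sum of the positive coroots\<close>

definition fw :: "'v \<Rightarrow> 'v" where
  "fw a = (SOME w. \<forall>d\<in>\<Delta>. d \<bullet> w = (if d = a then 1 else 0))"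

lemma simple_fw: "d \<in> \<Delta> \<Longrightarrow> d \<bullet> fw a = (if d = a then 1 else 0)"
proof -
  obtain g :: "'v \<Rightarrow> real" where g: "linear g" "\<forall>x\<in>\<Delta>. g x = (if x = a then 1 else 0)"
    using linear_independent_extend[OF simple_independent, of "\<lambda>x. if x = a then 1 else 0"] by blast
  \<comment> \<open>The functional g is the inner product with the vector
    \<open>adjoint g 1\<close>.\<close>
  have "\<forall>d\<in>\<Delta>. d \<bullet> adjoint g 1 = (if d = a then 1 else 0)"
    using g by (simp add: adjoint_works)
  then have "\<exists>w. \<forall>d\<in>\<Delta>. d \<bullet> w = (if d = a then 1 else 0)" by blast
  then have "\<forall>d\<in>\<Delta>. d \<bullet> fw a = (if d = a then 1 else 0)"
    unfolding fw_def by (rule someI_ex)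
  then show "d \<in> \<Delta> \<Longrightarrow> d \<bullet> fw a = (if d = a then 1 else 0)" by blast
qed

lemma simple_expansion: "x = (\<Sum>d\<in>\<Delta>. (x \<bullet> fw d) *\<^sub>R d)"
proof (rule linear_eq_on_span[of "\<lambda>x. x" "\<lambda>x. \<Sum>d\<in>\<Delta>. (x \<bullet> fw d) *\<^sub>R d" \<Delta>])
  show "linear (\<lambda>x. \<Sum>d\<in>\<Delta>. (x \<bullet> fw d) *\<^sub>R d)"
    by (intro linearI) (auto simp: inner_add_left scaleR_add_left sum.distrib scaleR_sum_right)
  fix d assume "d \<in> \<Delta>"
  then show "d = (\<Sum>e\<in>\<Delta>. (d \<bullet> fw e) *\<^sub>R e)"
    by (simp add: simple_fw if_distrib[of "\<lambda>r. r *\<^sub>R _"] finite_simple cong: if_cong)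
qed (auto simp: simple_span intro: linearI)

lemma P_fw: "a \<in> P \<Longrightarrow> a \<bullet> fw d \<ge> 0" and P_fw_int: "a \<in> P \<Longrightarrow> d \<in> \<Delta> \<Longrightarrow> a \<bullet> fw d \<in> \<int>"
proof -
  assume "a \<in> P"
  then obtain c :: "'v \<Rightarrow> nat" where c: "a = (\<Sum>d\<in>\<Delta>. of_nat (c d) *\<^sub>R d)" using P_nonneg_combination by blast
  have "a \<bullet> fw d = (if d \<in> \<Delta> then of_nat (c d) else 0)"
    unfolding c by (auto simp: inner_sum_left simple_fw if_distrib[of "\<lambda>r. _ * r"] finite_simple cong: if_cong)
  then show "a \<bullet> fw d \<ge> 0" "d \<in> \<Delta> \<Longrightarrow> a \<bullet> fw d \<in> \<int>" by auto
qed

text \<open>Here adjoint type is used: \<open>cochar\<close> is the full dual of the root lattice,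
  and roots are integral combinations of simple ones.\<close>

lemma fw_X: "d \<in> \<Delta> \<Longrightarrow> fw d \<in> X"
  unfolding cochar_def
proof safe
  fix a assume d: "d \<in> \<Delta>" and "a \<in> \<Phi>"
  then consider "a \<in> P" | "- a \<in> P" using P_cases by blast
  then show "a \<bullet> fw d \<in> \<int>"
    using P_fw_int[OF _ d, of a] Ints_minus[OF P_fw_int[OF _ d, of "- a"]] by cases auto
qed

text \<open>By reducedness b has a positive coefficient at some simple root other than a. Reflection
  in a does not change that coefficient, and one positive coefficient makes a root positive.\<close>

lemma simple_refl_P:
  assumes a: "a \<in> \<Delta>" and b: "b \<in> P" "b \<noteq> a"
  shows "root_refl a b \<in> P"
proof -
  have "\<exists>d\<in>\<Delta> - {a}. b \<bullet> fw d \<noteq> 0"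
  proof (rule ccontr)
    assume "\<not> ?thesis"
    then have "(\<Sum>d\<in>\<Delta>. (b \<bullet> fw d) *\<^sub>R d) = (b \<bullet> fw a) *\<^sub>R a"
      using a finite_simple by (subst sum.remove[of _ a]) (auto intro!: sum.neutral)
    then have ba: "b = (b \<bullet> fw a) *\<^sub>R a" using simple_expansion[of b] by simp
    then have "b \<bullet> fw a = 1 \<or> b \<bullet> fw a = - 1"
      using root_scale[OF simple_root[OF a], of "b \<bullet> fw a"] P_root[OF b(1)] by simp
    moreover have "b \<bullet> fw a \<ge> 0" using P_fw b by blast
    ultimately have "b \<bullet> fw a = 1" by auto
    then show False using ba b by simp
  qed
  then obtain d where d: "d \<in> \<Delta>" "d \<noteq> a" "b \<bullet> fw d > 0" using P_fw[OF b(1)] by (metis DiffE insertI1 order_le_less)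
  have "root_refl a b \<bullet> fw d > 0"
    using d a by (simp add: root_refl_alt inner_diff_left simple_fw)
  then have "- root_refl a b \<notin> P" using P_fw[of "- root_refl a b" d] by auto
  then show ?thesis
    using P_cases[OF root_refl_root[OF simple_root[OF a] P_root[OF b(1)]]] by blast
qed

text \<open>Built from coroots, not roots, because the exponents of the group algebra are
  cocharacters.\<close>

definition \<rho> :: 'v where "\<rho> = (1/2) *\<^sub>R (\<Sum>a\<in>P. coroot a)"

text \<open>The reflection in a permutes the positive roots other than a and negates a, so it moves
  \<rho> by exactly one coroot of a.\<close>

lemma \<rho>_simple: "a \<in> \<Delta> \<Longrightarrow> \<rho> \<bullet> a = 1"
proof -
  assume a: "a \<in> \<Delta>"
  have nz: "a \<noteq> 0" using root_nz simple_root a by blast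
  have orth: "orthogonal_transformation (root_refl a)" by (rule root_refl_orth[OF nz])
  have "bij_betw (root_refl a) (P - {a}) (P - {a})"
  proof (rule bij_betw_byWitness[where f' = "root_refl a"])
    have "root_refl a b \<noteq> a" if "b \<in> P" for b
    proof
      assume "root_refl a b = a"
      then have "b = - a" using root_refl_involution[OF nz, of b] root_refl_self[OF nz] by simp
      then show False using that P_cases[OF simple_root[OF a]] simple_P[OF a] by auto
    qed
    then show "root_refl a ` (P - {a}) \<subseteq> P - {a}" using simple_refl_P[OF a] by auto
    then show "root_refl a ` (P - {a}) \<subseteq> P - {a}" .
  qed (auto simp: root_refl_involution[OF nz])
  then have "(\<Sum>b\<in>P - {a}. coroot (root_refl a b)) = (\<Sum>b\<in>P - {a}. coroot b)"
    by (rule sum.reindex_bij_betw)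
  then have inva: "root_refl a (\<Sum>b\<in>P - {a}. coroot b) = (\<Sum>b\<in>P - {a}. coroot b)"
    by (simp add: coroot_orth[OF orth] linear_sum[OF root_refl_linear])
  have "root_refl a (coroot a) = - coroot a"
    by (simp add: coroot_orth[OF orth, symmetric] root_refl_self[OF nz] coroot_uminus)
  moreover have split: "(\<Sum>b\<in>P. coroot b) = coroot a + (\<Sum>b\<in>P - {a}. coroot b)"
    using finite_P simple_P[OF a] by (rule sum.remove)
  ultimately have "root_refl a \<rho> = \<rho> - coroot a"
    unfolding \<rho>_def split by (simp add: linear_cmul[OF root_refl_linear] linear_add[OF root_refl_linear] inva algebra_simps flip: scaleR_2)
  then have "(\<rho> \<bullet> a) *\<^sub>R coroot a = 1 *\<^sub>R coroot a" by (simp add: root_refl_coroot)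
  moreover have "coroot a \<noteq> 0" using coroot_self[OF nz] by auto
  ultimately show ?thesis using scaleR_right_imp_eq by blast
qed

lemma \<rho>_sum_fw: "\<rho> = (\<Sum>d\<in>\<Delta>. fw d)"
proof -
  have "(\<rho> - (\<Sum>d\<in>\<Delta>. fw d)) \<bullet> x = 0" for x
  proof -
    have "(\<rho> - (\<Sum>d\<in>\<Delta>. fw d)) \<bullet> a = 0" if "a \<in> \<Delta>" for a
      using that by (simp add: inner_diff_left \<rho>_simple inner_sum_left inner_commute[of "fw _" a] simple_fw finite_simple)
    then show ?thesis by (subst simple_expansion[of x]) (simp add: inner_sum_right)
  qed
  then show ?thesis by (metis eq_iff_diff_eq_0 inner_eq_zero_iff)
qed

lemma \<rho>_X: "\<rho> \<in> X"
proof -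
  have "finite S \<Longrightarrow> S \<subseteq> \<Delta> \<Longrightarrow> (\<Sum>d\<in>S. fw d) \<in> X" for S
    by (induction S rule: finite_induct) (auto simp: subgp_0[OF subgp_X] subgp_add[OF subgp_X] fw_X)
  then show ?thesis using finite_simple by (simp add: \<rho>_sum_fw)
qed

lemma inner_\<rho>: "x \<bullet> \<rho> = (\<Sum>d\<in>\<Delta>. x \<bullet> fw d)"
  by (simp add: \<rho>_sum_fw inner_sum_right)

text \<open>The cone of nonnegative real combinations of simple roots, since pairing with
  \<open>fw d\<close> reads off the coefficient of d. Pairing with \<rho> adds up the coefficients,
  hence detects 0 within the cone.\<close>

definition pos :: "'v \<Rightarrow> bool" where "pos x \<longleftrightarrow> (\<forall>d\<in>\<Delta>. x \<bullet> fw d \<ge> 0)"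

lemma pos_\<rho>: "pos x \<Longrightarrow> x \<bullet> \<rho> \<ge> 0" and pos_\<rho>_0: "pos x \<Longrightarrow> x \<bullet> \<rho> = 0 \<Longrightarrow> x = 0"
proof -
  assume p: "pos x"
  then show "x \<bullet> \<rho> \<ge> 0" by (auto simp: inner_\<rho> pos_def intro!: sum_nonneg)
  assume "x \<bullet> \<rho> = 0"
  then have "\<forall>d\<in>\<Delta>. x \<bullet> fw d = 0"
    using p sum_nonneg_eq_0_iff[OF finite_simple, of "\<lambda>d. x \<bullet> fw d"] by (auto simp: inner_\<rho> pos_def)
  then show "x = 0" using simple_expansion[of x] by simp
qed

lemma P_pos: "a \<in> P \<Longrightarrow> pos a"
  by (simp add: pos_def P_fw)

lemma pos_add: "pos x \<Longrightarrow> pos y \<Longrightarrow> pos (x + y)" and pos_scale: "c \<ge> 0 \<Longrightarrow> pos x \<Longrightarrow> pos (c *\<^sub>R x)"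
  by (auto simp: pos_def inner_add_left)

lemma P_coroot_pos: "a \<in> P \<Longrightarrow> pos (coroot a)"
  unfolding coroot_def by (intro pos_scale P_pos) auto

lemma P_\<rho>: "a \<in> P \<Longrightarrow> a \<bullet> \<rho> > 0"
  using pos_\<rho>[OF P_pos, of a] pos_\<rho>_0[OF P_pos, of a] root_nz[OF P_root, of a] by force

text \<open>\<rho> defines the same positive system as the arbitrary \<xi>, so an element of W that
  fixes \<rho> preserves positivity.\<close>

lemma P_iff: "a \<in> \<Phi> \<Longrightarrow> a \<in> P \<longleftrightarrow> a \<bullet> \<rho> > 0"
  using P_\<rho>[of a] P_\<rho>[of "- a"] P_cases[of a] by fastforce

lemma root_\<rho>: "a \<in> \<Phi> \<Longrightarrow> a \<bullet> \<rho> \<noteq> 0"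
  using P_\<rho>[of a] P_\<rho>[of "- a"] P_cases[of a] by fastforce

lemma ex_simple_acute: "b \<in> P \<Longrightarrow> \<exists>a\<in>\<Delta>. b \<bullet> a > 0"
proof (rule ccontr)
  assume b: "b \<in> P" and "\<not> (\<exists>a\<in>\<Delta>. b \<bullet> a > 0)"
  then have "(\<Sum>d\<in>\<Delta>. (b \<bullet> fw d) * (b \<bullet> d)) \<le> 0"
    using P_fw[OF b] by (intro sum_nonpos mult_nonneg_nonpos) auto
  moreover have "b \<bullet> b = (\<Sum>d\<in>\<Delta>. (b \<bullet> fw d) * (b \<bullet> d))"
    by (subst (2) simple_expansion[of b]) (simp add: inner_sum_right)
  ultimately have "b \<bullet> b \<le> 0" by simp
  then show False using root_nz[OF P_root[OF b]] inner_self_nonpos by blast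
qed

text \<open>A nonsimple positive root makes an acute angle with some simple root; reflecting in that
  simple root keeps it positive and strictly lowers its value on \<rho>.\<close>

lemma P_induct [consumes 1, case_names simple refl]:
  assumes "b \<in> P"
    and simple: "\<And>a. a \<in> \<Delta> \<Longrightarrow> Q a"
    and refl: "\<And>a c. a \<in> \<Delta> \<Longrightarrow> c \<in> P \<Longrightarrow> root_refl a c \<in> P \<Longrightarrow> Q c \<Longrightarrow> Q (root_refl a c)"
  shows "Q b"
  using assms(1)
proof (induction "card {c \<in> P. c \<bullet> \<rho> < b \<bullet> \<rho>}" arbitrary: b rule: less_induct)
  case less
  show ?case
  proof (cases "b \<in> \<Delta>")
    case False
    obtain a where a: "a \<in> \<Delta>" "b \<bullet> a > 0" using ex_simple_acute less.prems by blast
    have nz: "a \<noteq> 0" using root_nz simple_root a by blast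
    define c where "c = root_refl a b"
    have c: "c \<in> P" unfolding c_def using False a less.prems by (intro simple_refl_P) auto
    have "(b \<bullet> coroot a) * (a \<bullet> \<rho>) > 0" using a \<rho>_simple[OF a(1)] nz by (simp add: inner_coroot inner_commute)
    then have "c \<bullet> \<rho> < b \<bullet> \<rho>" by (simp add: c_def root_refl_alt inner_diff_left)
    then have "Q c" using c finite_P by (intro less.hyps psubset_card_mono) auto
    moreover have "root_refl a c = b" by (simp add: c_def root_refl_involution[OF nz])
    ultimately show ?thesis using refl[OF a(1) c] less.prems by simp
  qed (simp add: simple)
qed

end

section \<open>The Weyl group\<close>

context rootsys
begin

fun word :: "'v list \<Rightarrow> 'v \<Rightarrow> 'v" where
  "word [] = id"
| "word (a # as) = root_refl a \<circ> word as"

lemma word_append: "word (as @ bs) = word as \<circ> word bs"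
  by (induction as) (auto simp: comp_assoc)

lemma word_weyl: "set as \<subseteq> \<Delta> \<Longrightarrow> word as \<in> W"
  by (induction as) (auto simp: weyl_id weyl_step simple_root)

lemma refl_word: "b \<in> P \<Longrightarrow> \<exists>as. set as \<subseteq> \<Delta> \<and> root_refl b = word as"
proof (induction rule: P_induct)
  case (simple a)
  then show ?case by (intro exI[of _ "[a]"]) auto
next
  case (refl a c)
  then obtain as where as: "set as \<subseteq> \<Delta>" "root_refl c = word as" by blast
  have nz: "a \<noteq> 0" using root_nz simple_root refl(1) by blast
  have "root_refl (root_refl a c) \<circ> root_refl a \<circ> root_refl a = root_refl a \<circ> root_refl c \<circ> root_refl a"
    by (simp only: root_refl_conj_comp[OF root_refl_orth[OF nz]])
  then have "root_refl (root_refl a c) = root_refl a \<circ> root_refl c \<circ> root_refl a"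
    by (simp only: comp_assoc root_refl_involution_comp[OF nz] comp_id)
  also have "\<dots> = word (a # as @ [a])" by (simp add: word_append as comp_assoc)
  finally show ?case using as refl by (intro exI[of _ "a # as @ [a]"]) auto
qed

lemma weyl_word: "w \<in> W \<Longrightarrow> \<exists>as. set as \<subseteq> \<Delta> \<and> w = word as"
proof (induction rule: weyl.induct)
  case weyl_id
  then show ?case by (intro exI[of _ "[]"]) auto
next
  case (weyl_step w \<alpha>)
  obtain as where "set as \<subseteq> \<Delta>" "root_refl \<alpha> = word as"
    using refl_word[of \<alpha>] refl_word[of "- \<alpha>"] P_cases[OF weyl_step(2)] by (metis root_refl_uminus)
  moreover obtain bs where "set bs \<subseteq> \<Delta>" "w = word bs" using weyl_step by blast
  ultimately show ?case by (intro exI[of _ "as @ bs"]) (auto simp: word_append)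
qed

text \<open>Reading the word from the right, c turns negative at some letter. Just before that it
  equals the simple root of this letter, and conjugating the reflection in c up to there cancels the
  letter.\<close>

lemma exchange:
  assumes "set as \<subseteq> \<Delta>" "c \<in> P" "word as c \<notin> P"
  shows "\<exists>bs. set bs \<subseteq> \<Delta> \<and> length bs < length as \<and> word as \<circ> root_refl c = word bs"
  using assms
proof (induction as)
  case (Cons a as)
  have as: "set as \<subseteq> \<Delta>" and a: "a \<in> \<Delta>" using Cons.prems by auto
  show ?case
  proof (cases "word as c \<in> P")
    case True
    then have "word as c = a" using simple_refl_P[OF a True] Cons.prems by auto
    then have "word as \<circ> root_refl c = root_refl a \<circ> word as"
      using root_refl_conj_comp[OF weyl_orth[OF word_weyl[OF as]], of c] by simp
    then have "word (a # as) \<circ> root_refl c = word as"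
      using root_refl_involution_comp[OF root_nz[OF simple_root[OF a]]]
      by (simp add: comp_assoc flip: comp_assoc[of "root_refl a" "root_refl a"])
    then show ?thesis using as by (intro exI[of _ as]) (simp only: word.simps list.size, simp)
  next
    case False
    then obtain bs where "set bs \<subseteq> \<Delta>" "length bs < length as" "word as \<circ> root_refl c = word bs"
      using Cons.IH as Cons.prems by blast
    moreover from this have "word (a # as) \<circ> root_refl c = word (a # bs)" by (simp only: word.simps comp_assoc)
    ultimately show ?thesis using a by (intro exI[of _ "a # bs"]) (simp only: list.set list.size, simp)
  qed
qed simp

text \<open>In a shortest word the last letter a must be sent to a negative root by the preceding
  letters, because w itself keeps a positive; \<open>exchange\<close> then shortens the
  word.\<close>

lemma weyl_free:
  assumes w: "w \<in> W" and pres: "\<And>a. a \<in> P \<Longrightarrow> w a \<in> P"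
  shows "w = id"
proof -
  define Q where "Q as \<longleftrightarrow> set as \<subseteq> \<Delta> \<and> w = word as" for as
  have "\<exists>as. Q as" using weyl_word[OF w] by (auto simp: Q_def)
  then obtain as where as: "Q as" and least: "\<And>bs. Q bs \<Longrightarrow> length as \<le> length bs"
    using ex_has_least_nat[of Q _ length] by blast
  show ?thesis
  proof (cases as rule: rev_cases)
    case Nil
    then show ?thesis using as by (simp add: Q_def)
  next
    case (snoc bs a)
    have a: "a \<in> \<Delta>" and bs: "set bs \<subseteq> \<Delta>" and wa: "w = word bs \<circ> root_refl a"
      using as by (auto simp: Q_def snoc word_append)
    have "w a = - word bs a"
      using root_refl_self[OF root_nz[OF simple_root[OF a]]] linear_neg[OF weyl_linear[OF word_weyl[OF bs]]]
      by (simp add: wa)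
    then have "word bs a \<notin> P"
      using pres[OF simple_P[OF a]] P_cases[OF weyl_root[OF word_weyl[OF bs] simple_root[OF a]]] by simp
    then obtain cs where "set cs \<subseteq> \<Delta>" "length cs < length bs" "w = word cs"
      using exchange[OF bs simple_P[OF a]] wa by blast
    then have "Q cs" "length cs < length as" by (auto simp: Q_def snoc)
    then show ?thesis using least by fastforce
  qed
qed

lemma weyl_fix_\<rho>: "w \<in> W \<Longrightarrow> w \<rho> = \<rho> \<Longrightarrow> w = id"
proof (rule weyl_free)
  fix a assume "w \<in> W" "w \<rho> = \<rho>" "a \<in> P"
  moreover from this have "w a \<bullet> \<rho> = a \<bullet> \<rho>" using weyl_inner[of w a \<rho>] by simp
  ultimately show "w a \<in> P" using P_iff weyl_root P_root P_\<rho> by metis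
qed

section \<open>Dominant vectors\<close>

definition dominant :: "'v \<Rightarrow> bool" where "dominant t \<longleftrightarrow> (\<forall>a\<in>\<Delta>. t \<bullet> a \<ge> 0)"

lemma dominant_P: "dominant t \<Longrightarrow> b \<in> P \<Longrightarrow> t \<bullet> b \<ge> 0"
  by (subst simple_expansion[of b]) (auto simp: inner_sum_right dominant_def P_fw intro!: sum_nonneg)

lemma dominant_\<rho>: "dominant \<rho>"
  by (auto simp: dominant_def \<rho>_simple)

text \<open>If the word without its last letter a keeps a positive, that letter subtracts a
  nonnegative multiple of a positive coroot. Otherwise \<open>exchange\<close> supplies a shorter
  word for the same element.\<close>

lemma dominant_word: "set as \<subseteq> \<Delta> \<Longrightarrow> dominant t \<Longrightarrow> pos (t - word as t)"
proof (induction "length as" arbitrary: as rule: less_induct)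
  case less
  show ?case
  proof (cases as rule: rev_cases)
    case Nil
    then show ?thesis by (simp add: pos_def)
  next
    case (snoc bs a)
    have a: "a \<in> \<Delta>" and bs: "set bs \<subseteq> \<Delta>" and w: "word as = word bs \<circ> root_refl a"
      using less.prems by (auto simp: snoc word_append)
    have lin: "linear (word bs)" and orth: "orthogonal_transformation (word bs)"
      using weyl_linear weyl_orth word_weyl bs by auto
    show ?thesis
    proof (cases "word bs a \<in> P")
      case True
      have eq: "t - word as t = (t - word bs t) + (t \<bullet> a) *\<^sub>R coroot (word bs a)"
        by (simp add: w root_refl_coroot linear_diff[OF lin] linear_cmul[OF lin] coroot_orth[OF orth])
      have "pos (t - word bs t)" using less.hyps[of bs] less.prems bs by (simp add: snoc)
      moreover have "pos ((t \<bullet> a) *\<^sub>R coroot (word bs a))"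
        using less.prems a by (intro pos_scale P_coroot_pos True) (auto simp: dominant_def)
      ultimately show ?thesis unfolding eq by (rule pos_add)
    next
      case False
      then obtain cs where "set cs \<subseteq> \<Delta>" "length cs < length bs" "word as = word cs"
        using exchange[OF bs simple_P[OF a]] w by auto
      then show ?thesis using less.hyps[of cs] less.prems by (simp add: snoc)
    qed
  qed
qed

lemma dominant_weyl: "w \<in> W \<Longrightarrow> dominant t \<Longrightarrow> pos (t - w t)"
  using weyl_word dominant_word by blast

text \<open>Take the point of the orbit with the largest value on \<rho>: reflecting it in a simple
  root cannot increase that value.\<close>

lemma ex_dominant: "\<exists>w\<in>W. dominant (w x)"
proof -
  let ?f = "\<lambda>w. w x \<bullet> \<rho>"
  have "Max (?f ` W) \<in> ?f ` W" using weyl_finite weyl_id by (intro Max_in) auto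
  then obtain w where w: "w \<in> W" "Max (?f ` W) = ?f w" by blast
  have max: "?f u \<le> ?f w" if "u \<in> W" for u
    using that weyl_finite unfolding w(2)[symmetric] by (intro Max_ge) auto
  have "w x \<bullet> a \<ge> 0" if a: "a \<in> \<Delta>" for a
  proof -
    have "root_refl a (w x) \<bullet> \<rho> \<le> w x \<bullet> \<rho>" using max[OF weyl_step[OF w(1) simple_root[OF a]]] by simp
    then have "(w x \<bullet> a) * (coroot a \<bullet> \<rho>) \<ge> 0" by (simp add: root_refl_coroot inner_diff_left)
    moreover have "coroot a \<bullet> \<rho> > 0"
      using \<rho>_simple[OF a] root_nz[OF simple_root[OF a]] by (simp add: coroot_def inner_commute)
    ultimately show ?thesis by (simp add: zero_le_mult_iff)
  qed
  then show ?thesis using w by (auto simp: dominant_def)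
qed

lemma dominant_\<rho>_nonneg: "dominant y \<Longrightarrow> y \<bullet> \<rho> \<ge> 0"
  and dominant_\<rho>_0: "dominant y \<Longrightarrow> y \<bullet> \<rho> = 0 \<Longrightarrow> y = 0"
proof -
  assume y: "dominant y"
  have eq: "y \<bullet> \<rho> = 1/2 * (\<Sum>b\<in>P. y \<bullet> coroot b)" by (simp add: \<rho>_def inner_sum_right)
  have ge: "y \<bullet> coroot b \<ge> 0" if "b \<in> P" for b
    using dominant_P[OF y that] by (simp add: inner_coroot)
  then show "y \<bullet> \<rho> \<ge> 0" unfolding eq by (simp add: sum_nonneg)
  assume "y \<bullet> \<rho> = 0"
  then have 0: "y \<bullet> coroot b = 0" if "b \<in> P" for b
    using sum_nonneg_eq_0_iff[OF finite_P, of "\<lambda>b. y \<bullet> coroot b"] ge that by (simp add: eq)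
  have "y \<bullet> b = 0" if "b \<in> \<Delta>" for b
    using 0[OF simple_P[OF that]] root_nz[OF simple_root[OF that]] by (simp add: inner_coroot)
  then have "y \<bullet> y = 0" by (subst (2) simple_expansion[of y]) (simp add: inner_sum_right)
  then show "y = 0" by simp
qed

text \<open>The weights of Steinberg's basis and the order in which their Gram matrix is triangular.\<close>

definition sw :: "('v \<Rightarrow> 'v) \<Rightarrow> 'v" where
  "sw w = (\<Sum>a\<in>{a \<in> \<Delta>. w a \<notin> P}. fw a)"

definition sless :: "('v \<Rightarrow> 'v) \<Rightarrow> ('v \<Rightarrow> 'v) \<Rightarrow> bool" where
  "sless u v \<longleftrightarrow> sw u \<bullet> \<rho> < sw v \<bullet> \<rho> \<or> (sw u \<bullet> \<rho> = sw v \<bullet> \<rho> \<and> u \<rho> \<bullet> \<rho> < v \<rho> \<bullet> \<rho>)"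

lemma sless_irrefl: "\<not> sless u u" and sless_trans: "sless u v \<Longrightarrow> sless v w \<Longrightarrow> sless u w"
  by (auto simp: sless_def)

lemma sw_simple: "a \<in> \<Delta> \<Longrightarrow> sw w \<bullet> a = (if w a \<in> P then 0 else 1)"
  using finite_simple by (auto simp: sw_def inner_sum_left inner_commute[of "fw _"] simple_fw)

lemma sw_X: "sw w \<in> X"
proof -
  have "finite S \<Longrightarrow> S \<subseteq> \<Delta> \<Longrightarrow> (\<Sum>d\<in>S. fw d) \<in> X" for S
    by (induction S rule: finite_induct) (auto simp: subgp_0[OF subgp_X] subgp_add[OF subgp_X] fw_X)
  then show ?thesis using finite_simple by (simp add: sw_def)
qed

lemma sw_dominant: "dominant (sw w)" and sw_codominant: "dominant (\<rho> - sw w)"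
  by (auto simp: dominant_def sw_simple inner_diff_left \<rho>_simple)

text \<open>The vector \<rho> - p^-1 \<rho> lies in the positive cone, and it is orthogonal to t
  because p fixes t. Expanded over simple roots the pairing with t is a sum of nonnegative terms, so
  all of them vanish.\<close>

lemma stabilizer_defect:
  assumes p: "p \<in> W" and t: "dominant t" "p t = t"
    and a: "a \<in> \<Delta>" "t \<bullet> a > 0"
  shows "(\<rho> - finv p \<rho>) \<bullet> fw a = 0"
proof -
  let ?E = "\<rho> - finv p \<rho>"
  have E: "pos ?E" by (rule dominant_weyl[OF weyl_inv[OF p] dominant_\<rho>])
  have "finv p \<rho> \<bullet> t = \<rho> \<bullet> t"
    using weyl_adjoint[OF p, of t \<rho>] t(2) by (simp add: inner_commute)
  then have "0 = ?E \<bullet> t" by (simp add: inner_diff_left)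
  also have "\<dots> = (\<Sum>d\<in>\<Delta>. (?E \<bullet> fw d) * (t \<bullet> d))"
    by (subst simple_expansion[of ?E]) (simp add: inner_sum_left inner_sum_right inner_commute[of t])
  finally have "(\<Sum>d\<in>\<Delta>. (?E \<bullet> fw d) * (t \<bullet> d)) = 0" by simp
  then have "(?E \<bullet> fw a) * (t \<bullet> a) = 0"
    using E t(1) a(1) by (subst (asm) sum_nonneg_eq_0_iff[OF finite_simple]) (auto simp: pos_def dominant_def)
  then show ?thesis using a by simp
qed

text \<open>Moving the regular element \<mu> into the dominant chamber presents
  \<open>sw v - sw u\<close> as a sum of three terms that are nonnegative on \<rho>. This settles
  the first comparison in \<open>sless\<close>. In the case of equality all three terms vanish, and
  u \<rho> and v \<rho> are compared through the common element x^-1 \<rho>.\<close>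

lemma steinberg_triangular:
  assumes v: "v \<in> W" and u: "u \<in> W" and reg: "\<And>\<alpha>. \<alpha> \<in> \<Phi> \<Longrightarrow> \<alpha> \<bullet> (v (sw v) + u (\<rho> - sw u)) \<noteq> 0"
  shows "u = v \<or> sless u v"
proof -
  define \<mu> where "\<mu> = v (sw v) + u (\<rho> - sw u)"
  have \<mu>X: "\<mu> \<in> X"
    unfolding \<mu>_def
    by (rule subgp_add[OF subgp_X weyl_X[OF v sw_X] weyl_X[OF u subgp_diff[OF subgp_X \<rho>_X sw_X]]])
  obtain x where x: "x \<in> W" "dominant (x \<mu>)" using ex_dominant by blast
  define p q where "p = x \<circ> v" and "q = x \<circ> u"
  have p: "p \<in> W" and q: "q \<in> W" using weyl_comp x v u by (auto simp: p_def q_def)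
  have x\<mu>: "x \<mu> = p (sw v) + q (\<rho> - sw u)"
    by (simp add: \<mu>_def p_def q_def linear_add[OF weyl_linear[OF x(1)]])
  have dom: "dominant (x \<mu> - \<rho>)"
    unfolding dominant_def
  proof
    fix a assume a: "a \<in> \<Delta>"
    have "finv x a \<bullet> \<mu> \<noteq> 0"
      unfolding \<mu>_def by (rule reg[OF weyl_root[OF weyl_inv[OF x(1)] simple_root[OF a]]])
    then have "x \<mu> \<bullet> a \<noteq> 0" using weyl_adjoint[OF x(1), of \<mu> a] by (simp add: inner_commute)
    moreover have "x \<mu> \<bullet> a \<in> \<int>"
      using weyl_X[OF x(1) \<mu>X] simple_root[OF a] by (simp add: cochar_def inner_commute)
    moreover have "x \<mu> \<bullet> a \<ge> 0" using x(2) a by (simp add: dominant_def)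
    \<comment> \<open>Regularity and integrality turn nonnegative into at least 1, the value of
      \<rho> on a simple root; so \<rho> can be subtracted without leaving the dominant
      cone.\<close>
    ultimately have "x \<mu> \<bullet> a \<ge> 1" by (auto elim!: Ints_cases)
    then show "(x \<mu> - \<rho>) \<bullet> a \<ge> 0" using \<rho>_simple[OF a] by (simp add: inner_diff_left)
  qed
  define D1 D2 where "D1 = sw v - p (sw v)" and "D2 = (\<rho> - sw u) - q (\<rho> - sw u)"
  have D: "pos D1" "pos D2" unfolding D1_def D2_def by (intro dominant_weyl p q sw_dominant sw_codominant)+
  have eq: "sw v - sw u = (x \<mu> - \<rho>) + (D1 + D2)" by (simp add: x\<mu> D1_def D2_def)
  have ineq: "(x \<mu> - \<rho>) \<bullet> \<rho> \<ge> 0" "D1 \<bullet> \<rho> \<ge> 0" "D2 \<bullet> \<rho> \<ge> 0"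
    using dominant_\<rho>_nonneg[OF dom] pos_\<rho> D by auto
  have diff: "sw v \<bullet> \<rho> - sw u \<bullet> \<rho> = (x \<mu> - \<rho>) \<bullet> \<rho> + D1 \<bullet> \<rho> + D2 \<bullet> \<rho>"
    using arg_cong[OF eq, of "\<lambda>y. y \<bullet> \<rho>"] by (simp add: inner_diff_left inner_add_left)
  show ?thesis
  proof (cases "sw u \<bullet> \<rho> < sw v \<bullet> \<rho>")
    case True
    then show ?thesis by (simp add: sless_def)
  next
    case False
    then have 0: "(x \<mu> - \<rho>) \<bullet> \<rho> = 0" "D1 \<bullet> \<rho> = 0" "D2 \<bullet> \<rho> = 0"
      using ineq diff by linarith+
    have D0: "D1 = 0" "D2 = 0" using pos_\<rho>_0 D 0 by auto
    have "x \<mu> - \<rho> = 0" using dominant_\<rho>_0[OF dom 0(1)] .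
    then have sw_eq: "sw u = sw v" using eq D0 by simp
    have pfix: "p (sw v) = sw v" and qfix: "q (\<rho> - sw u) = \<rho> - sw u" using D0 by (auto simp: D1_def D2_def)
    have same: "v a \<in> P \<longleftrightarrow> u a \<in> P" if "a \<in> \<Delta>" for a
      using sw_simple[OF that, of u] sw_simple[OF that, of v] sw_eq by (auto split: if_splits)
    \<comment> \<open>Coefficients of E vanish at simple roots that v makes negative, those of F at
      simple roots that u keeps positive. Hence v E is nonnegative and u F nonpositive on
      \<rho>.\<close>
    define E F where "E = \<rho> - finv p \<rho>" and "F = \<rho> - finv q \<rho>"
    have E: "pos E" and F: "pos F"
      unfolding E_def F_def by (intro dominant_weyl weyl_inv p q dominant_\<rho>)+
    have E0: "E \<bullet> fw a = 0" if "a \<in> \<Delta>" "v a \<notin> P" for a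
      unfolding E_def using that by (intro stabilizer_defect[OF p sw_dominant pfix]) (auto simp: sw_simple)
    have F0: "F \<bullet> fw a = 0" if "a \<in> \<Delta>" "u a \<in> P" for a
      unfolding F_def using that
      by (intro stabilizer_defect[OF q sw_codominant qfix]) (auto simp: sw_simple inner_diff_left \<rho>_simple)
    have expand: "w y \<bullet> \<rho> = (\<Sum>d\<in>\<Delta>. (y \<bullet> fw d) * (w d \<bullet> \<rho>))" if "w \<in> W" for w y
      by (subst simple_expansion[of y])
         (simp add: linear_sum[OF weyl_linear[OF that]] linear_cmul[OF weyl_linear[OF that]] inner_sum_left)
    have negP: "w d \<bullet> \<rho> < 0" if "w \<in> W" "d \<in> \<Delta>" "w d \<notin> P" for w d
      using P_iff[OF weyl_root[OF that(1) simple_root[OF that(2)]]] root_\<rho>[OF weyl_root[OF that(1) simple_root[OF that(2)]]] that(3)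
      by auto
    have Eterm: "(E \<bullet> fw d) * (v d \<bullet> \<rho>) \<ge> 0" if "d \<in> \<Delta>" for d
      using E0[OF that] P_\<rho>[of "v d"] E that by (cases "v d \<in> P") (auto simp: pos_def)
    have Fterm: "(F \<bullet> fw d) * (u d \<bullet> \<rho>) \<le> 0" if "d \<in> \<Delta>" for d
      using F0[OF that] negP[OF u that] F that by (cases "u d \<in> P") (auto simp: pos_def mult_nonneg_nonpos)
    have "finv x (p y) = v y" "finv x (q y) = u y" for y
      by (simp_all add: p_def q_def weyl_inv_left[OF x(1)])
    then have pq: "v (finv p \<rho>) = finv x \<rho>" "u (finv q \<rho>) = finv x \<rho>"
      by (metis weyl_inv_right[OF p], metis weyl_inv_right[OF q])
    \<comment> \<open>Together with the two signs this places x^-1 \<rho> between u \<rho> and v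
      \<rho> in their values on \<rho>; equality at both ends forces E = F = 0 and therefore p = q =
      id.\<close>
    have vE: "v E \<bullet> \<rho> = v \<rho> \<bullet> \<rho> - finv x \<rho> \<bullet> \<rho>" and uF: "u F \<bullet> \<rho> = u \<rho> \<bullet> \<rho> - finv x \<rho> \<bullet> \<rho>"
      by (simp_all only: E_def F_def linear_diff[OF weyl_linear[OF v]] linear_diff[OF weyl_linear[OF u]] inner_diff_left pq)
    have vE0: "v E \<bullet> \<rho> \<ge> 0" by (subst expand[OF v]) (intro sum_nonneg Eterm)
    have uF0: "u F \<bullet> \<rho> \<le> 0" by (subst expand[OF u]) (intro sum_nonpos Fterm)
    show ?thesis
    proof (cases "u \<rho> \<bullet> \<rho> < v \<rho> \<bullet> \<rho>")
      case True
      then show ?thesis using sw_eq by (simp add: sless_def)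
    next
      case False
      then have "v E \<bullet> \<rho> = 0" "u F \<bullet> \<rho> = 0" using vE uF vE0 uF0 by linarith+
      have "E \<bullet> fw d = 0" if d: "d \<in> \<Delta>" for d
      proof -
        have "(E \<bullet> fw d) * (v d \<bullet> \<rho>) = 0"
          using \<open>v E \<bullet> \<rho> = 0\<close> sum_nonneg_eq_0_iff[OF finite_simple, of "\<lambda>d. (E \<bullet> fw d) * (v d \<bullet> \<rho>)"] Eterm d
          by (subst (asm) expand[OF v]) auto
        then show ?thesis using root_\<rho>[OF weyl_root[OF v simple_root[OF d]]] by simp
      qed
      then have "E = 0" using simple_expansion[of E] by simp
      have "F \<bullet> fw d = 0" if d: "d \<in> \<Delta>" for d
      proof -
        have "- ((F \<bullet> fw d) * (u d \<bullet> \<rho>)) = 0"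
          using \<open>u F \<bullet> \<rho> = 0\<close> sum_nonneg_eq_0_iff[OF finite_simple, of "\<lambda>d. - ((F \<bullet> fw d) * (u d \<bullet> \<rho>))"] Fterm d
          by (subst (asm) expand[OF u]) (auto simp: sum_negf)
        then show ?thesis using root_\<rho>[OF weyl_root[OF u simple_root[OF d]]] by simp
      qed
      then have "F = 0" using simple_expansion[of F] by simp
      have "p \<rho> = \<rho>" "q \<rho> = \<rho>"
        using \<open>E = 0\<close> \<open>F = 0\<close> weyl_inv_right[OF p, of \<rho>] weyl_inv_right[OF q, of \<rho>] by (auto simp: E_def F_def)
      then have "p = id" "q = id" using weyl_fix_\<rho> p q by auto
      then have "u y = v y" for y
        using \<open>finv x (p y) = v y\<close> \<open>finv x (q y) = u y\<close> by simp
      then show ?thesis by auto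
    qed
  qed
qed

section \<open>The sign character\<close>

text \<open>Counting inversions gives directly the sign that arises when W permutes a product over
  positive roots of factors odd in the root.\<close>

definition eps :: "('v \<Rightarrow> 'v) \<Rightarrow> int" where
  "eps w = (- 1) ^ card {a \<in> P. w a \<notin> P}"

lemma eps_square: "eps w * eps w = 1"
  by (simp add: eps_def flip: power_add mult_2)

definition flip_root :: "('v \<Rightarrow> 'v) \<Rightarrow> 'v \<Rightarrow> 'v" where
  "flip_root w a = (if w a \<in> P then w a else - w a)"

lemma flip_root_bij: "w \<in> W \<Longrightarrow> bij_betw (flip_root w) P P"
proof -
  assume w: "w \<in> W"
  have sub: "flip_root w ` P \<subseteq> P"
    using P_cases weyl_root[OF w] P_root by (fastforce simp: flip_root_def)
  moreover have "inj_on (flip_root w) P"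
  proof (rule inj_onI)
    fix a b assume ab: "a \<in> P" "b \<in> P" "flip_root w a = flip_root w b"
    then have "w a = w b \<or> w a = - w b" by (auto simp: flip_root_def split: if_splits) (metis add.inverse_inverse)
    then have "w a = w b \<or> w a = w (- b)" using linear_neg[OF weyl_linear[OF w]] by auto
    then have "a = b \<or> a = - b" using weyl_inv_left[OF w] by metis
    then show "a = b" using P_cases[OF P_root[OF ab(2)]] ab by auto
  qed
  ultimately show ?thesis using finite_P by (simp add: bij_betw_def endo_inj_surj)
qed

text \<open>Serves twice: with linear forms it shows that \<open>eps\<close> is multiplicative, with
  differences of half-coroot monomials that the Weyl denominator is antisymmetric.\<close>

lemma prod_flip_root:
  fixes f :: "'v \<Rightarrow> 'r::comm_ring_1"
  assumes w: "w \<in> W" and odd: "\<And>a. f (- a) = - f a"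
  shows "(\<Prod>a\<in>P. f (w a)) = of_int (eps w) * (\<Prod>a\<in>P. f a)"
proof -
  have "(\<Prod>a\<in>P. f (w a)) = (\<Prod>a\<in>P. (if w a \<notin> P then - 1 else 1) * f (flip_root w a))"
    by (intro prod.cong) (auto simp: flip_root_def odd)
  also have "\<dots> = (\<Prod>a\<in>P. if w a \<notin> P then - 1 else 1) * (\<Prod>a\<in>P. f (flip_root w a))"
    by (rule prod.distrib)
  also have "(\<Prod>a\<in>P. f (flip_root w a)) = (\<Prod>a\<in>P. f a)"
    by (rule prod.reindex_bij_betw[OF flip_root_bij[OF w]])
  also have "(\<Prod>a\<in>P. if w a \<notin> P then - 1 else 1) = (of_int (eps w) :: 'r)"
    using finite_P by (simp add: eps_def prod.If_cases Int_def)
  finally show ?thesis .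
qed

text \<open>The product of the positive roots, as a function on the space, is antisymmetric with
  sign \<open>eps\<close>. Evaluating it at \<rho>, where it does not vanish, compares the
  signs.\<close>

lemma eps_comp: "w \<in> W \<Longrightarrow> u \<in> W \<Longrightarrow> eps (w \<circ> u) = eps w * eps u"
proof -
  assume w: "w \<in> W" and u: "u \<in> W"
  define D where "D z = (\<Prod>a\<in>P. a \<bullet> z)" for z
  have D: "(\<Prod>a\<in>P. v a \<bullet> z) = of_int (eps v) * D z" if "v \<in> W" for v z
    unfolding D_def using prod_flip_root[OF that, of "\<lambda>a. a \<bullet> z"] by simp
  have "of_int (eps (w \<circ> u)) * D \<rho> = (\<Prod>a\<in>P. u a \<bullet> finv w \<rho>)"
    using D[OF weyl_comp[OF w u], of \<rho>] by (simp add: weyl_adjoint[OF w])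
  also have "\<dots> = of_int (eps u) * (\<Prod>a\<in>P. w a \<bullet> \<rho>)"
    by (simp only: D[OF u] D_def weyl_adjoint[OF w])
  also have "\<dots> = of_int (eps w * eps u) * D \<rho>"
    by (simp add: D[OF w])
  finally have "of_int (eps (w \<circ> u)) * D \<rho> = of_int (eps w * eps u) * D \<rho>" .
  moreover have "D \<rho> \<noteq> 0" using finite_P P_\<rho> by (auto simp: D_def prod_zero_iff) (metis less_irrefl)
  ultimately show ?thesis using mult_right_cancel of_int_eq_iff by blast
qed

lemma eps_id [simp]: "eps id = 1"
  by (simp add: eps_def)

lemma eps_refl: "\<alpha> \<in> \<Phi> \<Longrightarrow> eps (root_refl \<alpha>) = - 1"
proof -
  have P: "eps (root_refl b) = - 1" if "b \<in> P" for b
    using that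
  proof (induction rule: P_induct)
    case (simple a)
    have "root_refl a a \<notin> P"
      using root_refl_self[OF root_nz[OF simple_root[OF simple]]] P_cases[OF simple_root[OF simple]] simple_P[OF simple] by auto
    then have "{b \<in> P. root_refl a b \<notin> P} = {a}"
      using simple_refl_P[OF simple] simple_P[OF simple] by auto
    then show ?case by (simp add: eps_def)
  next
    case (refl a c)
    have nz: "a \<noteq> 0" using root_nz simple_root refl(1) by blast
    have "root_refl (root_refl a c) \<circ> root_refl a = root_refl a \<circ> root_refl c"
      by (rule root_refl_conj_comp[OF root_refl_orth[OF nz]])
    moreover have W: "root_refl a \<in> W" "root_refl c \<in> W" "root_refl (root_refl a c) \<in> W"
      using refl simple_root P_root weyl_refl by auto
    ultimately have "eps (root_refl (root_refl a c)) * eps (root_refl a) = eps (root_refl a) * eps (root_refl c)"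
      using eps_comp[OF W(3,1)] eps_comp[OF W(1,2)] by (simp only:)
    moreover have "eps (root_refl a) \<noteq> 0" using eps_square[of "root_refl a"] by auto
    ultimately show ?case
      unfolding refl by (metis mult.commute mult_left_cancel)
  qed
  assume "\<alpha> \<in> \<Phi>"
  then show ?thesis using P[of \<alpha>] P[of "- \<alpha>"] P_cases root_refl_uminus by metis
qed

end

section \<open>The Weyl group action on the group algebra\<close>

text \<open>Precomposition of coefficient functions with w, as in \<open>hpull\<close>. On monomials
  it is therefore the action of w^-1, and it reverses composition.\<close>

definition pull :: "('v \<Rightarrow> 'v) \<Rightarrow> ('v \<Rightarrow>\<^sub>0 'k::comm_ring_1) \<Rightarrow> ('v \<Rightarrow>\<^sub>0 'k)" where
  "pull = Poly_Mapping.map_key"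

lemma lookup_pull: "inj w \<Longrightarrow> lookup (pull w p) l = lookup p (w l)"
  by (simp add: pull_def map_key.rep_eq)

lemma pull_id [simp]: "pull id p = p"
  by (rule poly_mapping_eqI) (simp add: lookup_pull)

lemma pull_comp: "inj w \<Longrightarrow> inj u \<Longrightarrow> pull (w \<circ> u) p = pull u (pull w p)"
  by (rule poly_mapping_eqI) (simp add: lookup_pull inj_compose)

lemma pull_add: "inj w \<Longrightarrow> pull w (p + q) = pull w p + pull w q"
  by (rule poly_mapping_eqI) (simp add: lookup_pull lookup_add)

lemma pull_diff: "inj w \<Longrightarrow> pull w (p - q) = pull w p - pull w q"
  by (rule poly_mapping_eqI) (simp add: lookup_pull lookup_minus)

lemma pull_0: "inj w \<Longrightarrow> pull w 0 = 0"
  by (rule poly_mapping_eqI) (simp add: lookup_pull)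

lemma pull_sum: "inj w \<Longrightarrow> pull w (sum f I) = (\<Sum>i\<in>I. pull w (f i))"
  by (induction I rule: infinite_finite_induct) (auto simp: pull_0 pull_add)

lemma pull_single: "bij w \<Longrightarrow> pull w (Poly_Mapping.single l a) = Poly_Mapping.single (finv w l) a"
  by (rule poly_mapping_eqI) (auto simp: lookup_pull bij_is_inj lookup_single when_def inv_f_f bij_is_surj surj_f_inv_f)

lemma pull_gx: "bij w \<Longrightarrow> pull w (gx l) = gx (finv w l)"
  by (simp add: gx_def pull_single)

lemma one_minus_gx_int_dvd:
  assumes Y: "subgp Y" and b: "b \<in> Y"
  shows "\<exists>g\<in>GR Y. 1 - gx (of_int m *\<^sub>R b) = (1 - gx b) * (g :: 'v::real_vector \<Rightarrow>\<^sub>0 'k::comm_ring_1)"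
proof -
  have "of_int m *\<^sub>R b \<in> Y \<and> ?thesis"
  proof (induction m rule: int_induct[where k = 0])
    case base
    then show ?case using subgp_0[OF Y] by (auto intro!: bexI[of _ 0] GR_0)
  next
    case (step1 m)
    then obtain g where m: "of_int m *\<^sub>R b \<in> Y" "g \<in> GR Y" "1 - gx (of_int m *\<^sub>R b) = (1 - gx b) * (g :: 'v \<Rightarrow>\<^sub>0 'k)" by blast
    have "1 - gx (of_int (m + 1) *\<^sub>R b) = (1 - gx (of_int m *\<^sub>R b)) + (1 - gx b) * (gx (of_int m *\<^sub>R b) :: 'v \<Rightarrow>\<^sub>0 'k)"
      by (simp add: scaleR_add_left gx_add algebra_simps)
    also have "\<dots> = (1 - gx b) * (g + gx (of_int m *\<^sub>R b))"
      by (simp add: m(3) distrib_left)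
    finally show ?case
      using m b by (auto simp: scaleR_add_left subgp_add[OF Y] intro!: bexI[of _ "g + gx (of_int m *\<^sub>R b)"] GR_add GR_gx)
  next
    case (step2 m)
    then obtain g where m: "of_int m *\<^sub>R b \<in> Y" "g \<in> GR Y" "1 - gx (of_int m *\<^sub>R b) = (1 - gx b) * (g :: 'v \<Rightarrow>\<^sub>0 'k)" by blast
    have mem: "of_int (m - 1) *\<^sub>R b \<in> Y"
      using subgp_diff[OF Y m(1) b] by (simp add: scaleR_diff_left)
    have "gx (of_int m *\<^sub>R b) = gx (of_int (m - 1) *\<^sub>R b) * (gx b :: 'v \<Rightarrow>\<^sub>0 'k)"
      by (simp add: scaleR_diff_left flip: gx_add)
    then have "1 - gx (of_int (m - 1) *\<^sub>R b) = (1 - gx (of_int m *\<^sub>R b)) - (1 - gx b) * (gx (of_int (m - 1) *\<^sub>R b) :: 'v \<Rightarrow>\<^sub>0 'k)"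
      by (simp add: algebra_simps)
    also have "\<dots> = (1 - gx b) * (g - gx (of_int (m - 1) *\<^sub>R b))"
      by (simp only: m(3) right_diff_distrib)
    finally show ?case
      using mem m(2) by (intro conjI bexI[of _ "g - gx (of_int (m - 1) *\<^sub>R b)"] GR_diff GR_gx)
  qed
  then show ?thesis by blast
qed

context rootsys
begin

lemma weyl_inj: "w \<in> W \<Longrightarrow> inj w"
  by (simp add: weyl_bij bij_is_inj)

lemma finv_add: "w \<in> W \<Longrightarrow> finv w (x + y) = finv w x + finv w y"
  by (rule linear_add[OF weyl_linear[OF weyl_inv]])

lemma finv_uminus: "w \<in> W \<Longrightarrow> finv w (- x) = - finv w x"
  by (rule linear_neg[OF weyl_linear[OF weyl_inv]])

lemma finv_finv: "w \<in> W \<Longrightarrow> finv (finv w) = w"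
  by (simp add: weyl_bij inv_inv_eq)

lemma pull_mult: "w \<in> W \<Longrightarrow> pull w (p * q) = pull w p * pull w q"
proof (rule poly_mapping_mult_hom[where f = "pull w"])
  fix l m a b assume w: "w \<in> W"
  then show "pull w (Poly_Mapping.single (l + m) (a * b)) = pull w (Poly_Mapping.single l a) * pull w (Poly_Mapping.single m b)"
    by (simp add: pull_single weyl_bij mult_single finv_add)
qed (simp add: pull_add weyl_inj)

lemma pull_1: "w \<in> W \<Longrightarrow> pull w 1 = 1"
  using pull_gx[OF weyl_bij, of w 0] linear_0[OF weyl_linear[OF weyl_inv]] by simp

lemma pull_of_int: "w \<in> W \<Longrightarrow> pull w (of_int m) = of_int m"
  unfolding single_of_int[symmetric] using pull_single[OF weyl_bij, of w 0] linear_0[OF weyl_linear[OF weyl_inv]]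
  by (simp del: single_of_int)

lemma pull_prod: "w \<in> W \<Longrightarrow> pull w (prod f I) = (\<Prod>i\<in>I. pull w (f i))"
  by (induction I rule: infinite_finite_induct) (auto simp: pull_1 pull_mult)

lemma pull_GR: "w \<in> W \<Longrightarrow> p \<in> GR X \<Longrightarrow> pull w p \<in> GR X"
proof -
  assume w: "w \<in> W" and p: "p \<in> GR X"
  have "l \<in> X" if "w l \<in> X" for l
    using weyl_X[OF weyl_inv[OF w] that] weyl_inv_left[OF w] by simp
  then show ?thesis using p by (auto simp: GR_def in_keys_iff lookup_pull weyl_inj[OF w])
qed

lemma augm_pull: "w \<in> W \<Longrightarrow> augm (pull w p) = augm p"
  by (induction p rule: poly_mapping_additive_induct)
     (auto simp: pull_single weyl_bij pull_add weyl_inj augm_add)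

lemma pull_GI: "w \<in> W \<Longrightarrow> p \<in> GI X n \<Longrightarrow> pull w p \<in> GI X n"
proof (induction n arbitrary: p)
  case 0
  then show ?case by (simp add: pull_GR)
next
  case (Suc n)
  from Suc.prems(2) show ?case
  proof (induction rule: GI_Suc_induct)
    case zero
    then show ?case by (simp add: pull_0 weyl_inj Suc.prems(1) GI_0 del: GI.simps)
  next
    case (mult x y)
    then show ?case
      unfolding pull_mult[OF Suc.prems(1)]
      by (intro GI_Suc_mult) (auto simp: pull_GR augm_pull Suc)
  next
    case (add p q)
    then show ?case
      unfolding pull_add[OF weyl_inj[OF Suc.prems(1)]] by (intro GI_add)
  qed
qed

text \<open>On a monomial with exponent l the difference is that monomial times 1 - e^(-m \<alpha>),
  \<alpha> standing for the coroot; m = l \<bullet> \<alpha> is an integer since l is a cocharacter,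
  so the factor is a multiple of 1 - e^\<alpha>.\<close>

lemma pull_refl_dvd:
  fixes p :: "'v \<Rightarrow>\<^sub>0 'k::comm_ring_1"
  assumes a: "\<alpha> \<in> \<Phi>" and p: "p \<in> GR X"
  shows "\<exists>g\<in>GR X. p - pull (root_refl \<alpha>) p = (1 - gx (coroot \<alpha>)) * g"
  using p
proof (induction rule: GR_induct)
  case (single l c)
  obtain m where m: "l \<bullet> \<alpha> = of_int m" using single a by (auto simp: cochar_def inner_commute elim: Ints_cases)
  obtain g :: "'v \<Rightarrow>\<^sub>0 'k" where g: "g \<in> GR X" "1 - gx (of_int (- m) *\<^sub>R coroot \<alpha>) = (1 - gx (coroot \<alpha>)) * g"
    using one_minus_gx_int_dvd[OF subgp_X coroot_X[OF a]] by blast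
  have "finv (root_refl \<alpha>) l = root_refl \<alpha> l"
    using weyl_inv_left[OF weyl_refl[OF a], of "root_refl \<alpha> l"] by (simp add: root_refl_involution root_nz a)
  also have "\<dots> = l + of_int (- m) *\<^sub>R coroot \<alpha>" by (simp add: root_refl_coroot m)
  finally have "Poly_Mapping.single l c - pull (root_refl \<alpha>) (Poly_Mapping.single l c)
      = Poly_Mapping.single l c * (1 - gx (of_int (- m) *\<^sub>R coroot \<alpha>))"
    by (simp add: pull_single weyl_bij weyl_refl a gx_def mult_single right_diff_distrib)
  also have "\<dots> = (1 - gx (coroot \<alpha>)) * (Poly_Mapping.single l c * g)"
    by (simp only: g(2) mult.left_commute)
  finally show ?case
    by (rule bexI) (intro GR_mult[OF subgp_X] GR_single single g(1))
next
  case zero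
  then show ?case using weyl_inj[OF weyl_refl[OF a]] by (auto simp: pull_0 intro!: bexI[of _ 0] GR_0)
next
  case (add p q)
  then obtain g h where "g \<in> GR X" "h \<in> GR X" "p - pull (root_refl \<alpha>) p = (1 - gx (coroot \<alpha>)) * g"
    "q - pull (root_refl \<alpha>) q = (1 - gx (coroot \<alpha>)) * h" by blast
  then show ?case using weyl_inj[OF weyl_refl[OF a]]
    by (intro bexI[of _ "g + h"]) (auto simp: pull_add GR_add distrib_left add_diff_add)
qed

section \<open>Alternating sums\<close>

text \<open>The elements w and w s_a have opposite signs, and exactly one of the two keeps a
  positive. Summing over these representatives avoids dividing by 2, so characteristic 2 is
  included.\<close>

lemma alternating_sum_pair:
  fixes f :: "('v \<Rightarrow> 'v) \<Rightarrow> 'r::comm_ring_1"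
  assumes a: "a \<in> P"
  shows "(\<Sum>w\<in>W. of_int (eps w) * f w) = (\<Sum>w\<in>{w \<in> W. w a \<in> P}. of_int (eps w) * (f w - f (w \<circ> root_refl a)))"
proof -
  let ?s = "root_refl a"
  have aR: "a \<in> \<Phi>" and nz: "a \<noteq> 0" using P_root[OF a] root_nz by auto
  have W: "W = {w \<in> W. w a \<in> P} \<union> {w \<in> W. w a \<notin> P}" by auto
  have wsa: "(w \<circ> ?s) a \<in> P \<longleftrightarrow> w a \<notin> P" if w: "w \<in> W" for w
    using P_cases[OF weyl_root[OF w aR]] linear_neg[OF weyl_linear[OF w]] by (simp add: root_refl_self[OF nz])
  have ws: "w \<circ> ?s \<in> W" if "w \<in> W" for w using that weyl_comp weyl_refl aR by blast
  have wss: "w \<circ> ?s \<circ> ?s = w" for w :: "'v \<Rightarrow> 'v" by (simp add: comp_assoc root_refl_involution_comp[OF nz])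
  have bij: "bij_betw (\<lambda>w. w \<circ> ?s) {w \<in> W. w a \<in> P} {w \<in> W. w a \<notin> P}"
  proof (rule bij_betw_byWitness[where f' = "\<lambda>w. w \<circ> ?s"])
    show "(\<lambda>w. w \<circ> ?s) ` {w \<in> W. w a \<in> P} \<subseteq> {w \<in> W. w a \<notin> P}" using ws wsa by blast
    show "(\<lambda>w. w \<circ> ?s) ` {w \<in> W. w a \<notin> P} \<subseteq> {w \<in> W. w a \<in> P}" using ws wsa by blast
  qed (simp_all only: wss Ball_def, simp_all)
  have "(\<Sum>w\<in>{w \<in> W. w a \<notin> P}. of_int (eps w) * f w)
      = (\<Sum>w\<in>{w \<in> W. w a \<in> P}. of_int (eps (w \<circ> ?s)) * f (w \<circ> ?s))"
    by (rule sum.reindex_bij_betw[OF bij, symmetric])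
  also have "\<dots> = (\<Sum>w\<in>{w \<in> W. w a \<in> P}. - (of_int (eps w) * f (w \<circ> ?s)))"
    by (intro sum.cong refl) (use weyl_refl[OF aR] in \<open>simp add: eps_comp eps_refl[OF aR]\<close>)
  finally have neg: "(\<Sum>w\<in>{w \<in> W. w a \<notin> P}. of_int (eps w) * f w)
      = (\<Sum>w\<in>{w \<in> W. w a \<in> P}. - (of_int (eps w) * f (w \<circ> ?s)))" .
  have "(\<Sum>w\<in>W. of_int (eps w) * f w) = (\<Sum>w\<in>{w \<in> W. w a \<in> P}. of_int (eps w) * f w) + (\<Sum>w\<in>{w \<in> W. w a \<notin> P}. of_int (eps w) * f w)"
    by (subst W, rule sum.union_disjoint) (use weyl_finite in auto)
  also have "\<dots> = (\<Sum>w\<in>{w \<in> W. w a \<in> P}. of_int (eps w) * (f w - f (w \<circ> ?s)))"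
    unfolding neg by (simp add: right_diff_distrib sum_subtractf sum_negf)
  finally show ?thesis .
qed

lemma ex_separating:
  assumes "a \<in> P" "b \<in> P" "a \<noteq> b"
  shows "\<exists>\<gamma>. coroot a \<bullet> \<gamma> \<noteq> 0 \<and> coroot b \<bullet> \<gamma> = 0 \<and> (\<forall>l\<in>X. l \<bullet> \<gamma> \<in> \<int>)"
proof -
  have ab: "a \<in> \<Phi>" "b \<in> \<Phi>" and nz: "a \<noteq> 0" "b \<noteq> 0" using assms P_root root_nz by auto
  obtain m where m: "a \<bullet> coroot b = of_int m" using root_int[OF ab(2,1)] by (auto elim: Ints_cases)
  \<comment> \<open>Twice the component of a orthogonal to b. The factor 2 makes it an element of
    the root lattice, hence integral on cocharacters.\<close>
  define \<gamma> where "\<gamma> = 2 *\<^sub>R a - (a \<bullet> coroot b) *\<^sub>R b"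
  have "l \<bullet> \<gamma> \<in> \<int>" if "l \<in> X" for l
    using that ab by (simp add: \<gamma>_def inner_diff_right m cochar_def inner_commute[of l])
  moreover have "coroot b \<bullet> \<gamma> = 0"
    using coroot_self[OF nz(2)] by (simp add: \<gamma>_def inner_diff_right inner_commute[of "coroot b"])
  moreover have "coroot a \<bullet> \<gamma> \<noteq> 0"
  proof
    assume 0: "coroot a \<bullet> \<gamma> = 0"
    have n: "a \<bullet> a > 0" "b \<bullet> b > 0" using nz by auto
    have "a \<bullet> \<gamma> = 0" using 0 n by (simp add: coroot_def)
    then have "a \<bullet> (a - ((a \<bullet> b) / (b \<bullet> b)) *\<^sub>R b) = 0"
      by (simp add: \<gamma>_def inner_diff_right inner_coroot)
    moreover have "b \<bullet> (a - ((a \<bullet> b) / (b \<bullet> b)) *\<^sub>R b) = 0"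
      using n by (simp add: inner_diff_right inner_commute)
    ultimately have "(a - ((a \<bullet> b) / (b \<bullet> b)) *\<^sub>R b) \<bullet> (a - ((a \<bullet> b) / (b \<bullet> b)) *\<^sub>R b) = 0"
      by (simp add: inner_diff_left)
    then have "a = ((a \<bullet> b) / (b \<bullet> b)) *\<^sub>R b" by simp
    then have "a = b \<or> a = - b" using root_scale[OF ab(2)] ab(1) by (metis scaleR_minus1_left scaleR_one)
    then show False using assms P_cases[OF ab(2)] by auto
  qed
  ultimately show ?thesis by blast
qed

end

locale weyl_algebra = rootsys \<Phi> for \<Phi> :: "'v::euclidean_space set" +
  fixes kt :: "'k::field itself"
begin

text \<open>The Weyl denominator, normalized so that its lowest term is \<open>gx (- \<rho>)\<close>.\<close>

definition denom :: "'v \<Rightarrow>\<^sub>0 'k" where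
  "denom = gx (- \<rho>) * (\<Prod>a\<in>P. 1 - gx (coroot a))"

text \<open>The form in which every factor is odd in the root, so that \<open>prod_flip_root\<close>
  applies. Half coroots may leave the lattice, but the ring contains their monomials.\<close>

lemma denom_prod: "denom = (\<Prod>a\<in>P. gx (- ((1/2) *\<^sub>R coroot a)) - gx ((1/2) *\<^sub>R coroot a))"
proof -
  have gx_sum: "(\<Prod>a\<in>S. gx (f a)) = (gx (\<Sum>a\<in>S. f a) :: 'v \<Rightarrow>\<^sub>0 'k)" if "finite S" for S f
    using that by (induction S) (auto simp: gx_add)
  have "gx (- \<rho>) = (\<Prod>a\<in>P. gx (- ((1/2) *\<^sub>R coroot a)) :: 'v \<Rightarrow>\<^sub>0 'k)"
    by (simp add: gx_sum finite_P \<rho>_def sum_negf scaleR_sum_right)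
  moreover have "gx (- ((1/2) *\<^sub>R coroot a)) * (1 - gx (coroot a)) = (gx (- ((1/2) *\<^sub>R coroot a)) - gx ((1/2) *\<^sub>R coroot a) :: 'v \<Rightarrow>\<^sub>0 'k)" for a
  proof -
    have "- ((1/2) *\<^sub>R coroot a) + coroot a = (1/2) *\<^sub>R coroot a"
      using scaleR_add_left[of "1/2" "1/2" "coroot a"] by (simp add: algebra_simps)
    then show ?thesis by (simp add: right_diff_distrib flip: gx_add)
  qed
  ultimately show ?thesis by (simp add: denom_def flip: prod.distrib)
qed

lemma eps_finv: "w \<in> W \<Longrightarrow> eps (finv w) = eps w"
proof -
  assume w: "w \<in> W"
  have "w \<circ> finv w = id" using weyl_inv_right[OF w] by auto
  then have "eps w * eps (finv w) = eps w * eps w" using eps_comp[OF w weyl_inv[OF w]] eps_square by simp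
  moreover have "eps w \<noteq> 0" using eps_square[of w] by auto
  ultimately show ?thesis by simp
qed

lemma pull_denom: "w \<in> W \<Longrightarrow> pull w denom = of_int (eps w) * denom"
proof -
  assume w: "w \<in> W"
  define f where "f a = (gx (- ((1/2) *\<^sub>R coroot a)) - gx ((1/2) *\<^sub>R coroot a) :: 'v \<Rightarrow>\<^sub>0 'k)" for a
  have "pull w (f a) = f (finv w a)" for a
    by (simp add: f_def pull_diff weyl_inj w pull_gx weyl_bij finv_uminus
        linear_cmul[OF weyl_linear[OF weyl_inv[OF w]]] coroot_orth[OF weyl_orth[OF weyl_inv[OF w]]])
  then have "pull w denom = (\<Prod>a\<in>P. f (finv w a))"
    by (simp add: denom_prod pull_prod[OF w] f_def)
  also have "\<dots> = of_int (eps (finv w)) * (\<Prod>a\<in>P. f a)"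
    by (rule prod_flip_root[OF weyl_inv[OF w]]) (simp add: f_def coroot_uminus)
  finally show ?thesis by (simp add: eps_finv[OF w] denom_prod f_def)
qed

lemma denom_leading: "leading (- \<rho>) denom (- \<rho>) 1"
proof -
  have "leading (- \<rho>) (\<Prod>a\<in>P. 1 - gx (coroot a) :: 'v \<Rightarrow>\<^sub>0 'k) (\<Sum>a\<in>P. 0) (\<Prod>a\<in>P. 1)"
  proof (rule leading_prod)
    fix a assume "a \<in> P"
    then have "coroot a \<bullet> (- \<rho>) < 0" using P_\<rho>[of a] root_nz[OF P_root, of a] by (simp add: coroot_def)
    then show "leading (- \<rho>) (1 - gx (coroot a) :: 'v \<Rightarrow>\<^sub>0 'k) 0 1" by (rule leading_one_minus)
  qed
  from leading_mult[OF leading_gx this, of "- \<rho>"] show ?thesis by (simp add: denom_def)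
qed

lemma denom_leading': "leading \<rho> denom \<rho> ((- 1) ^ card P)"
proof -
  have "leading \<rho> (\<Prod>a\<in>P. 1 - gx (coroot a) :: 'v \<Rightarrow>\<^sub>0 'k) (\<Sum>a\<in>P. coroot a) (\<Prod>a\<in>P. - 1)"
  proof (rule leading_prod)
    fix a assume "a \<in> P"
    then have "coroot a \<bullet> \<rho> > 0" using P_\<rho>[of a] root_nz[OF P_root, of a] by (simp add: coroot_def)
    then show "leading \<rho> (1 - gx (coroot a) :: 'v \<Rightarrow>\<^sub>0 'k) (coroot a) (- 1)" by (rule leading_minus_one)
  qed
  moreover have "(\<Sum>a\<in>P. coroot a) = \<rho> + \<rho>" by (simp add: \<rho>_def flip: scaleR_add_left)
  ultimately have "leading \<rho> (\<Prod>a\<in>P. 1 - gx (coroot a) :: 'v \<Rightarrow>\<^sub>0 'k) (\<rho> + \<rho>) ((- 1) ^ card P)" by simp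
  from leading_mult[OF leading_gx this, of "- \<rho>"] show ?thesis by (simp add: denom_def)
qed

lemma denom_nzd: "denom * q = 0 \<Longrightarrow> q = 0"
  by (rule leading_nonzero_divisor[OF denom_leading]) auto

lemma denom_cancel: "denom * p = denom * q \<Longrightarrow> p = q"
  using denom_nzd[of "p - q"] by (simp add: right_diff_distrib)

definition alt :: "('v \<Rightarrow>\<^sub>0 'k) \<Rightarrow> 'v \<Rightarrow>\<^sub>0 'k" where
  "alt x = (\<Sum>w\<in>W. of_int (eps w) * pull w x)"

lemma subquot_GR: "subquot (GR X) {0 :: 'v \<Rightarrow>\<^sub>0 'k}"
  by standard (auto intro: GR_1 GR_diff GR_mult subgp_X)

lemma of_int_GR: "of_int m \<in> GR X"
  unfolding single_of_int[symmetric] by (rule GR_single[OF subgp_0[OF subgp_X]])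

lemma alt_dvd:
  assumes x: "x \<in> GR X"
  shows "\<exists>y\<in>GR X. alt x = denom * y"
proof -
  interpret subquot "GR X" "{0 :: 'v \<Rightarrow>\<^sub>0 'k}" by (rule subquot_GR)
  have dv: "divs f z \<longleftrightarrow> (\<exists>g\<in>GR X. z = f * g)" for f z by (simp add: divs_def)
  have E: "1 - gx (coroot a) \<in> GR X" if "a \<in> P" for a
    using that by (intro GR_diff GR_1[OF subgp_X] GR_gx coroot_X P_root)
  have altG: "alt x \<in> GR X"
    unfolding alt_def by (intro GR_sum GR_mult[OF subgp_X] of_int_GR pull_GR x)
  have "divs (\<Prod>a\<in>P. 1 - gx (coroot a)) (alt x)"
  proof (rule divs_prod[OF finite_P E altG])
    fix a b y assume ab: "a \<in> P" "b \<in> P" "a \<noteq> b" and y: "y \<in> GR X"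
      and "divs (1 - gx (coroot b)) ((1 - gx (coroot a)) * y)"
    then obtain z where "z \<in> GR X" "(1 - gx (coroot a)) * y = (1 - gx (coroot b)) * z" by (auto simp: dv)
    moreover obtain \<gamma> where "coroot a \<bullet> \<gamma> \<noteq> 0" "coroot b \<bullet> \<gamma> = 0" using ex_separating[OF ab] by blast
    ultimately show "divs (1 - gx (coroot b)) y"
      unfolding dv using GR_coprime[OF subgp_X coroot_X[OF P_root[OF ab(1)]] coroot_X[OF P_root[OF ab(2)]] _ _ y] by blast
  next
    fix a assume a: "a \<in> P"
    have "divs (1 - gx (coroot a)) (pull w x - pull (w \<circ> root_refl a) x)" if w: "w \<in> W" for w
      using pull_refl_dvd[OF P_root[OF a] pull_GR[OF w x]]
      by (simp add: dv pull_comp[OF weyl_inj[OF w] weyl_inj[OF weyl_refl[OF P_root[OF a]]]])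
    then show "divs (1 - gx (coroot a)) (alt x)"
      unfolding alt_def alternating_sum_pair[OF a] by (intro divs_sum divs_mult of_int_GR) auto
  qed
  then have "divs denom (alt x)"
    unfolding denom_def
    by (intro divs_unit[where v = "gx \<rho>"] GR_gx \<rho>_X subgp_minus[OF subgp_X]) (simp_all flip: gx_add)
  then show ?thesis by (simp add: dv)
qed

text \<open>With exponents negated this is the Weyl character operator:
  \<open>J (gx (- (\<lambda> + \<rho>)))\<close> is Weyl's formula for dominant \<lambda>. The
  quotient is unique because \<open>denom\<close> is regular.\<close>

definition J :: "('v \<Rightarrow>\<^sub>0 'k) \<Rightarrow> 'v \<Rightarrow>\<^sub>0 'k" where
  "J x = (SOME y. y \<in> GR X \<and> alt x = denom * y)"

lemma J_GR: "x \<in> GR X \<Longrightarrow> J x \<in> GR X" and alt_J: "x \<in> GR X \<Longrightarrow> alt x = denom * J x"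
proof -
  assume "x \<in> GR X"
  then have "\<exists>y. y \<in> GR X \<and> alt x = denom * y" using alt_dvd by blast
  then have "J x \<in> GR X \<and> alt x = denom * J x" unfolding J_def by (rule someI_ex)
  then show "J x \<in> GR X" "alt x = denom * J x" by auto
qed

lemma J_eq: "x \<in> GR X \<Longrightarrow> alt x = denom * y \<Longrightarrow> J x = y"
  using alt_J denom_cancel by metis

lemma alt_diff: "alt (x - y) = alt x - alt y"
  by (simp add: alt_def pull_diff weyl_inj right_diff_distrib sum_subtractf)

lemma alt_0: "alt 0 = 0"
  by (simp add: alt_def pull_0 weyl_inj)

lemma alt_sum: "alt (sum f I) = (\<Sum>i\<in>I. alt (f i))"
proof -
  have "alt (x + y) = alt x + alt y" for x y
    by (simp add: alt_def pull_add weyl_inj distrib_left sum.distrib)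
  note add = this
  show ?thesis by (induction I rule: infinite_finite_induct) (auto simp: alt_0 add)
qed

lemma alt_mult_invariant: "(\<And>w. w \<in> W \<Longrightarrow> pull w c = c) \<Longrightarrow> alt (x * c) = alt x * c"
  by (simp add: alt_def pull_mult sum_distrib_right mult.assoc)

lemma pull_alt: "u \<in> W \<Longrightarrow> pull u (alt x) = of_int (eps u) * alt x"
proof -
  assume u: "u \<in> W"
  have "bij_betw (\<lambda>w. w \<circ> u) W W"
  proof (rule bij_betw_byWitness[where f' = "\<lambda>w. w \<circ> finv u"])
    have 1: "u \<circ> finv u = id" "finv u \<circ> u = id" using weyl_inv_right[OF u] weyl_inv_left[OF u] by auto
    show "\<forall>a\<in>W. a \<circ> u \<circ> finv u = a" "\<forall>a'\<in>W. a' \<circ> finv u \<circ> u = a'"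
      by (simp_all only: comp_assoc 1 comp_id) simp_all
  qed (use weyl_comp u weyl_inv in auto)
  then have "alt x = (\<Sum>w\<in>W. of_int (eps (w \<circ> u)) * pull (w \<circ> u) x)"
    unfolding alt_def by (rule sum.reindex_bij_betw[symmetric])
  also have "\<dots> = (\<Sum>w\<in>W. of_int (eps u) * (of_int (eps w) * pull u (pull w x)))"
    by (intro sum.cong refl) (simp add: eps_comp u pull_comp weyl_inj mult_ac)
  also have "\<dots> = of_int (eps u) * pull u (alt x)"
    by (simp add: alt_def pull_sum weyl_inj u pull_mult pull_of_int flip: sum_distrib_left)
  finally have "of_int (eps u) * alt x = of_int (eps u * eps u) * pull u (alt x)"
    by (simp add: mult.assoc)
  then show ?thesis by (simp add: eps_square)
qed

lemma alt_pull: "u \<in> W \<Longrightarrow> alt (pull u x) = of_int (eps u) * alt x"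
proof -
  assume u: "u \<in> W"
  have "bij_betw (\<lambda>w. u \<circ> w) W W"
  proof (rule bij_betw_byWitness[where f' = "\<lambda>w. finv u \<circ> w"])
    have 1: "u \<circ> finv u = id" "finv u \<circ> u = id" using weyl_inv_right[OF u] weyl_inv_left[OF u] by auto
    show "\<forall>a\<in>W. finv u \<circ> (u \<circ> a) = a" "\<forall>a'\<in>W. u \<circ> (finv u \<circ> a') = a'"
      by (simp_all only: comp_assoc[symmetric] 1 id_comp) simp_all
  qed (use weyl_comp u weyl_inv in auto)
  then have "alt x = (\<Sum>w\<in>W. of_int (eps (u \<circ> w)) * pull (u \<circ> w) x)"
    unfolding alt_def by (rule sum.reindex_bij_betw[symmetric])
  also have "\<dots> = (\<Sum>w\<in>W. of_int (eps u) * (of_int (eps w) * pull w (pull u x)))"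
    by (intro sum.cong refl) (simp add: eps_comp u pull_comp weyl_inj mult_ac)
  also have "\<dots> = of_int (eps u) * alt (pull u x)"
    by (simp add: alt_def sum_distrib_left)
  finally have "of_int (eps u) * alt x = of_int (eps u * eps u) * alt (pull u x)"
    by (simp add: mult.assoc)
  then show ?thesis by (simp add: eps_square)
qed

lemma pull_J: "u \<in> W \<Longrightarrow> x \<in> GR X \<Longrightarrow> pull u (J x) = J x"
proof -
  assume u: "u \<in> W" and x: "x \<in> GR X"
  have "of_int (eps u * eps u) * (denom * pull u (J x)) = of_int (eps u) * pull u (denom * J x)"
    by (simp add: pull_mult u pull_denom mult_ac)
  also have "\<dots> = of_int (eps u * eps u) * (denom * J x)"
    by (simp add: pull_alt u mult_ac flip: alt_J[OF x])
  finally show ?thesis using denom_cancel by (simp add: eps_square)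
qed

text \<open>The reflection that fixes \<mu> pairs equal terms with opposite signs.\<close>

lemma J_singular:
  assumes \<mu>: "\<mu> \<in> X" and \<alpha>: "\<alpha> \<in> \<Phi>" "\<alpha> \<bullet> \<mu> = 0"
  shows "J (gx (- \<mu>)) = 0"
proof -
  obtain a where a: "a \<in> P" "a \<bullet> \<mu> = 0" using P_cases[OF \<alpha>(1)] \<alpha>(2) by (metis inner_minus_left neg_equal_0_iff_equal)
  have aR: "a \<in> \<Phi>" by (rule P_root[OF a(1)])
  let ?x = "gx (- \<mu>) :: 'v \<Rightarrow>\<^sub>0 'k" and ?s = "root_refl a"
  have sW: "?s \<in> W" by (rule weyl_refl[OF aR])
  have "?s (- \<mu>) = - \<mu>" using a(2) by (simp add: root_refl_coroot inner_commute)
  then have "pull ?s ?x = ?x" using weyl_inv_left[OF sW, of "- \<mu>"] by (simp add: pull_gx weyl_bij[OF sW])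
  have "finv (w \<circ> ?s) = ?s \<circ> finv w" if w: "w \<in> W" for w
  proof -
    have "finv ?s = ?s" using root_refl_involution_comp[OF root_nz[OF aR]] by (intro inv_unique_comp) auto
    then show ?thesis using w sW weyl_bij by (simp add: o_inv_distrib)
  qed
  then have fixed: "pull (finv w) ?x - pull (finv (w \<circ> ?s)) ?x = 0" if w: "w \<in> W" for w
    using that \<open>pull ?s ?x = ?x\<close> pull_comp[OF weyl_inj[OF sW] weyl_inj[OF weyl_inv[OF w]], of ?x] by simp
  \<comment> \<open>Since \<open>pull w\<close> acts by w^-1, the sum is reindexed by inverses; the
    reflection then meets the monomial before w does, which is the pairing of
    \<open>alternating_sum_pair\<close>.\<close>
  have "bij_betw finv W W"
    by (rule bij_betw_byWitness[where f' = finv]) (auto simp: finv_finv weyl_inv)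
  then have "alt ?x = (\<Sum>w\<in>W. of_int (eps (finv w)) * pull (finv w) ?x)"
    unfolding alt_def by (rule sum.reindex_bij_betw[symmetric])
  also have "\<dots> = (\<Sum>w\<in>W. of_int (eps w) * pull (finv w) ?x)"
    by (intro sum.cong) (auto simp: eps_finv)
  also have "\<dots> = 0"
    unfolding alternating_sum_pair[OF a(1)] by (intro sum.neutral ballI) (use fixed in simp)
  finally show ?thesis
    using \<mu> by (intro J_eq GR_gx subgp_minus[OF subgp_X]) auto
qed

text \<open>Weyl's denominator formula. Numerator and denominator both have
  \<open>gx (- \<rho>)\<close> as their unique lowest term, with coefficient 1, because \<rho> has
  trivial stabilizer and its conjugates lie below it. At the other end Cauchy-Schwarz bounds the
  exponents by those of \<open>denom\<close>, so the quotient is 1.\<close>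

lemma J_\<rho>: "J (gx (- \<rho>)) = (1 :: 'v \<Rightarrow>\<^sub>0 'k)"
proof -
  have G: "gx (- \<rho>) \<in> (GR X :: ('v \<Rightarrow>\<^sub>0 'k) set)" by (intro GR_gx subgp_minus[OF subgp_X] \<rho>_X)
  have altx: "alt (gx (- \<rho>)) = (\<Sum>w\<in>W. of_int (eps w) * gx (- finv w \<rho>) :: 'v \<Rightarrow>\<^sub>0 'k)"
    unfolding alt_def by (intro sum.cong refl) (simp add: pull_gx weyl_bij finv_uminus)
  have lk: "lookup (alt (gx (- \<rho>))) k = (\<Sum>w\<in>W. if finv w \<rho> = - k then of_int (eps w) else (0 :: 'k))" for k
  proof -
    have "lookup (of_int m * gx l) k = (if l = k then of_int m else (0 :: 'k))" for m l
      unfolding gx_def single_of_int[symmetric] mult_single by (simp add: lookup_single when_def)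
    then show ?thesis
      unfolding altx lookup_sum by (intro sum.cong refl) (auto simp: minus_equation_iff)
  qed
  have keys: "\<exists>w\<in>W. k = - w \<rho>" if "k \<in> keys (alt (gx (- \<rho>)) :: 'v \<Rightarrow>\<^sub>0 'k)" for k
  proof -
    have "\<exists>w\<in>W. finv w \<rho> = - k"
    proof (rule ccontr)
      assume "\<not> ?thesis"
      then have "lookup (alt (gx (- \<rho>))) k = (0 :: 'k)" unfolding lk by (intro sum.neutral) auto
      then show False using that by (simp add: in_keys_iff)
    qed
    then obtain w where w: "w \<in> W" "finv w \<rho> = - k" by blast
    show ?thesis by (rule bexI[OF _ weyl_inv[OF w(1)]]) (simp add: w(2))
  qed
  have "lookup (alt (gx (- \<rho>))) (- \<rho>) = (1 :: 'k)"
  proof -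
    have "finv w \<rho> = \<rho> \<longleftrightarrow> w = id" if w: "w \<in> W" for w
      using weyl_fix_\<rho>[OF w] weyl_inv_right[OF w, of \<rho>] by auto
    then have "lookup (alt (gx (- \<rho>))) (- \<rho>) = (\<Sum>w\<in>W. if w = id then of_int (eps w) else (0 :: 'k))"
      unfolding lk by (intro sum.cong) auto
    then show ?thesis using weyl_finite weyl_id by simp
  qed
  moreover have "k = - \<rho> \<or> k \<bullet> (- \<rho>) < (- \<rho>) \<bullet> (- \<rho>)" if k: "k \<in> keys (alt (gx (- \<rho>)) :: 'v \<Rightarrow>\<^sub>0 'k)" for k
  proof -
    obtain w where w: "w \<in> W" "k = - w \<rho>" using keys[OF k] by blast
    have "pos (\<rho> - w \<rho>)" by (rule dominant_weyl[OF w(1) dominant_\<rho>])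
    then have "(\<rho> - w \<rho>) \<bullet> \<rho> \<ge> 0" "(\<rho> - w \<rho>) \<bullet> \<rho> = 0 \<Longrightarrow> \<rho> - w \<rho> = 0"
      by (rule pos_\<rho>, rule pos_\<rho>_0)
    then show ?thesis using w(2) by (cases "(\<rho> - w \<rho>) \<bullet> \<rho> = 0") (auto simp: inner_diff_left)
  qed
  ultimately have lead: "leading (- \<rho>) (denom * J (gx (- \<rho>)) :: 'v \<Rightarrow>\<^sub>0 'k) (- \<rho>) 1"
    by (simp add: leading_def flip: alt_J[OF G])
  show ?thesis
  proof (rule leading_quotient_1[OF denom_leading _ _ lead])
    show "leading (- (- \<rho>)) (denom :: 'v \<Rightarrow>\<^sub>0 'k) \<rho> ((- 1) ^ card P)" using denom_leading' by simp
    show "(- 1) ^ card P \<noteq> (0 :: 'k)" by simp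
    fix k assume "k \<in> keys (denom * J (gx (- \<rho>)) :: 'v \<Rightarrow>\<^sub>0 'k)"
    then obtain w where w: "w \<in> W" "k = - w \<rho>" using keys by (auto simp flip: alt_J[OF G])
    have "- (w \<rho> \<bullet> \<rho>) \<le> norm (w \<rho>) * norm \<rho>" using Cauchy_Schwarz_ineq2[of "w \<rho>" \<rho>] by simp
    also have "norm (w \<rho>) = norm \<rho>" using orthogonal_transformation_norm weyl_orth w(1) by blast
    finally show "\<rho> \<bullet> (- \<rho>) \<le> k \<bullet> (- \<rho>)" using w(2) by (simp add: dot_square_norm power2_eq_square)
  qed
qed

section \<open>Steinberg's basis\<close>

definition stb :: "('v \<Rightarrow> 'v) \<Rightarrow> 'v \<Rightarrow>\<^sub>0 'k" where "stb v = gx (- v (sw v))"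
text \<open>Uses the complementary weight: for u = v the two exponents add up to - v \<rho>, which
  makes the diagonal Gram entries signs.\<close>

definition stb' :: "('v \<Rightarrow> 'v) \<Rightarrow> 'v \<Rightarrow>\<^sub>0 'k" where "stb' u = gx (- u (\<rho> - sw u))"

lemma stb_GR: "v \<in> W \<Longrightarrow> stb v \<in> GR X" and stb'_GR: "v \<in> W \<Longrightarrow> stb' v \<in> GR X"
  unfolding stb_def stb'_def
  by (rule GR_gx[OF subgp_minus[OF subgp_X weyl_X[OF _ sw_X]]], assumption,
      rule GR_gx[OF subgp_minus[OF subgp_X weyl_X[OF _ subgp_diff[OF subgp_X \<rho>_X sw_X]]]], assumption)

lemma stb_mult: "stb v * stb' u = gx (- (v (sw v) + u (\<rho> - sw u)))"
  by (simp add: stb_def stb'_def add.commute flip: gx_add)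

lemma gram_triangular:
  assumes "v \<in> W" "u \<in> W" "J (stb v * stb' u) \<noteq> (0 :: 'v \<Rightarrow>\<^sub>0 'k)"
  shows "u = v \<or> sless u v"
proof (rule steinberg_triangular[OF assms(1,2)])
  have "v (sw v) + u (\<rho> - sw u) \<in> X"
    by (rule subgp_add[OF subgp_X weyl_X[OF assms(1) sw_X] weyl_X[OF assms(2) subgp_diff[OF subgp_X \<rho>_X sw_X]]])
  then show "\<alpha> \<bullet> (v (sw v) + u (\<rho> - sw u)) \<noteq> 0" if "\<alpha> \<in> \<Phi>" for \<alpha>
    using J_singular[OF _ that] assms(3) unfolding stb_mult by blast
qed

lemma gram_diag: "v \<in> W \<Longrightarrow> J (stb v * stb' v) = of_int (eps v)"
proof -
  assume v: "v \<in> W"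
  have G: "gx (- \<rho>) \<in> GR X" by (intro GR_gx subgp_minus[OF subgp_X] \<rho>_X)
  have "stb v * stb' v = gx (- v \<rho>)"
    by (simp add: stb_mult linear_diff[OF weyl_linear[OF v]])
  also have "\<dots> = pull (finv v) (gx (- \<rho>))"
    by (simp add: pull_gx weyl_bij weyl_inv v finv_finv linear_neg[OF weyl_linear[OF v]])
  finally have eq: "stb v * stb' v = pull (finv v) (gx (- \<rho>))" .
  show ?thesis
    unfolding eq
  proof (rule J_eq[OF pull_GR[OF weyl_inv[OF v] G]])
    show "alt (pull (finv v) (gx (- \<rho>))) = denom * of_int (eps v)"
      by (simp add: alt_pull weyl_inv v eps_finv alt_J[OF G] J_\<rho> mult.commute)
  qed
qed

text \<open>Back substitution in a triangular system. The Gram column of \<open>stb' t\<close> is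
  nonzero only at t and at elements above t, whose dual elements are already available by
  induction.\<close>

lemma ex_dual: "t \<in> W \<Longrightarrow> \<exists>c\<in>GR X. \<forall>s\<in>W. J (stb s * c) = (if s = t then 1 else (0 :: 'v \<Rightarrow>\<^sub>0 'k))"
proof (induction "card {v \<in> W. sless t v}" arbitrary: t rule: less_induct)
  case less
  note t = less.prems
  let ?V = "{v \<in> W. sless t v}"
  have finV: "finite ?V" using weyl_finite by simp
  have "\<exists>c\<in>GR X. \<forall>s\<in>W. J (stb s * c) = (if s = v then 1 else (0 :: 'v \<Rightarrow>\<^sub>0 'k))" if v: "v \<in> ?V" for v
  proof (rule less.hyps)
    have "{u \<in> W. sless v u} \<subset> ?V" using v sless_trans sless_irrefl by blast
    then show "card {u \<in> W. sless v u} < card ?V" by (rule psubset_card_mono[OF finV])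
  qed (use v in simp)
  then have "\<forall>v\<in>?V. \<exists>c. c \<in> GR X \<and> (\<forall>s\<in>W. J (stb s * c) = (if s = v then 1 else 0))" by blast
  from bchoice[OF this] obtain c where c: "\<And>v. v \<in> ?V \<Longrightarrow> c v \<in> GR X"
    "\<And>v s. v \<in> ?V \<Longrightarrow> s \<in> W \<Longrightarrow> J (stb s * c v) = (if s = v then 1 else 0)"
    by blast
  define G where "G s = J (stb s * stb' t :: 'v \<Rightarrow>\<^sub>0 'k)" for s
  have st: "stb s * stb' t \<in> (GR X :: ('v \<Rightarrow>\<^sub>0 'k) set)" if "s \<in> W" for s
    using that t by (intro GR_mult[OF subgp_X] stb_GR stb'_GR)
  define e where "e = (of_int (eps t) :: 'v \<Rightarrow>\<^sub>0 'k)"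
  have e: "e \<in> GR X" "\<And>w. w \<in> W \<Longrightarrow> pull w e = e" "e * e = 1"
    by (auto simp: e_def of_int_GR pull_of_int eps_square simp flip: of_int_mult)
  have G: "G s \<in> GR X" "\<And>w. w \<in> W \<Longrightarrow> pull w (G s) = G s" if "s \<in> W" for s
    unfolding G_def using st[OF that] by (auto simp: J_GR pull_J)
  \<comment> \<open>The sign e normalizes the diagonal entry to 1; the sum removes the entries above
    it. The coefficients \<open>G v * e\<close> are invariant, so they can be taken out of
    \<open>alt\<close>.\<close>
  define d where "d = stb' t * e - (\<Sum>v\<in>?V. c v * (G v * e))"
  have dG: "d \<in> GR X"
    unfolding d_def using c(1) G(1) t e by (intro GR_diff GR_mult[OF subgp_X] GR_sum stb'_GR) auto
  have "J (stb s * d) = (if s = t then 1 else 0)" if s: "s \<in> W" for s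
  proof (rule J_eq)
    show "stb s * d \<in> GR X" using s dG by (intro GR_mult[OF subgp_X] stb_GR)
    have "alt (stb s * (c v * (G v * e))) = denom * (if s = v then G v * e else 0)" if v: "v \<in> ?V" for v
    proof -
      have "alt (stb s * (c v * (G v * e))) = alt ((stb s * c v) * (G v * e))" by (simp add: mult.assoc)
      also have "\<dots> = alt (stb s * c v) * (G v * e)"
        using v by (intro alt_mult_invariant) (simp add: pull_mult G e)
      also have "alt (stb s * c v) = denom * J (stb s * c v)"
        using s v by (intro alt_J GR_mult[OF subgp_X] stb_GR c)
      finally show ?thesis using c(2)[OF v s] by simp
    qed
    then have "(\<Sum>v\<in>?V. alt (stb s * (c v * (G v * e)))) = (\<Sum>v\<in>?V. denom * (if s = v then G v * e else 0))"
      by (rule sum.cong[OF refl])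
    also have "\<dots> = denom * (if s \<in> ?V then G s * e else 0)"
      using finV by (simp flip: sum_distrib_left)
    finally have S: "(\<Sum>v\<in>?V. alt (stb s * (c v * (G v * e)))) = denom * (if s \<in> ?V then G s * e else 0)" .
    have "alt (stb s * (stb' t * e)) = alt (stb s * stb' t) * e"
      unfolding mult.assoc[symmetric] by (rule alt_mult_invariant[OF e(2)])
    also have "\<dots> = denom * (G s * e)" by (simp add: alt_J[OF st[OF s]] G_def mult.assoc)
    finally have "alt (stb s * d) = denom * (G s * e) - denom * (if s \<in> ?V then G s * e else 0)"
      unfolding d_def right_diff_distrib alt_diff sum_distrib_left alt_sum S by simp
    also have "\<dots> = denom * (if s = t then 1 else 0)"
    proof -
      consider "s \<in> ?V" "s \<noteq> t" | "s = t" "s \<notin> ?V" | "s \<noteq> t" "s \<notin> ?V" using sless_irrefl by blast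
      then show ?thesis
      proof cases
        case 2
        then have "G s * e = 1" using gram_diag[OF t] e(3) by (simp add: G_def e_def)
        with 2 show ?thesis by (auto simp: sless_irrefl)
      next
        case 3
        then have "G s = 0" using gram_triangular[OF s t] s by (auto simp: G_def)
        with 3 show ?thesis by simp
      qed auto
    qed
    finally show "alt (stb s * d) = denom * (if s = t then 1 else 0)" .
  qed
  then show ?case using dG by blast
qed

definition std :: "('v \<Rightarrow> 'v) \<Rightarrow> 'v \<Rightarrow>\<^sub>0 'k" where
  "std t = (SOME c. c \<in> GR X \<and> (\<forall>s\<in>W. J (stb s * c) = (if s = t then 1 else 0)))"

lemma std_GR: "t \<in> W \<Longrightarrow> std t \<in> GR X"
  and J_std: "t \<in> W \<Longrightarrow> s \<in> W \<Longrightarrow> J (stb s * std t) = (if s = t then 1 else (0 :: 'v \<Rightarrow>\<^sub>0 'k))"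
proof -
  assume "t \<in> W"
  then have "\<exists>c. c \<in> GR X \<and> (\<forall>s\<in>W. J (stb s * c) = (if s = t then 1 else (0 :: 'v \<Rightarrow>\<^sub>0 'k)))" using ex_dual by blast
  then have *: "std t \<in> GR X \<and> (\<forall>s\<in>W. J (stb s * std t) = (if s = t then 1 else (0 :: 'v \<Rightarrow>\<^sub>0 'k)))"
    unfolding std_def by (rule someI_ex)
  then show "std t \<in> (GR X :: ('v \<Rightarrow>\<^sub>0 'k) set)" by blast
  show "J (stb s * std t) = (if s = t then 1 else (0 :: 'v \<Rightarrow>\<^sub>0 'k))" if "s \<in> W" using * that by blast
qed

text \<open>The tensor \<open>\<Sum>t. stb t \<otimes> std t\<close> represents the diagonal.\<close>

lemma diagonal:
  assumes "u \<in> W" "w \<in> W"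
  shows "(\<Sum>t\<in>W. pull w (std t) * pull u (stb t)) = (if w = u then of_int (eps w) * denom else (0 :: 'v \<Rightarrow>\<^sub>0 'k))"
proof -
  have "(\<Sum>t\<in>W. (of_int (eps w) * pull w (std t)) * pull u (stb t)) = (if w = u then denom else (0 :: 'v \<Rightarrow>\<^sub>0 'k))"
  \<comment> \<open>Orthogonality of the two families is a matrix identity after spelling out the
    alternating sum over w; exchanging the factors turns the sum over W into a sum over basis
    elements. The sign is put on the second matrix and removed at the end.\<close>
  proof (rule sum_flip[where A = "\<lambda>t u. pull u (stb t)" and C = "\<lambda>w t. of_int (eps w) * pull w (std t)", OF weyl_finite denom_nzd _ assms])
    fix s t assume st: "s \<in> W" "t \<in> W"
    have "(\<Sum>w\<in>W. pull w (stb s) * (of_int (eps w) * pull w (std t))) = alt (stb s * std t :: 'v \<Rightarrow>\<^sub>0 'k)"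
      unfolding alt_def by (intro sum.cong refl) (simp add: pull_mult mult_ac)
    also have "\<dots> = denom * J (stb s * std t)"
      using st by (intro alt_J GR_mult[OF subgp_X] stb_GR std_GR)
    finally show "(\<Sum>w\<in>W. pull w (stb s) * (of_int (eps w) * pull w (std t))) = (if s = t then denom else (0 :: 'v \<Rightarrow>\<^sub>0 'k))"
      using J_std[OF st(2,1)] by simp
  qed simp_all
  then have "of_int (eps w) * (\<Sum>t\<in>W. (of_int (eps w) * pull w (std t)) * pull u (stb t)) = of_int (eps w) * (if w = u then denom else (0 :: 'v \<Rightarrow>\<^sub>0 'k))"
    by simp
  moreover have "of_int (eps w) * (\<Sum>t\<in>W. (of_int (eps w) * pull w (std t)) * pull u (stb t)) = (of_int (eps w * eps w) * (\<Sum>t\<in>W. pull w (std t) * pull u (stb t)) :: 'v \<Rightarrow>\<^sub>0 'k)"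
    by (simp add: sum_distrib_left mult.assoc)
  ultimately show ?thesis by (simp add: eps_square)
qed

end

lemma (in subquot) C_of_int: "of_int m \<in> C"
proof (induction m rule: int_induct[where k = 0])
  case (step1 m)
  then show ?case by (simp add: C_add C_1)
next
  case (step2 m)
  then show ?case by (simp add: C_diff C_1)
qed (simp add: C_0)

text \<open>The values of \<gamma> on Y form a nonzero group of integers. Dividing by its least
  positive element, attained at \<open>y0\<close>, produces a functional that takes the value
  1.\<close>

lemma ex_height:
  fixes Y :: "'v::real_inner set"
  assumes Y: "subgp Y" and int: "\<And>l. l \<in> Y \<Longrightarrow> l \<bullet> \<gamma> \<in> \<int>" and a: "a \<in> Y" "a \<bullet> \<gamma> \<noteq> 0"
  shows "\<exists>\<phi> y0. height Y \<phi> y0 \<and> \<phi> a \<noteq> 0 \<and> (\<forall>b\<in>Y. b \<bullet> \<gamma> = 0 \<longrightarrow> \<phi> b = 0)"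
proof -
  define i where "i l = \<lfloor>l \<bullet> \<gamma>\<rfloor>" for l
  have i: "of_int (i l) = l \<bullet> \<gamma>" if "l \<in> Y" for l
    using int[OF that] by (auto simp: i_def elim: Ints_cases)
  have i_eq: "i l = m" if "l \<in> Y" "l \<bullet> \<gamma> = of_int m" for l m
    using i[OF that(1)] that(2) by simp
  define Q where "Q n \<longleftrightarrow> 0 < n \<and> (\<exists>l\<in>Y. i l = int n)" for n
  have "\<exists>n. Q n"
  proof (cases "i a > 0")
    case True
    then show ?thesis using a by (intro exI[of _ "nat (i a)"]) (auto simp: Q_def)
  next
    case False
    have "i (- a) = - i a" using i[OF a(1)] by (intro i_eq subgp_minus[OF Y] a) auto
    moreover have "i a \<noteq> 0" using i[OF a(1)] a(2) by auto
    ultimately show ?thesis using False subgp_minus[OF Y a(1)]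
      by (intro exI[of _ "nat (- i a)"]) (auto simp: Q_def)
  qed
  then have Qg: "Q (LEAST n. Q n)" by (rule LeastI_ex)
  define g where "g = int (LEAST n. Q n)"
  have g: "g > 0" using Qg by (simp add: Q_def g_def)
  obtain y0 where y0: "y0 \<in> Y" "i y0 = g" using Qg by (auto simp: Q_def g_def)
  have mult: "of_int m *\<^sub>R y0 \<in> Y" for m
  proof (induction m rule: int_induct[where k = 0])
    case (step1 m)
    then show ?case using subgp_add[OF Y _ y0(1)] by (simp add: scaleR_add_left)
  next
    case (step2 m)
    then show ?case using subgp_diff[OF Y _ y0(1)] by (simp add: scaleR_diff_left)
  qed (simp add: subgp_0[OF Y])
  have dvd: "g dvd i l" if l: "l \<in> Y" for l
  proof (rule ccontr)
    assume ndvd: "\<not> g dvd i l"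
    define r where "r = i l mod g"
    have "r \<noteq> 0" using ndvd by (auto simp: r_def)
    then have r: "0 < r" "r < g"
      using pos_mod_sign[OF g, of "i l"] pos_mod_bound[OF g, of "i l"] by (auto simp: r_def)
    have mem: "l - of_int (i l div g) *\<^sub>R y0 \<in> Y" by (intro subgp_diff[OF Y] l mult)
    have "r = i l - (i l div g) * g" by (simp add: r_def minus_div_mult_eq_mod)
    then have "i (l - of_int (i l div g) *\<^sub>R y0) = r"
      using i[OF l] i[OF y0(1)] y0(2) by (intro i_eq mem) (simp add: inner_diff_left)
    then have "Q (nat r)" using r mem by (auto simp: Q_def)
    then have "(LEAST n. Q n) \<le> nat r" by (rule Least_le)
    then show False using r by (simp add: g_def)
  qed
  define \<phi> where "\<phi> l = i l div g" for l
  have "height Y \<phi> y0"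
  proof
    fix x y assume xy: "x \<in> Y" "y \<in> Y"
    have "i (x + y) = i x + i y"
      using i[OF xy(1)] i[OF xy(2)] by (intro i_eq subgp_add[OF Y] xy) (simp add: inner_add_left)
    then show "\<phi> (x + y) = \<phi> x + \<phi> y" using dvd[OF xy(1)] by (simp add: \<phi>_def div_plus_div_distrib_dvd_left)
  qed (use Y y0 g in \<open>auto simp: \<phi>_def\<close>)
  moreover have "\<phi> a \<noteq> 0"
  proof
    assume "\<phi> a = 0"
    then have "i a = 0" using dvd_mult_div_cancel[OF dvd[OF a(1)]] by (simp add: \<phi>_def)
    then show False using i[OF a(1)] a(2) by simp
  qed
  moreover have "\<phi> b = 0" if "b \<in> Y" "b \<bullet> \<gamma> = 0" for b
    using i_eq[OF that(1), of 0] that(2) by (simp add: \<phi>_def)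
  ultimately show ?thesis by blast
qed

section \<open>Cauchy sequences in the group algebra\<close>

context weyl_algebra
begin

lemma filtered_coprime:
  assumes "a \<in> P" "b \<in> P" "a \<noteq> b"
  shows "\<exists>m. \<forall>z\<in>GR X. (1 - gx (coroot a)) * z \<in> (Mod X (coroot b) m :: ('v \<Rightarrow>\<^sub>0 'k) set) \<longrightarrow> z \<in> Mod X (coroot b) n"
proof -
  obtain \<gamma> where \<gamma>: "coroot a \<bullet> \<gamma> \<noteq> 0" "coroot b \<bullet> \<gamma> = 0" "\<forall>l\<in>X. l \<bullet> \<gamma> \<in> \<int>"
    using ex_separating[OF assms] by blast
  have ab: "coroot a \<in> X" "coroot b \<in> X" using assms P_root coroot_X by auto
  obtain \<phi> y0 where h: "height X \<phi> y0" "\<phi> (coroot a) \<noteq> 0" "\<phi> (coroot b) = 0"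
    using ex_height[OF subgp_X _ ab(1) \<gamma>(1)] \<gamma> ab by blast
  interpret height X \<phi> y0 "TYPE('k)" by (rule h(1))
  show ?thesis by (rule Mod_coprime[OF _ ab(1) h(2)]) (simp add: K_def ab h(3))
qed

text \<open>The case b = 0 of \<open>Mod_coprime\<close>. The functional is pairing with \<alpha>,
  integral on cocharacters and equal to 2 on the coroot as an integer, even when 2 vanishes in the
  field.\<close>

lemma filtered_regular:
  assumes "\<alpha> \<in> \<Phi>"
  shows "\<exists>m. \<forall>z\<in>GR X. (1 - gx (coroot \<alpha>)) * z \<in> (GI X m :: ('v \<Rightarrow>\<^sub>0 'k) set) \<longrightarrow> z \<in> GI X n"
proof -
  have a: "coroot \<alpha> \<in> X" using assms coroot_X by auto
  have "coroot \<alpha> \<bullet> \<alpha> \<noteq> 0" using coroot_self[OF root_nz[OF assms]] by (simp add: inner_commute)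
  then obtain \<phi> y0 where h: "height X \<phi> y0" "\<phi> (coroot \<alpha>) \<noteq> 0"
    using ex_height[OF subgp_X _ a, of \<alpha>] assms by (auto simp: cochar_def inner_commute)
  interpret height X \<phi> y0 "TYPE('k)" by (rule h(1))
  have "0 \<in> K" by (rule subgp_0[OF subgp_K])
  from Mod_coprime[OF this a h(2)] show ?thesis by simp
qed

text \<open>The term x n represents a class modulo the n-th power, so comparing neighbours expresses
  compatibility, and membership in \<open>Ns\<close> means being zero at each level. Pointwise
  operations make all sequences a commutative ring, and the completion is \<open>Cs\<close> modulo
  \<open>Ns\<close>.\<close>

definition Cs :: "(nat \<Rightarrow> 'v \<Rightarrow>\<^sub>0 'k) set" where
  "Cs = {x. \<forall>n. x n \<in> GR X \<and> x (Suc n) - x n \<in> GI X n}"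

definition Ns :: "(nat \<Rightarrow> 'v \<Rightarrow>\<^sub>0 'k) set" where
  "Ns = {x. \<forall>n. x n \<in> GI X n}"

definition cst :: "('v \<Rightarrow>\<^sub>0 'k) \<Rightarrow> nat \<Rightarrow> 'v \<Rightarrow>\<^sub>0 'k" where "cst p = (\<lambda>n. p)"

definition spull :: "('v \<Rightarrow> 'v) \<Rightarrow> (nat \<Rightarrow> 'v \<Rightarrow>\<^sub>0 'k) \<Rightarrow> nat \<Rightarrow> 'v \<Rightarrow>\<^sub>0 'k" where
  "spull w x = (\<lambda>n. pull w (x n))"

sublocale sq: subquot Cs Ns
proof
  show "1 \<in> Cs" by (simp add: Cs_def one_fun_def GR_1 subgp_X GI_0 del: GI.simps)
next
  fix x y assume xy: "x \<in> Cs" "y \<in> Cs"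
  have GRs: "x n \<in> GR X" "y n \<in> GR X" for n using xy by (auto simp: Cs_def)
  have d: "x (Suc n) - x n \<in> GI X n" "y (Suc n) - y n \<in> GI X n" for n using xy by (auto simp: Cs_def)
  have e: "(x - y) (Suc n) - (x - y) n = (x (Suc n) - x n) - (y (Suc n) - y n)" for n by simp
  have "(x - y) (Suc n) - (x - y) n \<in> GI X n" for n
    unfolding e by (intro GI_diff[OF subgp_X] d)
  moreover have "(x - y) n \<in> GR X" for n using GRs by (simp add: GR_diff)
  ultimately show "x - y \<in> Cs" by (simp add: Cs_def)
  have e: "(x * y) (Suc n) - (x * y) n = y (Suc n) * (x (Suc n) - x n) + x n * (y (Suc n) - y n)" for n
    by (simp add: algebra_simps)
  have "(x * y) (Suc n) - (x * y) n \<in> GI X n" for n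
    unfolding e by (intro GI_add GI_mult[OF subgp_X] GRs d)
  moreover have "(x * y) n \<in> GR X" for n using GRs by (simp add: GR_mult[OF subgp_X])
  ultimately show "x * y \<in> Cs" by (simp add: Cs_def)
next
  show "0 \<in> Ns" by (simp add: Ns_def GI_0)
  show "x - y \<in> Ns" if "x \<in> Ns" "y \<in> Ns" for x y using that by (simp add: Ns_def GI_diff[OF subgp_X])
  show "x * y \<in> Ns" if "x \<in> Cs" "y \<in> Ns" for x y using that by (simp add: Ns_def Cs_def GI_mult[OF subgp_X])
qed

lemma Ns_Cs: "x \<in> Ns \<Longrightarrow> x \<in> Cs"
proof -
  assume x: "x \<in> Ns"
  have 1: "x n \<in> GI X n" for n using x by (simp add: Ns_def)
  have "x (Suc n) - x n \<in> GI X n" for n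
    by (rule GI_diff[OF subgp_X GI_Suc_subset[OF subgp_X 1] 1])
  then show ?thesis using GI_GR[OF subgp_X 1] by (simp add: Cs_def)
qed

lemma Cs_GR: "x \<in> Cs \<Longrightarrow> x n \<in> GR X"
  by (simp add: Cs_def)

lemma Cs_diff_GI:
  assumes x: "x \<in> Cs" and "n \<le> m"
  shows "x m - x n \<in> GI X n"
  using assms(2)
proof (induction m rule: dec_induct)
  case base
  then show ?case by (simp add: GI_0)
next
  case (step m)
  have "x (Suc m) - x m \<in> GI X n"
    using x by (intro GI_antimono[OF subgp_X step.hyps(1)]) (auto simp: Cs_def)
  from GI_add[OF this step.IH] show ?case by simp
qed

lemma cst_Cs: "p \<in> GR X \<Longrightarrow> cst p \<in> Cs"
  by (simp add: Cs_def cst_def GI_0)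

lemma cst_mult: "cst (p * q) = cst p * cst q" and cst_add: "cst (p + q) = cst p + cst q"
  and cst_0: "cst 0 = 0" and cst_1: "cst 1 = 1"
  by (auto simp: cst_def)

lemma cst_sum: "cst (sum f I) = (\<Sum>i\<in>I. cst (f i))"
  by (induction I rule: infinite_finite_induct) (auto simp: cst_0 cst_add)

lemma cst_prod: "cst (prod f I) = (\<Prod>i\<in>I. cst (f i))"
  by (induction I rule: infinite_finite_induct) (auto simp: cst_1 cst_mult)

lemma cst_of_int: "cst (of_int m) = of_int m"
proof (induction m rule: int_induct[where k = 0])
  case (step1 i)
  then show ?case by (simp add: cst_add cst_1)
next
  case (step2 i)
  have "cst (of_int i) = cst (of_int (i - 1)) + cst 1" by (simp flip: cst_add)
  then show ?case using step2 by (simp add: cst_1)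
qed (simp add: cst_0)

lemma spull_Cs: "w \<in> W \<Longrightarrow> x \<in> Cs \<Longrightarrow> spull w x \<in> Cs"
  unfolding Cs_def spull_def
  using pull_GI[of w] by (auto simp: pull_GR simp flip: pull_diff[OF weyl_inj])

lemma spull_Ns: "w \<in> W \<Longrightarrow> x \<in> Ns \<Longrightarrow> spull w x \<in> Ns"
  by (simp add: Ns_def spull_def pull_GI)

lemma spull_mult: "w \<in> W \<Longrightarrow> spull w (x * y) = spull w x * spull w y"
  and spull_diff: "w \<in> W \<Longrightarrow> spull w (x - y) = spull w x - spull w y"
  and spull_add: "w \<in> W \<Longrightarrow> spull w (x + y) = spull w x + spull w y"
  and spull_0: "w \<in> W \<Longrightarrow> spull w 0 = 0"
  by (auto simp: spull_def pull_mult pull_diff pull_add pull_0 weyl_inj)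

lemma spull_sum: "w \<in> W \<Longrightarrow> spull w (sum f I) = (\<Sum>i\<in>I. spull w (f i))"
  by (induction I rule: infinite_finite_induct) (auto simp: spull_0 spull_add)

lemma spull_cst: "spull w (cst p) = cst (pull w p)"
  by (simp add: spull_def cst_def)

lemma spull_of_int: "w \<in> W \<Longrightarrow> spull w (of_int m) = of_int m"
  by (simp add: spull_cst pull_of_int flip: cst_of_int)

lemma spull_comp: "w \<in> W \<Longrightarrow> u \<in> W \<Longrightarrow> spull (w \<circ> u) x = spull u (spull w x)"
  by (simp add: spull_def pull_comp weyl_inj)

lemma spull_id [simp]: "spull id x = x"
  by (simp add: spull_def)

section \<open>Divisibility, coprimality and regularity for Cauchy sequences\<close>

definition E :: "'v \<Rightarrow> nat \<Rightarrow> 'v \<Rightarrow>\<^sub>0 'k" where "E \<alpha> = cst (1 - gx (coroot \<alpha>))"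

lemma E_Cs: "\<alpha> \<in> \<Phi> \<Longrightarrow> E \<alpha> \<in> Cs"
  unfolding E_def by (intro cst_Cs GR_diff GR_1[OF subgp_X] GR_gx coroot_X)

lemma divs_Mod: "x \<in> Cs \<Longrightarrow> sq.divs (E \<alpha>) x \<Longrightarrow> x n \<in> Mod X (coroot \<alpha>) n"
proof -
  assume "sq.divs (E \<alpha>) x"
  then obtain g where g: "g \<in> Cs" "x - E \<alpha> * g \<in> Ns" by (auto simp: sq.divs_def)
  show ?thesis
    using g by (intro ModI[of _ _ "g n" "(x - E \<alpha> * g) n"]) (auto simp: E_def cst_def Cs_GR Ns_def)
qed

text \<open>The ideal of \<open>E \<alpha>\<close> is closed. Quotients chosen level by level need
  not be compatible, but uniform regularity makes them a Cauchy sequence after passing to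
  sufficiently late indices.\<close>

lemma Mod_divs:
  assumes \<alpha>: "\<alpha> \<in> \<Phi>" and x: "x \<in> Cs" and h: "\<And>n. x n \<in> Mod X (coroot \<alpha>) n"
  shows "sq.divs (E \<alpha>) x"
proof -
  have "\<exists>y. y \<in> GR X \<and> x n - (1 - gx (coroot \<alpha>)) * y \<in> GI X n" for n
    using h[of n] by (auto simp: Mod_def)
  then have "\<exists>y. \<forall>n. y n \<in> GR X \<and> x n - (1 - gx (coroot \<alpha>)) * y n \<in> GI X n" by (rule choice[OF allI])
  then obtain y where y: "\<And>n. y n \<in> GR X" "\<And>n. x n - (1 - gx (coroot \<alpha>)) * y n \<in> GI X n" by blast
  have "\<exists>m. \<forall>n. \<forall>z\<in>GR X. (1 - gx (coroot \<alpha>)) * z \<in> (GI X (m n) :: ('v \<Rightarrow>\<^sub>0 'k) set) \<longrightarrow> z \<in> GI X n"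
    by (rule choice[OF allI]) (rule filtered_regular[OF \<alpha>])
  then obtain m where m: "\<And>n z. z \<in> GR X \<Longrightarrow> (1 - gx (coroot \<alpha>)) * z \<in> (GI X (m n) :: ('v \<Rightarrow>\<^sub>0 'k) set) \<Longrightarrow> z \<in> GI X n" by blast
  \<comment> \<open>The partial sums make M monotone with M n at least n and at least m n: late
    enough for regularity to yield precision n.\<close>
  define M where "M n = n + (\<Sum>k\<le>n. m k)" for n
  have M: "n \<le> M n" "m n \<le> M n" "M n \<le> M (Suc n)" for n
    using member_le_sum[of n "{..n}" m] by (auto simp: M_def)
  define g where "g n = y (M n)" for n
  have "g (Suc n) - g n \<in> GI X n" for n
  proof (rule m)
    let ?e = "\<lambda>k. x k - (1 - gx (coroot \<alpha>)) * y k"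
    have "(1 - gx (coroot \<alpha>)) * (g (Suc n) - g n) = (x (M (Suc n)) - x (M n)) - ?e (M (Suc n)) + ?e (M n)"
      by (simp add: g_def algebra_simps)
    moreover have "(x (M (Suc n)) - x (M n)) - ?e (M (Suc n)) + ?e (M n) \<in> GI X (M n)"
      by (intro GI_add GI_diff[OF subgp_X] Cs_diff_GI[OF x M(3)] y(2) GI_antimono[OF subgp_X M(3) y(2)])
    ultimately show "(1 - gx (coroot \<alpha>)) * (g (Suc n) - g n) \<in> GI X (m n)"
      using GI_antimono[OF subgp_X M(2)] by metis
  qed (simp add: g_def y GR_diff)
  then have g: "g \<in> Cs" using y(1) by (simp add: Cs_def g_def)
  have "(x - E \<alpha> * g) n \<in> GI X n" for n
  proof -
    have "(x - E \<alpha> * g) n = (x (M n) - (1 - gx (coroot \<alpha>)) * y (M n)) - (x (M n) - x n)"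
      by (simp add: E_def cst_def g_def)
    then show ?thesis
      using GI_diff[OF subgp_X GI_antimono[OF subgp_X M(1) y(2)] Cs_diff_GI[OF x M(1)]] by metis
  qed
  then have "x - E \<alpha> * g \<in> Ns" unfolding Ns_def by blast
  then show ?thesis using g unfolding sq.divs_def by blast
qed

text \<open>Go down to one level k, late enough for \<open>filtered_coprime\<close>, and come back
  to level n by the Cauchy property; closedness of the ideal then reassembles the levels.\<close>

lemma divs_coprime:
  assumes ab: "a \<in> P" "b \<in> P" "a \<noteq> b" and y: "y \<in> Cs" and div: "sq.divs (E b) (E a * y)"
  shows "sq.divs (E b) y"
proof (rule Mod_divs[OF P_root[OF ab(2)] y])
  fix n
  have bX: "coroot b \<in> X" by (rule coroot_X[OF P_root[OF ab(2)]])
  obtain m where m: "\<And>z. z \<in> GR X \<Longrightarrow> (1 - gx (coroot a)) * z \<in> (Mod X (coroot b) m :: ('v \<Rightarrow>\<^sub>0 'k) set) \<Longrightarrow> z \<in> Mod X (coroot b) n"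
    using filtered_coprime[OF ab] by blast
  define k where "k = max m n"
  have "(E a * y) k \<in> Mod X (coroot b) k"
    by (rule divs_Mod[OF sq.C_mult[OF E_Cs[OF P_root[OF ab(1)]] y] div])
  then have "(1 - gx (coroot a)) * y k \<in> Mod X (coroot b) m"
    using Mod_antimono[OF subgp_X bX, of m k] by (simp add: E_def cst_def k_def)
  then have 1: "y k \<in> Mod X (coroot b) n" by (rule m[OF Cs_GR[OF y]])
  have 2: "y k - y n \<in> Mod X (coroot b) n"
    by (rule GI_Mod[OF subgp_X bX Cs_diff_GI[OF y]]) (simp add: k_def)
  show "y n \<in> Mod X (coroot b) n" using Mod_diff[OF subgp_X bX 1 2] by simp
qed

lemma E_regular:
  assumes \<alpha>: "\<alpha> \<in> \<Phi>" and y: "y \<in> Cs" and 0: "E \<alpha> * y \<in> Ns"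
  shows "y \<in> Ns"
  unfolding Ns_def
proof (intro CollectI allI)
  fix n
  obtain m where m: "\<And>z. z \<in> GR X \<Longrightarrow> (1 - gx (coroot \<alpha>)) * z \<in> (GI X m :: ('v \<Rightarrow>\<^sub>0 'k) set) \<Longrightarrow> z \<in> GI X n"
    using filtered_regular[OF \<alpha>] by blast
  define k where "k = max m n"
  have "(1 - gx (coroot \<alpha>)) * y k \<in> GI X k" using 0 by (simp add: Ns_def E_def cst_def)
  then have "(1 - gx (coroot \<alpha>)) * y k \<in> GI X m"
    by (rule GI_antimono[OF subgp_X, rotated]) (simp add: k_def)
  then have 1: "y k \<in> GI X n" by (rule m[OF Cs_GR[OF y]])
  have 2: "y k - y n \<in> GI X n" by (rule Cs_diff_GI[OF y]) (simp add: k_def)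
  show "y n \<in> GI X n" using GI_diff[OF subgp_X 1 2] by simp
qed

definition sden :: "nat \<Rightarrow> 'v \<Rightarrow>\<^sub>0 'k" where "sden = cst denom"

lemma sden_eq: "sden = cst (gx (- \<rho>)) * (\<Prod>a\<in>P. E a)"
  by (simp add: sden_def denom_def cst_mult cst_prod E_def)

lemma gx_\<rho>_Cs: "cst (gx \<rho>) \<in> Cs" "cst (gx (- \<rho>)) \<in> Cs"
  by (intro cst_Cs GR_gx \<rho>_X subgp_minus[OF subgp_X])+

lemma gx_\<rho>_inverse: "cst (gx \<rho>) * cst (gx (- \<rho>)) = 1"
  by (simp add: cst_1 flip: cst_mult gx_add)

lemma sden_regular:
  assumes y: "y \<in> Cs" and 0: "sden * y \<in> Ns"
  shows "y \<in> Ns"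
proof -
  have prod: "finite S \<Longrightarrow> S \<subseteq> P \<Longrightarrow> (\<Prod>a\<in>S. E a) * y \<in> Ns \<Longrightarrow> y \<in> Ns" for S
  proof (induction S rule: finite_induct)
    case (insert a S)
    have "(\<Prod>a\<in>S. E a) * y \<in> Ns"
    proof (rule E_regular)
      show "a \<in> \<Phi>" using insert.prems P_root by auto
      show "(\<Prod>a\<in>S. E a) * y \<in> Cs"
        using insert.prems by (intro sq.C_mult sq.C_prod E_Cs P_root y) auto
      show "E a * ((\<Prod>a\<in>S. E a) * y) \<in> Ns" using insert.prems(2) unfolding prod.insert[OF insert.hyps(1,2)] mult.assoc .
    qed
    then show ?case using insert.IH insert.prems(1) by blast
  qed simp
  have "cst (gx \<rho>) * (sden * y) = (cst (gx \<rho>) * cst (gx (- \<rho>))) * ((\<Prod>a\<in>P. E a) * y)"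
    by (simp only: sden_eq mult.assoc)
  then have "(\<Prod>a\<in>P. E a) * y \<in> Ns"
    using sq.N_mult[OF gx_\<rho>_Cs(1) 0] by (simp add: gx_\<rho>_inverse)
  then show ?thesis using prod[OF finite_P] by blast
qed

lemma sden_cancel:
  assumes "x \<in> Cs" "y \<in> Cs" "sden * x - sden * y \<in> Ns"
  shows "x - y \<in> Ns"
  using sden_regular[of "x - y"] assms by (simp add: sq.C_diff right_diff_distrib)

lemma divs_sden:
  assumes z: "z \<in> Cs" and div: "\<And>a. a \<in> P \<Longrightarrow> sq.divs (E a) z"
  shows "sq.divs sden z"
proof -
  have "sq.divs (\<Prod>a\<in>P. E a) z"
    by (rule sq.divs_prod[OF finite_P E_Cs[OF P_root] z divs_coprime div])
  then show ?thesis
    unfolding sden_eq by (intro sq.divs_unit[where v = "cst (gx \<rho>)"] gx_\<rho>_Cs gx_\<rho>_inverse)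
qed

lemma spull_refl_divs:
  assumes \<alpha>: "\<alpha> \<in> \<Phi>" and y: "y \<in> Cs"
  shows "sq.divs (E \<alpha>) (y - spull (root_refl \<alpha>) y)"
proof (rule Mod_divs[OF \<alpha>])
  show "y - spull (root_refl \<alpha>) y \<in> Cs" by (intro sq.C_diff y spull_Cs weyl_refl \<alpha>)
  fix n
  obtain g where "g \<in> GR X" "y n - pull (root_refl \<alpha>) (y n) = (1 - gx (coroot \<alpha>)) * g"
    using pull_refl_dvd[OF \<alpha> Cs_GR[OF y]] by blast
  then show "(y - spull (root_refl \<alpha>) y) n \<in> Mod X (coroot \<alpha>) n"
    by (intro ModI[of _ _ g 0]) (auto simp: spull_def GI_0)
qed

section \<open>Families of congruent elements\<close>

definition congruent_family :: "(('v \<Rightarrow> 'v) \<Rightarrow> nat \<Rightarrow> 'v \<Rightarrow>\<^sub>0 'k) \<Rightarrow> bool" where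
  "congruent_family f \<longleftrightarrow> (\<forall>w\<in>W. f w \<in> Cs \<and> (\<forall>\<alpha>\<in>\<Phi>. sq.divs (E \<alpha>) (f w - f (w \<circ> root_refl \<alpha>))))"

text \<open>With y' the transform of y under w, the difference to be divided is y' minus its
  reflection.\<close>

lemma congruent_family_spull: "y \<in> Cs \<Longrightarrow> congruent_family (\<lambda>w. spull w y)"
  unfolding congruent_family_def
  using spull_refl_divs spull_Cs by (auto simp: spull_comp weyl_refl)

lemma congruent_family_mult:
  assumes f: "congruent_family f" and g: "congruent_family g"
  shows "congruent_family (\<lambda>w. f w * g w)"
  unfolding congruent_family_def
proof (intro ballI conjI)
  fix w assume w: "w \<in> W"
  show "f w * g w \<in> Cs" using f g w by (auto simp: congruent_family_def intro: sq.C_mult)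
  fix \<alpha> assume \<alpha>: "\<alpha> \<in> \<Phi>"
  let ?u = "w \<circ> root_refl \<alpha>"
  have u: "?u \<in> W" by (intro weyl_comp w weyl_refl \<alpha>)
  have "f w * g w - f ?u * g ?u = f w * (g w - g ?u) + g ?u * (f w - f ?u)" by (simp add: algebra_simps)
  moreover have "sq.divs (E \<alpha>) (f w * (g w - g ?u) + g ?u * (f w - f ?u))"
    using f g w u \<alpha> by (intro sq.divs_add sq.divs_mult) (auto simp: congruent_family_def)
  ultimately show "sq.divs (E \<alpha>) (f w * g w - f ?u * g ?u)" by simp
qed

definition salt :: "(('v \<Rightarrow> 'v) \<Rightarrow> nat \<Rightarrow> 'v \<Rightarrow>\<^sub>0 'k) \<Rightarrow> nat \<Rightarrow> 'v \<Rightarrow>\<^sub>0 'k" where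
  "salt f = (\<Sum>w\<in>W. of_int (eps w) * f w)"

lemma salt_divs:
  assumes f: "congruent_family f"
  shows "sq.divs sden (salt f)"
proof (rule divs_sden)
  show "salt f \<in> Cs"
    unfolding salt_def using f by (intro sq.C_sum sq.C_mult sq.C_of_int) (auto simp: congruent_family_def)
  fix a assume a: "a \<in> P"
  show "sq.divs (E a) (salt f)"
    unfolding salt_def alternating_sum_pair[OF a]
    using f P_root[OF a] by (intro sq.divs_sum sq.divs_mult sq.C_of_int) (auto simp: congruent_family_def)
qed

text \<open>The coefficient of \<open>std t\<close>, determined only up to a null sequence; all
  later statements about it are modulo \<open>Ns\<close>.\<close>

definition coef :: "(('v \<Rightarrow> 'v) \<Rightarrow> nat \<Rightarrow> 'v \<Rightarrow>\<^sub>0 'k) \<Rightarrow> ('v \<Rightarrow> 'v) \<Rightarrow> nat \<Rightarrow> 'v \<Rightarrow>\<^sub>0 'k" where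
  "coef f t = (SOME g. g \<in> Cs \<and> salt (\<lambda>w. f w * cst (pull w (stb t))) - sden * g \<in> Ns)"

lemma coef:
  assumes f: "congruent_family f" and t: "t \<in> W"
  shows "coef f t \<in> Cs" and "salt (\<lambda>w. f w * cst (pull w (stb t))) - sden * coef f t \<in> Ns"
proof -
  have "congruent_family (\<lambda>w. f w * spull w (cst (stb t)))"
    by (intro congruent_family_mult f congruent_family_spull cst_Cs stb_GR t)
  then have "sq.divs sden (salt (\<lambda>w. f w * cst (pull w (stb t))))"
    using salt_divs by (simp add: spull_cst)
  then have "\<exists>g. g \<in> Cs \<and> salt (\<lambda>w. f w * cst (pull w (stb t))) - sden * g \<in> Ns" by (auto simp: sq.divs_def)
  then have "coef f t \<in> Cs \<and> salt (\<lambda>w. f w * cst (pull w (stb t))) - sden * coef f t \<in> Ns"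
    unfolding coef_def by (rule someI_ex)
  then show "coef f t \<in> Cs" "salt (\<lambda>w. f w * cst (pull w (stb t))) - sden * coef f t \<in> Ns" by auto
qed

text \<open>It suffices to compare after multiplication by the denominator, where the coefficients
  become alternating sums and \<open>diagonal\<close> can be applied.\<close>

lemma coef_expansion:
  assumes f: "congruent_family f" and w: "w \<in> W"
  shows "f w - (\<Sum>t\<in>W. coef f t * cst (pull w (std t))) \<in> Ns"
proof (rule sden_cancel)
  have fC: "f u \<in> Cs" if "u \<in> W" for u using f that by (simp add: congruent_family_def)
  have stdC: "cst (pull w (std t)) \<in> Cs" if "t \<in> W" for t by (intro cst_Cs pull_GR w std_GR that)
  show "f w \<in> Cs" by (rule fC[OF w])
  show "(\<Sum>t\<in>W. coef f t * cst (pull w (std t))) \<in> Cs"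
    by (intro sq.C_sum sq.C_mult coef(1)[OF f] stdC)
  let ?S = "\<lambda>t. salt (\<lambda>u. f u * cst (pull u (stb t)))"
  have "(\<Sum>t\<in>W. ?S t * cst (pull w (std t)))
      = (\<Sum>t\<in>W. \<Sum>u\<in>W. (of_int (eps u) * f u) * (cst (pull u (stb t)) * cst (pull w (std t))))"
    by (simp add: salt_def sum_distrib_right mult.assoc)
  \<comment> \<open>After interchanging the sums the inner one is the left side of
    \<open>diagonal\<close>: only u = w survives, with the sign occurring twice and
    cancelling.\<close>
  also have "\<dots> = (\<Sum>u\<in>W. (of_int (eps u) * f u) * cst (\<Sum>t\<in>W. pull w (std t) * pull u (stb t)))"
    unfolding cst_sum cst_mult sum_distrib_left
    by (subst sum.swap) (simp only: mult.commute[of "cst (pull _ (std _))"])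
  also have "\<dots> = (\<Sum>u\<in>W. if u = w then of_int (eps w * eps w) * f w * sden else 0)"
  proof (intro sum.cong refl)
    fix u assume u: "u \<in> W"
    show "(of_int (eps u) * f u) * cst (\<Sum>t\<in>W. pull w (std t) * pull u (stb t))
        = (if u = w then of_int (eps w * eps w) * f w * sden else 0)"
      unfolding diagonal[OF u w] by (auto simp: cst_mult cst_of_int cst_0 sden_def mult_ac)
  qed
  also have "\<dots> = sden * f w"
    using weyl_finite w by (simp add: eps_square mult.commute)
  finally have S: "(\<Sum>t\<in>W. ?S t * cst (pull w (std t))) = sden * f w" .
  have "(\<Sum>t\<in>W. cst (pull w (std t)) * (?S t - sden * coef f t)) \<in> Ns"
    by (intro sq.N_sum sq.N_mult stdC coef(2)[OF f])
  also have "(\<Sum>t\<in>W. cst (pull w (std t)) * (?S t - sden * coef f t))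
      = (\<Sum>t\<in>W. ?S t * cst (pull w (std t))) - sden * (\<Sum>t\<in>W. coef f t * cst (pull w (std t)))"
    by (simp add: right_diff_distrib sum_subtractf sum_distrib_left mult_ac)
  finally show "sden * f w - sden * (\<Sum>t\<in>W. coef f t * cst (pull w (std t))) \<in> Ns"
    unfolding S .
qed

text \<open>For a family of conjugates of one element, reindexing by w u shows that the alternating
  sum is multiplied by the sign of u, exactly like the denominator; the quotient is therefore
  fixed.\<close>

lemma coef_spull_invariant:
  assumes y: "y \<in> Cs" and t: "t \<in> W" and u: "u \<in> W"
  shows "spull u (coef (\<lambda>w. spull w y) t) - coef (\<lambda>w. spull w y) t \<in> Ns"
proof (rule sden_cancel)
  let ?g = "coef (\<lambda>w. spull w y) t"
  let ?z = "y * cst (stb t)"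
  let ?S = "salt (\<lambda>w. spull w y * cst (pull w (stb t)))"
  note fam = congruent_family_spull[OF y]
  have g: "?g \<in> Cs" "?S - sden * ?g \<in> Ns" using coef[OF fam t] by auto
  show "?g \<in> Cs" "spull u ?g \<in> Cs" using g spull_Cs u by auto
  have S: "?S = (\<Sum>w\<in>W. of_int (eps w) * spull w ?z)"
    unfolding salt_def by (intro sum.cong refl) (simp add: spull_mult spull_cst)
  have "bij_betw (\<lambda>w. w \<circ> u) W W"
  proof (rule bij_betw_byWitness[where f' = "\<lambda>w. w \<circ> finv u"])
    have 1: "u \<circ> finv u = id" "finv u \<circ> u = id" using weyl_inv_right[OF u] weyl_inv_left[OF u] by auto
    show "\<forall>a\<in>W. a \<circ> u \<circ> finv u = a" "\<forall>a'\<in>W. a' \<circ> finv u \<circ> u = a'"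
      by (simp_all only: comp_assoc 1 comp_id) simp_all
  qed (use weyl_comp u weyl_inv in auto)
  then have "?S = (\<Sum>w\<in>W. of_int (eps (w \<circ> u)) * spull (w \<circ> u) ?z)"
    unfolding S by (rule sum.reindex_bij_betw[symmetric])
  also have "\<dots> = (\<Sum>w\<in>W. of_int (eps u) * spull u (of_int (eps w) * spull w ?z))"
    by (intro sum.cong refl) (simp add: eps_comp u spull_comp spull_mult spull_of_int mult_ac)
  also have "\<dots> = of_int (eps u) * spull u ?S"
    by (simp add: S spull_sum[OF u] sum_distrib_left)
  finally have Su: "?S = of_int (eps u) * spull u ?S" .
  have "spull u sden = of_int (eps u) * sden"
    by (simp add: sden_def spull_cst pull_denom[OF u] cst_mult cst_of_int)
  then have "of_int (eps u) * spull u (?S - sden * ?g) = ?S - of_int (eps u * eps u) * (sden * spull u ?g)"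
    using Su by (simp add: spull_diff u spull_mult right_diff_distrib mult.assoc)
  then have "?S - sden * spull u ?g \<in> Ns"
    using sq.N_mult[OF sq.C_of_int spull_Ns[OF u g(2)], of "eps u"] by (simp add: eps_square)
  from sq.N_diff[OF g(2) this] show "sden * spull u ?g - sden * ?g \<in> Ns" by simp
qed

text \<open>Injectivity rests on this. Interchanging the sums over p and w exhibits the combination
  of alternating sums as a combination, over w, of the values assumed null; the denominator is then
  cancelled.\<close>

lemma coef_relation:
  assumes fin: "finite S" and C: "\<And>p. p \<in> S \<Longrightarrow> x p \<in> Cs" "\<And>p. p \<in> S \<Longrightarrow> y p \<in> Cs" and t: "t \<in> W"
    and 0: "\<And>w. w \<in> W \<Longrightarrow> (\<Sum>p\<in>S. x p * spull w (y p)) \<in> Ns"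
  shows "(\<Sum>p\<in>S. x p * coef (\<lambda>w. spull w (y p)) t) \<in> Ns"
proof (rule sden_regular)
  let ?g = "\<lambda>p. coef (\<lambda>w. spull w (y p)) t"
  let ?S = "\<lambda>p. salt (\<lambda>w. spull w (y p) * cst (pull w (stb t)))"
  have g: "?g p \<in> Cs" "?S p - sden * ?g p \<in> Ns" if "p \<in> S" for p
    using coef[OF congruent_family_spull[OF C(2)[OF that]] t] by auto
  show "(\<Sum>p\<in>S. x p * ?g p) \<in> Cs" by (intro sq.C_sum sq.C_mult C g)
  have "(\<Sum>p\<in>S. x p * ?S p) = (\<Sum>p\<in>S. \<Sum>w\<in>W. of_int (eps w) * cst (pull w (stb t)) * (x p * spull w (y p)))"
    by (simp add: salt_def sum_distrib_left mult_ac)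
  also have "\<dots> = (\<Sum>w\<in>W. of_int (eps w) * cst (pull w (stb t)) * (\<Sum>p\<in>S. x p * spull w (y p)))"
    by (subst sum.swap) (simp add: sum_distrib_left)
  also have "\<dots> \<in> Ns"
    by (intro sq.N_sum sq.N_mult sq.C_mult sq.C_of_int cst_Cs pull_GR stb_GR t 0)
  finally have "(\<Sum>p\<in>S. x p * ?S p) \<in> Ns" .
  moreover have "(\<Sum>p\<in>S. x p * (?S p - sden * ?g p)) \<in> Ns" by (intro sq.N_sum sq.N_mult C g)
  ultimately have "(\<Sum>p\<in>S. x p * ?S p) - (\<Sum>p\<in>S. x p * (?S p - sden * ?g p)) \<in> Ns" by (rule sq.N_diff)
  also have "(\<Sum>p\<in>S. x p * ?S p) - (\<Sum>p\<in>S. x p * (?S p - sden * ?g p)) = sden * (\<Sum>p\<in>S. x p * ?g p)"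
    by (simp add: right_diff_distrib sum_subtractf sum_distrib_left mult_ac)
  finally show "sden * (\<Sum>p\<in>S. x p * ?g p) \<in> Ns" .
qed

end

section \<open>Comparison with the completion\<close>

lemma lookup_plus_fun: "lookup (p + q) = lookup p + lookup q"
  by (rule ext) (simp add: lookup_add)

lemma lookup_minus_fun: "lookup (p - q) = lookup p - lookup q"
  by (rule ext) (simp add: lookup_minus)

lemma lookup_zero_fun: "lookup 0 = 0"
  by (rule ext) simp

lemma conv_lookup: "conv (lookup p) (lookup q) = lookup (p * q)"
  by (rule ext) (simp add: conv_def lookup_mult_group keys.rep_eq)

lemma ex_lookup: "ex l = lookup (gx l)"
  by (rule ext) (auto simp: ex_def gx_def lookup_single when_def)

lemma aug_lookup: "aug (lookup p) = augm p"
  by (simp add: aug_def augm_def lin_def keys.rep_eq)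

lemma of_int_fun_apply: "(of_int m :: 'a \<Rightarrow> 'b::ring_1) x = of_int m"
proof (induction m rule: int_induct[where k = 0])
  case (step1 i)
  then show ?case by (simp add: plus_fun_apply one_fun_apply)
next
  case (step2 i)
  then show ?case by (simp add: fun_diff_def one_fun_apply)
qed simp

context weyl_algebra
begin

lemma lookup_RT: "lookup p \<in> (RT \<Phi> :: ('v \<Rightarrow> 'k) set) \<longleftrightarrow> p \<in> GR X"
  by (auto simp: RT_def GR_def in_keys_iff)

lemma RT_lookup: "(f :: 'v \<Rightarrow> 'k) \<in> RT \<Phi> \<Longrightarrow> \<exists>p\<in>GR X. f = lookup p"
proof -
  assume f: "f \<in> RT \<Phi>"
  then have "lookup (Abs_poly_mapping f) = f" by (simp add: RT_def)
  then show ?thesis using f lookup_RT by metis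
qed

lemma Ipow_lookup: "(f :: 'v \<Rightarrow> 'k) \<in> Ipow \<Phi> n \<Longrightarrow> \<exists>p\<in>GI X n. f = lookup p"
proof (induction n arbitrary: f)
  case 0
  then show ?case by (simp add: RT_lookup)
next
  case (Suc n)
  from Suc.prems show ?case
    unfolding Ipow.simps
  proof (induction rule: addspan.induct)
    case addspan_zero
    then show ?case by (intro bexI[of _ 0]) (auto simp: lookup_zero_fun GI_0 simp del: GI.simps)
  next
    case (addspan_gen f)
    then obtain x y where xy: "f = conv x y" "x \<in> Iaug \<Phi>" "y \<in> Ipow \<Phi> n" by blast
    obtain p where p: "p \<in> GR X" "x = lookup p" using xy(2) RT_lookup by (auto simp: Iaug_def)
    obtain q where q: "q \<in> GI X n" "y = lookup q" using Suc.IH[OF xy(3)] by blast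
    have "augm p = 0" using xy(2) p by (simp add: Iaug_def aug_lookup)
    then show ?case
      using GI_Suc_mult[OF p(1) _ q(1)] xy(1) p q by (intro bexI[of _ "p * q"]) (auto simp: conv_lookup simp del: GI.simps)
  next
    case (addspan_add f g)
    then obtain p q where "p \<in> GI X (Suc n)" "q \<in> GI X (Suc n)" "f = lookup p" "g = lookup q" by blast
    then show ?case by (intro bexI[of _ "p + q"]) (auto simp: lookup_plus_fun GI_add simp del: GI.simps)
  qed
qed

lemma lookup_Ipow: "lookup p \<in> (Ipow \<Phi> n :: ('v \<Rightarrow> 'k) set) \<longleftrightarrow> p \<in> GI X n"
proof
  show "lookup p \<in> Ipow \<Phi> n \<Longrightarrow> p \<in> GI X n"
    using Ipow_lookup by (fastforce simp: lookup_inject simp del: GI.simps Ipow.simps)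
  show "p \<in> GI X n \<Longrightarrow> lookup p \<in> Ipow \<Phi> n"
  proof (induction n arbitrary: p)
    case 0
    then show ?case by (simp add: lookup_RT)
  next
    case (Suc n)
    from Suc.prems show ?case
    proof (induction rule: GI_Suc_induct)
      case zero
      show ?case by (simp only: lookup_zero_fun Ipow.simps addspan_zero)
    next
      case (mult x y)
      have "lookup x \<in> Iaug \<Phi>" using mult by (simp add: Iaug_def lookup_RT aug_lookup)
      then have "conv (lookup x) (lookup y) \<in> Ipow \<Phi> (Suc n)"
        unfolding Ipow.simps by (intro addspan_gen) (use Suc.IH[OF mult(3)] in blast)
      then show ?case by (simp only: conv_lookup)
    next
      case (add p q)
      then show ?case unfolding lookup_plus_fun Ipow.simps by (intro addspan_add)
    qed
  qed
qed

definition cl :: "(nat \<Rightarrow> 'v \<Rightarrow>\<^sub>0 'k) \<Rightarrow> ('v, 'k) cel" where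
  "cl x = (\<lambda>n. coset \<Phi> n (lookup (x n)))"

lemma cl_mem: "lookup z \<in> cl x n \<longleftrightarrow> z \<in> GR X \<and> z - x n \<in> GI X n"
  by (auto simp: cl_def coset_def lookup_RT lookup_Ipow simp flip: lookup_minus_fun)

lemma cl_elim: "f \<in> cl x n \<Longrightarrow> \<exists>z\<in>GR X. f = lookup z \<and> z - x n \<in> GI X n"
proof -
  assume f: "f \<in> cl x n"
  then obtain z where "z \<in> GR X" "f = lookup z" using RT_lookup by (auto simp: cl_def coset_def)
  then show ?thesis using f cl_mem by blast
qed

lemma RT_subset_eqI:
  assumes "A \<subseteq> RT \<Phi>" "B \<subseteq> RT \<Phi>" "\<And>z. z \<in> GR X \<Longrightarrow> lookup z \<in> A \<longleftrightarrow> lookup z \<in> B"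
  shows "A = (B :: ('v \<Rightarrow> 'k) set)"
  using assms RT_lookup by blast

lemma cl_RT: "cl x n \<subseteq> RT \<Phi>"
  by (auto simp: cl_def coset_def)

text \<open>Common core for \<open>hadd\<close>, \<open>hsub\<close> and \<open>hmul\<close>, which
  are defined by the same set comprehension over cosets. Only congruence of the operation differs,
  so it is a hypothesis.\<close>

lemma cl_op:
  fixes opf :: "('v \<Rightarrow> 'k) \<Rightarrow> ('v \<Rightarrow> 'k) \<Rightarrow> 'v \<Rightarrow> 'k" and op :: "('v \<Rightarrow>\<^sub>0 'k) \<Rightarrow> ('v \<Rightarrow>\<^sub>0 'k) \<Rightarrow> 'v \<Rightarrow>\<^sub>0 'k"
  assumes "\<And>p q. opf (lookup p) (lookup q) = lookup (op p q)"
    and x: "x \<in> Cs" and y: "y \<in> Cs"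
    and cong: "\<And>p q. p \<in> GR X \<Longrightarrow> q \<in> GR X \<Longrightarrow> p - x n \<in> GI X n \<Longrightarrow> q - y n \<in> GI X n \<Longrightarrow>
      op p q - op (x n) (y n) \<in> GI X n"
  shows "{z \<in> RT \<Phi>. \<exists>a\<in>cl x n. \<exists>b\<in>cl y n. z - opf a b \<in> Ipow \<Phi> n} = coset \<Phi> n (lookup (op (x n) (y n)))"
proof (rule RT_subset_eqI)
  fix z :: "'v \<Rightarrow>\<^sub>0 'k" assume z: "z \<in> GR X"
  have "(\<exists>a\<in>cl x n. \<exists>b\<in>cl y n. lookup z - opf a b \<in> Ipow \<Phi> n) \<longleftrightarrow> z - op (x n) (y n) \<in> GI X n"
  proof
    assume "\<exists>a\<in>cl x n. \<exists>b\<in>cl y n. lookup z - opf a b \<in> Ipow \<Phi> n"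
    then obtain a b where ab: "a \<in> cl x n" "b \<in> cl y n" "lookup z - opf a b \<in> Ipow \<Phi> n" by blast
    obtain p q where pq: "p \<in> GR X" "a = lookup p" "p - x n \<in> GI X n" "q \<in> GR X" "b = lookup q" "q - y n \<in> GI X n"
      using cl_elim[OF ab(1)] cl_elim[OF ab(2)] by blast
    have "z - op p q \<in> GI X n"
      using ab(3) by (simp add: pq assms(1) lookup_Ipow flip: lookup_minus_fun)
    from GI_add[OF this cong[OF pq(1,4,3,6)]] show "z - op (x n) (y n) \<in> GI X n" by simp
  next
    assume "z - op (x n) (y n) \<in> GI X n"
    then have "lookup z - opf (lookup (x n)) (lookup (y n)) \<in> Ipow \<Phi> n"
      by (simp add: assms(1) lookup_Ipow flip: lookup_minus_fun)
    moreover have "lookup (x n) \<in> cl x n" "lookup (y n) \<in> cl y n"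
      using x y by (simp_all add: cl_mem Cs_GR GI_0)
    ultimately show "\<exists>a\<in>cl x n. \<exists>b\<in>cl y n. lookup z - opf a b \<in> Ipow \<Phi> n" by blast
  qed
  then show "lookup z \<in> {z \<in> RT \<Phi>. \<exists>a\<in>cl x n. \<exists>b\<in>cl y n. z - opf a b \<in> Ipow \<Phi> n}
      \<longleftrightarrow> lookup z \<in> coset \<Phi> n (lookup (op (x n) (y n)))"
    using z by (simp add: coset_def lookup_RT lookup_Ipow flip: lookup_minus_fun)
qed (auto simp: coset_def)

lemma hadd_cl: "x \<in> Cs \<Longrightarrow> y \<in> Cs \<Longrightarrow> hadd \<Phi> (cl x) (cl y) = cl (x + y)"
proof (rule ext)
  fix n assume x: "x \<in> Cs" and y: "y \<in> Cs"
  have "hadd \<Phi> (cl x) (cl y) n = coset \<Phi> n (lookup (x n + y n))"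
    unfolding hadd_def
  proof (rule cl_op[OF _ x y, where op = "(+)"])
    fix p q assume "p - x n \<in> GI X n" "q - y n \<in> GI X n"
    from GI_add[OF this] show "p + q - (x n + y n) \<in> GI X n" by (simp add: algebra_simps)
  qed (simp add: lookup_plus_fun)
  then show "hadd \<Phi> (cl x) (cl y) n = cl (x + y) n" by (simp add: cl_def)
qed

lemma hsub_cl: "x \<in> Cs \<Longrightarrow> y \<in> Cs \<Longrightarrow> hsub \<Phi> (cl x) (cl y) = cl (x - y)"
proof (rule ext)
  fix n assume x: "x \<in> Cs" and y: "y \<in> Cs"
  have "hsub \<Phi> (cl x) (cl y) n = coset \<Phi> n (lookup (x n - y n))"
    unfolding hsub_def
  proof (rule cl_op[OF _ x y, where op = "(-)"])
    fix p q assume "p - x n \<in> GI X n" "q - y n \<in> GI X n"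
    from GI_diff[OF subgp_X this] show "p - q - (x n - y n) \<in> GI X n" by (simp add: algebra_simps)
  qed (simp add: lookup_minus_fun)
  then show "hsub \<Phi> (cl x) (cl y) n = cl (x - y) n" by (simp add: cl_def)
qed

lemma hmul_cl: "x \<in> Cs \<Longrightarrow> y \<in> Cs \<Longrightarrow> hmul \<Phi> (cl x) (cl y) = cl (x * y)"
proof (rule ext)
  fix n assume x: "x \<in> Cs" and y: "y \<in> Cs"
  have "hmul \<Phi> (cl x) (cl y) n = coset \<Phi> n (lookup (x n * y n))"
    unfolding hmul_def
  proof (rule cl_op[OF _ x y, where op = "(*)"])
    fix p q assume pq: "p \<in> GR X" "p - x n \<in> GI X n" "q - y n \<in> GI X n"
    have "p * (q - y n) + y n * (p - x n) \<in> GI X n"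
      by (intro GI_add GI_mult[OF subgp_X] pq Cs_GR y)
    moreover have "p * q - x n * y n = p * (q - y n) + y n * (p - x n)" by (simp add: algebra_simps)
    ultimately show "p * q - x n * y n \<in> GI X n" by simp
  qed (simp add: conv_lookup)
  then show "hmul \<Phi> (cl x) (cl y) n = cl (x * y) n" by (simp add: cl_def)
qed

lemma hemb_cl: "hemb \<Phi> (lookup p) = cl (cst p)"
  by (simp add: hemb_def cl_def cst_def)

lemma hzero_cl: "hzero \<Phi> = cl 0"
  by (rule ext) (simp add: hzero_def hemb_def cl_def lookup_zero_fun zero_fun_def)

lemma hone_cl: "hone \<Phi> = cl 1"
  by (simp add: hone_def ex_lookup hemb_cl cst_1)

lemma hint_cl: "hint \<Phi> m = cl (of_int m)"
proof -
  have "(\<lambda>\<nu>. if \<nu> = 0 then of_int m else 0) = lookup (of_int m :: 'v \<Rightarrow>\<^sub>0 'k)"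
    by (rule ext) (simp add: lookup_of_int when_def)
  then show ?thesis by (simp add: hint_def hemb_cl cst_of_int)
qed

lemma hpull_cl:
  assumes w: "w \<in> W" and x: "x \<in> Cs"
  shows "hpull w (cl x) = cl (spull w x)"
proof
  fix n
  have cw: "lookup p \<circ> w = lookup (pull w p)" for p :: "'v \<Rightarrow>\<^sub>0 'k"
    by (rule ext) (simp add: lookup_pull weyl_inj[OF w])
  have sub: "f \<circ> w \<in> cl (spull w x) n" if f: "f \<in> cl x n" for f
  proof -
    obtain z where z: "z \<in> GR X" "f = lookup z" "z - x n \<in> GI X n" using cl_elim[OF f] by blast
    have "pull w z - spull w x n = pull w (z - x n)" by (simp add: spull_def pull_diff weyl_inj w)
    then show ?thesis using pull_GI[OF w z(3)] pull_GR[OF w z(1)] by (simp add: z(2) cw cl_mem)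
  qed
  \<comment> \<open>Unlike the ring operations, \<open>hpull\<close> takes plain images of cosets,
    so every element of the target coset needs a preimage; transforming by w^-1 gives one.\<close>
  have sup: "f \<in> (\<lambda>f. f \<circ> w) ` cl x n" if f: "f \<in> cl (spull w x) n" for f
  proof -
    obtain z where z: "z \<in> GR X" "f = lookup z" "z - spull w x n \<in> GI X n" using cl_elim[OF f] by blast
    have u: "finv w \<in> W" by (rule weyl_inv[OF w])
    have id: "finv w \<circ> w = id" "w \<circ> finv w = id" using weyl_inv_left[OF w] weyl_inv_right[OF w] by auto
    have "pull (finv w) (z - spull w x n) = pull (finv w) z - x n"
      by (simp add: spull_def pull_diff weyl_inj u id flip: pull_comp[OF weyl_inj[OF w] weyl_inj[OF u]])
    then have "lookup (pull (finv w) z) \<in> cl x n"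
      using pull_GI[OF u z(3)] pull_GR[OF u z(1)] by (simp add: cl_mem)
    moreover have "lookup (pull (finv w) z) \<circ> w = f"
      by (simp add: cw z(2) id flip: pull_comp[OF weyl_inj[OF u] weyl_inj[OF w]])
    ultimately show ?thesis by blast
  qed
  show "hpull w (cl x) n = cl (spull w x) n"
    unfolding hpull_def using sub sup by blast
qed

lemma cl_eq_iff:
  assumes "x \<in> Cs" "y \<in> Cs"
  shows "cl x = cl y \<longleftrightarrow> x - y \<in> Ns"
proof
  assume "cl x = cl y"
  then have "lookup (x n) \<in> cl y n" for n using assms cl_mem[of "x n" x n] by (simp add: Cs_GR GI_0)
  then show "x - y \<in> Ns" by (simp add: cl_mem Ns_def)
next
  assume xy: "x - y \<in> Ns"
  show "cl x = cl y"
  proof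
    fix n
    have d: "x n - y n \<in> GI X n" using xy by (simp add: Ns_def)
    show "cl x n = cl y n"
    proof (rule RT_subset_eqI[OF cl_RT cl_RT])
      fix z :: "'v \<Rightarrow>\<^sub>0 'k"
      show "lookup z \<in> cl x n \<longleftrightarrow> lookup z \<in> cl y n"
        using GI_add[of "z - x n" X n, OF _ d] GI_diff[OF subgp_X _ d, of "z - y n"] by (auto simp: cl_mem)
    qed
  qed
qed

lemma cl_Rhat: "x \<in> Cs \<Longrightarrow> cl x \<in> Rhat \<Phi>"
proof -
  assume x: "x \<in> Cs"
  have "cl x (Suc n) \<subseteq> cl x n" for n
  proof
    fix f assume "f \<in> cl x (Suc n)"
    then obtain z where z: "z \<in> GR X" "f = lookup z" "z - x (Suc n) \<in> GI X (Suc n)" using cl_elim by blast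
    have "x (Suc n) - x n \<in> GI X n" using x by (simp add: Cs_def)
    from GI_add[OF GI_Suc_subset[OF subgp_X z(3)] this] show "f \<in> cl x n" by (simp add: z cl_mem)
  qed
  then show ?thesis using x by (auto simp: Rhat_def cl_def lookup_RT Cs_GR)
qed

lemma Rhat_cl: "c \<in> Rhat \<Phi> \<Longrightarrow> \<exists>x. x \<in> Cs \<and> c = (cl x :: ('v, 'k) cel)"
proof -
  assume c: "c \<in> Rhat \<Phi>"
  have "\<exists>p. p \<in> GR X \<and> c n = coset \<Phi> n (lookup p)" for n
    using c RT_lookup unfolding Rhat_def by blast
  then have "\<exists>x. \<forall>n. x n \<in> GR X \<and> c n = coset \<Phi> n (lookup (x n))" by (rule choice[OF allI])
  then obtain x where x: "\<And>n. x n \<in> GR X" "\<And>n. c n = coset \<Phi> n (lookup (x n))" by blast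
  have cx: "c = cl x" by (rule ext) (simp add: cl_def x(2))
  have "x (Suc n) - x n \<in> GI X n" for n
  proof -
    have "lookup (x (Suc n)) \<in> cl x (Suc n)" using x(1) by (simp add: cl_mem GI_0 del: GI.simps)
    then have "lookup (x (Suc n)) \<in> cl x n" using c unfolding cx Rhat_def by blast
    then show ?thesis by (simp add: cl_mem)
  qed
  then have "x \<in> Cs" using x(1) by (simp add: Cs_def)
  then show ?thesis using cx by blast
qed

definition rp :: "('v, 'k) cel \<Rightarrow> nat \<Rightarrow> 'v \<Rightarrow>\<^sub>0 'k" where
  "rp c = (SOME x. x \<in> Cs \<and> c = cl x)"

lemma rp: "c \<in> Rhat \<Phi> \<Longrightarrow> rp c \<in> Cs" and cl_rp: "c \<in> Rhat \<Phi> \<Longrightarrow> cl (rp c) = c"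
proof -
  assume "c \<in> Rhat \<Phi>"
  then have "rp c \<in> Cs \<and> c = cl (rp c)" unfolding rp_def by (rule someI_ex[OF Rhat_cl])
  then show "rp c \<in> Cs" "cl (rp c) = c" by auto
qed

text \<open>The fold can be evaluated only for steps that commute. Addition of coset families is
  known to commute just on classes of Cauchy sequences, so the step is first replaced by one that
  commutes everywhere.\<close>

lemma hsum_cl:
  assumes fin: "finite S" and v: "\<And>p. p \<in> S \<Longrightarrow> v p \<in> Cs" and G: "\<And>p. p \<in> S \<Longrightarrow> G p = cl (v p)"
  shows "hsum \<Phi> G S = cl (\<Sum>p\<in>S. v p)"
proof -
  \<comment> \<open>Agrees with the original step on classes of Cauchy sequences, which the fold
    never leaves, and is the identity elsewhere.\<close>
  define h where "h p c = (if c \<in> cl ` Cs then hadd \<Phi> (cl (v p)) c else c)" for p c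
  have h: "h p (cl x) = cl (v p + x)" if "p \<in> S" "x \<in> Cs" for p x
    using that by (auto simp: h_def hadd_cl v)
  have "hsum \<Phi> G S = Finite_Set.fold h (hzero \<Phi>) S"
    unfolding hsum_def
  proof (rule fold_closed_eq[where B = "cl ` Cs"])
    show "hadd \<Phi> (G a) b = h a b" if "a \<in> S" "b \<in> cl ` Cs" for a b using that by (simp add: h_def G)
    show "h a b \<in> cl ` Cs" if "a \<in> S" "b \<in> cl ` Cs" for a b
      using that h v sq.C_add by auto
    show "hzero \<Phi> \<in> cl ` Cs" using hzero_cl sq.C_0 by blast
  qed
  also have "\<dots> = cl (\<Sum>p\<in>S. v p)"
  proof -
    interpret comp_fun_commute_on S h
    proof
      fix p q assume pq: "p \<in> S" "q \<in> S"
      show "h q \<circ> h p = h p \<circ> h q"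
      proof
        fix c
        show "(h q \<circ> h p) c = (h p \<circ> h q) c"
        proof (cases "c \<in> cl ` Cs")
          case True
          then obtain x where "x \<in> Cs" "c = cl x" by blast
          then show ?thesis using pq by (simp add: h v sq.C_add add.left_commute)
        qed (simp add: h_def)
      qed
    qed
    have "finite A \<Longrightarrow> A \<subseteq> S \<Longrightarrow> Finite_Set.fold h (hzero \<Phi>) A = cl (\<Sum>p\<in>A. v p)" for A
    proof (induction A rule: finite_induct)
      case (insert a A)
      have "(\<Sum>p\<in>A. v p) \<in> Cs" using insert.prems by (intro sq.C_sum v) auto
      then have "Finite_Set.fold h (hzero \<Phi>) (insert a A) = cl (v a + (\<Sum>p\<in>A. v p))"
        using insert.IH insert.prems fold_insert[OF insert.prems insert.hyps(1,2)] h[OF _ \<open>(\<Sum>p\<in>A. v p) \<in> Cs\<close>]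
        by simp
      then show ?case by (simp only: sum.insert[OF insert.hyps(1,2)])
    qed (simp add: hzero_cl)
    then show ?thesis using fin by blast
  qed
  finally show ?thesis .
qed

section \<open>The tensor product\<close>

definition tval :: "('v \<Rightarrow> 'v) \<Rightarrow> ('v, 'k) cel \<times> ('v, 'k) cel \<Rightarrow> nat \<Rightarrow> 'v \<Rightarrow>\<^sub>0 'k" where
  "tval w p = rp (fst p) * spull w (rp (snd p))"

lemma tval_Cs: "w \<in> W \<Longrightarrow> fst p \<in> Rhat \<Phi> \<Longrightarrow> snd p \<in> Rhat \<Phi> \<Longrightarrow> tval w p \<in> Cs"
  unfolding tval_def by (intro sq.C_mult spull_Cs rp)

lemma tau_cl:
  assumes F: "F \<in> formal \<Phi>" and w: "w \<in> W"
  shows "tau \<Phi> F w = cl (\<Sum>p\<in>fsupp F. of_int (F p) * tval w p)"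
  unfolding tau_def
proof (rule hsum_cl)
  show "finite (fsupp F)" using F by (simp add: formal_def)
  fix p assume "p \<in> fsupp F"
  then have p: "fst p \<in> Rhat \<Phi>" "snd p \<in> Rhat \<Phi>" using F by (auto simp: formal_def)
  show "of_int (F p) * tval w p \<in> Cs" by (intro sq.C_mult sq.C_of_int tval_Cs w p)
  have "hmul \<Phi> (hint \<Phi> (F p)) (hmul \<Phi> (fst p) (hpull w (snd p)))
      = hmul \<Phi> (cl (of_int (F p))) (hmul \<Phi> (cl (rp (fst p))) (hpull w (cl (rp (snd p)))))"
    by (simp add: hint_cl cl_rp p)
  also have "\<dots> = cl (of_int (F p) * tval w p)"
    using p w by (simp add: hpull_cl hmul_cl rp spull_Cs sq.C_mult sq.C_of_int tval_def)
  finally show "(case p of (a, b) \<Rightarrow> hmul \<Phi> (hint \<Phi> (F (a, b))) (hmul \<Phi> a (hpull w b))) = cl (of_int (F p) * tval w p)"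
    by (simp add: case_prod_beta)
qed

lemma TRel_minus: "x \<in> TRel \<Phi> \<Longrightarrow> - x \<in> TRel \<Phi>" for x :: "('v, 'k) fsum"
  using TRel_diff[OF TRel_zero, of x] by simp

lemma TRel_add: "x \<in> TRel \<Phi> \<Longrightarrow> y \<in> TRel \<Phi> \<Longrightarrow> x + y \<in> TRel \<Phi>" for x y :: "('v, 'k) fsum"
  using TRel_diff[of x \<Phi> "- y"] TRel_minus[of y] by simp

lemma TRel_sum: "(\<And>i. i \<in> I \<Longrightarrow> f i \<in> TRel \<Phi>) \<Longrightarrow> sum f I \<in> TRel \<Phi>" for f :: "'i \<Rightarrow> ('v, 'k) fsum"
  by (induction I rule: infinite_finite_induct) (auto simp: TRel_zero TRel_add)

lemma TRel_scale: "x \<in> TRel \<Phi> \<Longrightarrow> of_int m * x \<in> TRel \<Phi>" for x :: "('v, 'k) fsum"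
proof (induction m rule: int_induct[where k = 0])
  case base
  show ?case by (simp only: of_int_0 mult_zero_left TRel_zero)
next
  case (step1 m)
  have "of_int (m + 1) * x = of_int m * x + x" by (simp only: of_int_add of_int_1 distrib_right mult_1)
  then show ?case using TRel_add step1 by metis
next
  case (step2 m)
  have "of_int (m - 1) * x = of_int m * x - x" by (simp only: of_int_diff of_int_1 left_diff_distrib mult_1)
  then show ?case using TRel_diff step2 by metis
qed

text \<open>D stands for x going to \<open>delta (cl x, s)\<close> or
  \<open>delta (s, cl x)\<close>. In the free abelian group such a map is additive only modulo the
  relations, so zero, integer multiples and finite sums each have to be derived.\<close>

context
  fixes D :: "(nat \<Rightarrow> 'v \<Rightarrow>\<^sub>0 'k) \<Rightarrow> ('v, 'k) fsum"
  assumes D: "\<And>x y. x \<in> Cs \<Longrightarrow> y \<in> Cs \<Longrightarrow> D (x + y) - D x - D y \<in> TRel \<Phi>"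
begin

lemma additive_0: "D 0 \<in> TRel \<Phi>"
  using TRel_minus[OF D[OF sq.C_0 sq.C_0]] by simp

lemma additive_of_int: "x \<in> Cs \<Longrightarrow> D (of_int m * x) - of_int m * D x \<in> TRel \<Phi>"
proof (induction m rule: int_induct[where k = 0])
  case base
  show ?case using additive_0 by (simp only: of_int_0 mult_zero_left diff_zero)
next
  case (step1 m)
  let ?y = "of_int m * x"
  have y: "?y \<in> Cs" using step1 by (intro sq.C_mult sq.C_of_int)
  have eq: "D (of_int (m + 1) * x) - of_int (m + 1) * D x = (D (?y + x) - D ?y - D x) + (D ?y - of_int m * D x)"
    by (simp add: distrib_right)
  show ?case unfolding eq by (rule TRel_add[OF D[OF y step1.prems] step1.IH[OF step1.prems]])
next
  case (step2 m)
  let ?y = "of_int (m - 1) * x"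
  have y: "?y \<in> Cs" using step2 by (intro sq.C_mult sq.C_of_int)
  have my: "of_int m * x = ?y + x" by (simp add: left_diff_distrib)
  have eq: "D ?y - of_int (m - 1) * D x = (D (of_int m * x) - of_int m * D x) - (D (?y + x) - D ?y - D x)"
    unfolding my by (simp add: left_diff_distrib)
  show ?case unfolding eq by (rule TRel_diff[OF step2.IH[OF step2.prems] D[OF y step2.prems]])
qed

lemma additive_sum: "(\<And>p. p \<in> S \<Longrightarrow> v p \<in> Cs) \<Longrightarrow> D (\<Sum>p\<in>S. v p) - (\<Sum>p\<in>S. D (v p)) \<in> TRel \<Phi>"
proof (induction S rule: infinite_finite_induct)
  case (insert p S)
  let ?y = "\<Sum>p\<in>S. v p"
  have C: "v p \<in> Cs" "?y \<in> Cs" using insert.prems by (auto intro: sq.C_sum)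
  have eq: "D (\<Sum>p\<in>insert p S. v p) - (\<Sum>p\<in>insert p S. D (v p)) = (D (v p + ?y) - D (v p) - D ?y) + (D ?y - (\<Sum>p\<in>S. D (v p)))"
    using insert.hyps by simp
  have "D ?y - (\<Sum>p\<in>S. D (v p)) \<in> TRel \<Phi>"
    by (rule insert.IH) (use insert.prems in auto)
  then show ?case unfolding eq by (rule TRel_add[OF D[OF C]])
qed (use additive_0 in auto)

lemma additive_combination:
  assumes "\<And>p. p \<in> S \<Longrightarrow> v p \<in> Cs"
  shows "D (\<Sum>p\<in>S. of_int (m p) * v p) - (\<Sum>p\<in>S. of_int (m p) * D (v p)) \<in> TRel \<Phi>"
proof -
  have "D (\<Sum>p\<in>S. of_int (m p) * v p) - (\<Sum>p\<in>S. D (of_int (m p) * v p)) \<in> TRel \<Phi>"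
    using assms by (intro additive_sum sq.C_mult sq.C_of_int)
  moreover have "(\<Sum>p\<in>S. D (of_int (m p) * v p) - of_int (m p) * D (v p)) \<in> TRel \<Phi>"
    using assms by (intro TRel_sum additive_of_int)
  ultimately have "(D (\<Sum>p\<in>S. of_int (m p) * v p) - (\<Sum>p\<in>S. D (of_int (m p) * v p)))
      + (\<Sum>p\<in>S. D (of_int (m p) * v p) - of_int (m p) * D (v p)) \<in> TRel \<Phi>" by (rule TRel_add)
  then show ?thesis by (simp only: sum_subtractf diff_add_eq_diff_diff_swap diff_diff_add) simp
qed

end

lemma delta_left_additive:
  assumes "s \<in> Cs" "x \<in> Cs" "y \<in> Cs"
  shows "delta (cl (x + y), cl s) - delta (cl x, cl s) - delta (cl y, cl s) \<in> TRel \<Phi>"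
  using TRel_addl[OF cl_Rhat[OF assms(2)] cl_Rhat[OF assms(3)] cl_Rhat[OF assms(1)]] assms by (simp add: hadd_cl)

lemma delta_right_additive:
  assumes "s \<in> Cs" "x \<in> Cs" "y \<in> Cs"
  shows "delta (cl s, cl (x + y)) - delta (cl s, cl x) - delta (cl s, cl y) \<in> TRel \<Phi>"
  using TRel_addr[OF cl_Rhat[OF assms(1)] cl_Rhat[OF assms(2)] cl_Rhat[OF assms(3)]] assms by (simp add: hadd_cl)

lemma std_Cs: "t \<in> W \<Longrightarrow> cst (std t) \<in> Cs"
  by (intro cst_Cs std_GR)

text \<open>At w = id, \<open>coef_expansion\<close> writes y over the \<open>std t\<close>, with
  coefficients that are invariant by \<open>coef_spull_invariant\<close>; the relation
  \<open>TRel_bal\<close> moves them into the left factor.\<close>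

lemma delta_expansion:
  assumes x: "x \<in> Cs" and y: "y \<in> Cs"
  shows "delta (cl x, cl y) - (\<Sum>t\<in>W. delta (cl (coef (\<lambda>w. spull w y) t * x), cl (cst (std t)))) \<in> TRel \<Phi>"
proof -
  let ?g = "coef (\<lambda>w. spull w y)"
  have fam: "congruent_family (\<lambda>w. spull w y)" by (rule congruent_family_spull[OF y])
  have g: "?g t \<in> Cs" if "t \<in> W" for t by (rule coef(1)[OF fam that])
  have gs: "?g t * cst (std t) \<in> Cs" if "t \<in> W" for t by (intro sq.C_mult g std_Cs that)
  have "y - (\<Sum>t\<in>W. ?g t * cst (std t)) \<in> Ns"
    using coef_expansion[OF fam weyl_id] by simp
  then have "cl y = cl (\<Sum>t\<in>W. ?g t * cst (std t))"
    using cl_eq_iff y gs by (simp add: sq.C_sum)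
  then have 1: "delta (cl x, cl y) - (\<Sum>t\<in>W. delta (cl x, cl (?g t * cst (std t)))) \<in> TRel \<Phi>"
    using additive_sum[of "\<lambda>y. delta (cl x, cl y)" W "\<lambda>t. ?g t * cst (std t)", OF delta_right_additive[OF x] gs] by simp
  have "delta (cl (?g t * x), cl (cst (std t))) - delta (cl x, cl (?g t * cst (std t))) \<in> TRel \<Phi>" if t: "t \<in> W" for t
  proof -
    have "hpull u (cl (?g t)) = cl (?g t)" if u: "u \<in> W" for u
      using coef_spull_invariant[OF y t u] g[OF t] u by (simp add: hpull_cl cl_eq_iff spull_Cs)
    then have "cl (?g t) \<in> Rinv \<Phi>" using cl_Rhat[OF g[OF t]] by (simp add: Rinv_def)
    from TRel_bal[OF this cl_Rhat[OF x] cl_Rhat[OF std_Cs[OF t]]]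
    show ?thesis using g[OF t] x std_Cs[OF t] by (simp add: hmul_cl)
  qed
  then have "(\<Sum>t\<in>W. delta (cl (?g t * x), cl (cst (std t))) - delta (cl x, cl (?g t * cst (std t)))) \<in> TRel \<Phi>"
    by (rule TRel_sum)
  from TRel_diff[OF 1 this] show ?thesis by (simp add: sum_subtractf)
qed

lemma formal_expansion:
  fixes F :: "('v, 'k) fsum"
  assumes "finite (fsupp F)"
  shows "F = (\<Sum>p\<in>fsupp F. of_int (F p) * delta p)"
proof
  fix q
  have sum_apply: "sum f S q = (\<Sum>p\<in>S. f p q)" for f :: "_ \<Rightarrow> ('v, 'k) fsum" and S
    by (induction S rule: infinite_finite_induct) auto
  have "(\<Sum>p\<in>fsupp F. of_int (F p) * delta p) q = (\<Sum>p\<in>fsupp F. if q = p then F p else 0)"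
    unfolding sum_apply by (intro sum.cong refl) (simp add: of_int_fun_apply delta_def)
  then show "F q = (\<Sum>p\<in>fsupp F. of_int (F p) * delta p) q"
    using assms by (auto simp: fsupp_def)
qed

text \<open>Rewriting each tensor over the \<open>std t\<close> collects one left factor per t. By
  \<open>coef_relation\<close> this left factor is null, so the terms belonging to each t form an
  element of \<open>TRel\<close>.\<close>

lemma tau_injective:
  fixes F :: "('v, 'k) fsum"
  assumes F: "F \<in> formal \<Phi>" and 0: "\<And>w. w \<in> W \<Longrightarrow> tau \<Phi> F w = hzero \<Phi>"
  shows "F \<in> TRel \<Phi>"
proof -
  let ?S = "fsupp F"
  let ?x = "\<lambda>p. rp (fst p)" and ?y = "\<lambda>p. rp (snd p)"
  let ?g = "\<lambda>p t. coef (\<lambda>w. spull w (?y p)) t"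
  have fin: "finite ?S" using F by (simp add: formal_def)
  have R: "fst p \<in> Rhat \<Phi>" "snd p \<in> Rhat \<Phi>" if "p \<in> ?S" for p using F that by (auto simp: formal_def)
  have C: "?x p \<in> Cs" "?y p \<in> Cs" if "p \<in> ?S" for p using R[OF that] by (auto intro: rp)
  have gC: "?g p t * ?x p \<in> Cs" if "p \<in> ?S" "t \<in> W" for p t
    using that by (intro sq.C_mult coef(1) congruent_family_spull C)
  have zero: "(\<Sum>p\<in>?S. (of_int (F p) * ?x p) * spull w (?y p)) \<in> Ns" if w: "w \<in> W" for w
  proof -
    have "(\<Sum>p\<in>?S. of_int (F p) * tval w p) \<in> Cs"
      using R w by (intro sq.C_sum sq.C_mult sq.C_of_int tval_Cs)
    then have "(\<Sum>p\<in>?S. of_int (F p) * tval w p) - 0 \<in> Ns"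
      using 0[OF w] unfolding tau_cl[OF F w] hzero_cl by (subst (asm) cl_eq_iff) (auto simp: sq.C_0)
    then show ?thesis by (simp only: tval_def mult.assoc diff_zero)
  qed
  \<comment> \<open>All terms with right factor \<open>std t\<close>; modulo the relations they
    combine into a single tensor.\<close>
  define G where "G t = (\<Sum>p\<in>?S. of_int (F p) * delta (cl (?g p t * ?x p), cl (cst (std t))))" for t
  have "G t \<in> TRel \<Phi>" if t: "t \<in> W" for t
  proof -
    let ?D = "\<lambda>x. delta (cl x, cl (cst (std t)))"
    let ?z = "\<Sum>p\<in>?S. of_int (F p) * (?g p t * ?x p)"
    note D = delta_left_additive[OF std_Cs[OF t]]
    have "(\<Sum>p\<in>?S. (of_int (F p) * ?x p) * ?g p t) \<in> Ns"
      by (rule coef_relation[OF fin _ _ t zero]) (auto intro: sq.C_mult sq.C_of_int C)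
    then have z: "?z \<in> Ns" by (simp only: mult_ac)
    have "cl ?z = cl 0"
      using z by (subst cl_eq_iff) (simp_all only: diff_zero Ns_Cs sq.C_0)
    then have "?D ?z \<in> TRel \<Phi>" using additive_0[of ?D, OF D] by simp
    moreover have "?D ?z - G t \<in> TRel \<Phi>"
      unfolding G_def by (rule additive_combination[of ?D, OF D]) (auto intro: gC t)
    ultimately have "?D ?z - (?D ?z - G t) \<in> TRel \<Phi>" by (rule TRel_diff)
    then show ?thesis by simp
  qed
  then have G: "(\<Sum>t\<in>W. G t) \<in> TRel \<Phi>" by (rule TRel_sum)
  have "of_int (F p) * (delta p - (\<Sum>t\<in>W. delta (cl (?g p t * ?x p), cl (cst (std t))))) \<in> TRel \<Phi>" if "p \<in> ?S" for p
    using delta_expansion[OF C[OF that]] R[OF that] by (intro TRel_scale) (simp add: cl_rp)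
  then have "(\<Sum>p\<in>?S. of_int (F p) * (delta p - (\<Sum>t\<in>W. delta (cl (?g p t * ?x p), cl (cst (std t)))))) \<in> TRel \<Phi>"
    by (rule TRel_sum)
  also have "(\<Sum>p\<in>?S. of_int (F p) * (delta p - (\<Sum>t\<in>W. delta (cl (?g p t * ?x p), cl (cst (std t))))))
      = (\<Sum>p\<in>?S. of_int (F p) * delta p) - (\<Sum>t\<in>W. G t)"
    unfolding G_def by (subst sum.swap) (simp only: right_diff_distrib sum_subtractf sum_distrib_left)
  also have "(\<Sum>p\<in>?S. of_int (F p) * delta p) = F"
    by (rule formal_expansion[OF fin, symmetric])
  finally have "F - (\<Sum>t\<in>W. G t) \<in> TRel \<Phi>" .
  from TRel_add[OF this G] show ?thesis by simp
qed

lemma congruence_iff: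
  assumes "\<alpha> \<in> \<Phi>" "x \<in> Cs" "y \<in> Cs"
  shows "(\<exists>g\<in>Rhat \<Phi>. hsub \<Phi> (cl x) (cl y) = hmul \<Phi> (hsub \<Phi> (hone \<Phi>) (hemb \<Phi> (ex (coroot \<alpha>)))) g)
    \<longleftrightarrow> sq.divs (E \<alpha>) (x - y)"
proof -
  have "cst (gx (coroot \<alpha>)) \<in> Cs" by (intro cst_Cs GR_gx coroot_X assms)
  then have "hsub \<Phi> (hone \<Phi>) (hemb \<Phi> (ex (coroot \<alpha>))) = cl (1 - cst (gx (coroot \<alpha>)))"
    by (simp add: hone_cl ex_lookup hemb_cl hsub_cl sq.C_1)
  also have "1 - cst (gx (coroot \<alpha>)) = E \<alpha>"
    by (rule ext) (simp add: E_def cst_def)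
  finally have e: "hsub \<Phi> (hone \<Phi>) (hemb \<Phi> (ex (coroot \<alpha>))) = cl (E \<alpha>)" .
  have "cl (x - y) = hmul \<Phi> (cl (E \<alpha>)) (cl g) \<longleftrightarrow> x - y - E \<alpha> * g \<in> Ns" if "g \<in> Cs" for g
    using that assms E_Cs by (simp add: hmul_cl cl_eq_iff sq.C_diff sq.C_mult)
  moreover have "(\<exists>g\<in>Rhat \<Phi>. Q g) \<longleftrightarrow> (\<exists>g\<in>Cs. Q (cl g))" for Q :: "('v, 'k) cel \<Rightarrow> bool"
    using Rhat_cl cl_Rhat by blast
  ultimately show ?thesis
    using assms unfolding e sq.divs_def by (simp add: hsub_cl)
qed

lemma tau_congruent:
  fixes F :: "('v, 'k) fsum"
  assumes F: "F \<in> formal \<Phi>"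
  shows "congruent_family (\<lambda>w. \<Sum>p\<in>fsupp F. of_int (F p) * tval w p)"
proof -
  have R: "fst p \<in> Rhat \<Phi>" "snd p \<in> Rhat \<Phi>" if "p \<in> fsupp F" for p using F that by (auto simp: formal_def)
  have 1: "congruent_family (\<lambda>w. of_int (F p) * tval w p)" if p: "p \<in> fsupp F" for p
  proof -
    have const: "congruent_family (\<lambda>w. c)" if "c \<in> Cs" for c
      using that sq.divs_0 by (simp add: congruent_family_def)
    show ?thesis
      unfolding tval_def
      by (intro congruent_family_mult const congruent_family_spull rp R p sq.C_of_int)
  qed
  show ?thesis
    unfolding congruent_family_def sum_subtractf[symmetric]
    using 1 by (intro ballI conjI sq.C_sum sq.divs_sum) (auto simp: congruent_family_def)
qed

lemma tau_surjective:
  fixes f :: "('v \<Rightarrow> 'v) \<Rightarrow> nat \<Rightarrow> 'v \<Rightarrow>\<^sub>0 'k"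
  assumes f: "congruent_family f"
  shows "\<exists>F\<in>formal \<Phi>. \<forall>w\<in>W. tau \<Phi> F w = cl (f w)"
proof -
  define p where "p t = (cl (coef f t), cl (cst (std t)))" for t
  \<comment> \<open>Different t may give the same pair, so F counts pairs with multiplicity; the sum
    over its support is unfolded back to a sum over W below.\<close>
  define F :: "('v, 'k) fsum" where "F = (\<Sum>t\<in>W. delta (p t))"
  have sum_apply: "sum h S q = (\<Sum>p\<in>S. h p q)" for h :: "('v \<Rightarrow> 'v) \<Rightarrow> ('v, 'k) fsum" and S q
    by (induction S rule: infinite_finite_induct) auto
  have Fq: "F q = (\<Sum>t\<in>W. if q = p t then 1 else 0)" for q
    by (simp add: F_def sum_apply delta_def)
  have sub: "fsupp F \<subseteq> p ` W"
  proof
    fix q assume "q \<in> fsupp F"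
    show "q \<in> p ` W"
    proof (rule ccontr)
      assume "q \<notin> p ` W"
      then have "F q = 0" unfolding Fq by (intro sum.neutral) auto
      then show False using \<open>q \<in> fsupp F\<close> by (simp add: fsupp_def)
    qed
  qed
  have g: "coef f t \<in> Cs" if "t \<in> W" for t by (rule coef(1)[OF f that])
  have pR: "p t \<in> Rhat \<Phi> \<times> Rhat \<Phi>" if "t \<in> W" for t
    using that by (simp add: p_def cl_Rhat g std_Cs)
  have formal: "F \<in> formal \<Phi>"
  proof -
    have "fsupp F \<subseteq> Rhat \<Phi> \<times> Rhat \<Phi>" using sub pR by blast
    moreover have "finite (fsupp F)" using sub weyl_finite by (auto intro: finite_subset)
    ultimately show ?thesis by (simp add: formal_def)
  qed
  have "tau \<Phi> F w = cl (f w)" if w: "w \<in> W" for w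
  proof -
    have "(\<Sum>q\<in>fsupp F. of_int (F q) * tval w q) = (\<Sum>q\<in>p ` W. of_int (F q) * tval w q)"
      using sub weyl_finite by (intro sum.mono_neutral_left) (auto simp: fsupp_def)
    also have "\<dots> = (\<Sum>q\<in>p ` W. \<Sum>t\<in>W. if q = p t then tval w q else 0)"
      by (intro sum.cong refl) (simp add: Fq of_int_sum sum_distrib_right if_distrib[of of_int] if_distrib[of "\<lambda>c. c * _"] cong: if_cong)
    also have "\<dots> = (\<Sum>t\<in>W. tval w (p t))"
      by (subst sum.swap) (use weyl_finite in \<open>simp add: sum.delta'\<close>)
    finally have S: "(\<Sum>q\<in>fsupp F. of_int (F q) * tval w q) = (\<Sum>t\<in>W. tval w (p t))" .
    have tC: "tval w (p t) \<in> Cs" if "t \<in> W" for t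
      using pR[OF that] by (intro tval_Cs w) auto
    \<comment> \<open>\<open>tval\<close> works with representatives chosen by \<open>rp\<close>,
      which differ from \<open>coef f t\<close> and \<open>std t\<close> by null sequences.\<close>
    have tv: "tval w (p t) - coef f t * cst (pull w (std t)) \<in> Ns" if t: "t \<in> W" for t
    proof -
      let ?r = "rp (cl (coef f t))" and ?s = "rp (cl (cst (std t)))"
      have r: "?r \<in> Cs" "?r - coef f t \<in> Ns"
        using rp[OF cl_Rhat[OF g[OF t]]] cl_rp[OF cl_Rhat[OF g[OF t]]] cl_eq_iff g[OF t] by auto
      have s: "?s \<in> Cs" "?s - cst (std t) \<in> Ns"
        using rp[OF cl_Rhat[OF std_Cs[OF t]]] cl_rp[OF cl_Rhat[OF std_Cs[OF t]]] cl_eq_iff std_Cs[OF t] by auto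
      have "?r * spull w (?s - cst (std t)) + spull w (cst (std t)) * (?r - coef f t) \<in> Ns"
        by (intro sq.N_add sq.N_mult r spull_Ns[OF w s(2)] spull_Cs[OF w std_Cs[OF t]])
      also have "?r * spull w (?s - cst (std t)) + spull w (cst (std t)) * (?r - coef f t)
          = tval w (p t) - coef f t * cst (pull w (std t))"
        unfolding spull_diff[OF w] spull_cst[symmetric] tval_def p_def fst_conv snd_conv
        by (simp only: right_diff_distrib mult.commute) simp
      finally show ?thesis .
    qed
    have "(\<Sum>t\<in>W. tval w (p t) - coef f t * cst (pull w (std t))) \<in> Ns" by (intro sq.N_sum tv)
    from sq.N_diff[OF this coef_expansion[OF f w]]
    have "(\<Sum>t\<in>W. tval w (p t)) - f w \<in> Ns" by (simp add: sum_subtractf)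
    moreover have "f w \<in> Cs" using f w by (simp add: congruent_family_def)
    ultimately have "cl (\<Sum>t\<in>W. tval w (p t)) = cl (f w)"
      by (subst cl_eq_iff) (auto intro: sq.C_sum tC)
    then show ?thesis by (simp add: tau_cl[OF formal w] S)
  qed
  then show ?thesis using formal by blast
qed

lemma image_iff:
  fixes f :: "('v \<Rightarrow> 'v) \<Rightarrow> ('v, 'k) cel"
  assumes f: "\<And>w. w \<in> W \<Longrightarrow> f w \<in> Rhat \<Phi>"
  shows "(\<exists>F\<in>formal \<Phi>. \<forall>w\<in>W. tau \<Phi> F w = f w) \<longleftrightarrow>
    (\<forall>w\<in>W. \<forall>\<alpha>\<in>\<Phi>. \<exists>g\<in>Rhat \<Phi>. hsub \<Phi> (f w) (f (w \<circ> root_refl \<alpha>)) =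
      hmul \<Phi> (hsub \<Phi> (hone \<Phi>) (hemb \<Phi> (ex (coroot \<alpha>)))) g)" (is "?L \<longleftrightarrow> ?R")
proof -
  \<comment> \<open>Stated for arbitrary representatives x, since one direction uses those coming
    from a formal sum and the other the chosen ones.\<close>
  have key: "?R \<longleftrightarrow> congruent_family x" if x: "\<And>w. w \<in> W \<Longrightarrow> x w \<in> Cs" "\<And>w. w \<in> W \<Longrightarrow> f w = cl (x w)" for x
    using x congruence_iff weyl_comp weyl_refl unfolding congruent_family_def by simp
  show ?thesis
  proof
    assume ?L
    then obtain F where F: "F \<in> formal \<Phi>" "\<And>w. w \<in> W \<Longrightarrow> tau \<Phi> F w = f w" by blast
    note fam = tau_congruent[OF F(1)]
    show ?R
      using fam F(2) tau_cl[OF F(1)] by (subst key[of "\<lambda>w. \<Sum>p\<in>fsupp F. of_int (F p) * tval w p"]) (auto simp: congruent_family_def)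
  next
    assume ?R
    then have "congruent_family (\<lambda>w. rp (f w))"
      using key[of "\<lambda>w. rp (f w)"] f rp cl_rp by simp
    then show ?L using tau_surjective f cl_rp by fastforce
  qed
qed

end

theorem mainTheorem6:
  fixes \<Phi> :: "'v::euclidean_space set"
  assumes "root_system \<Phi>"
  shows "(\<forall>F::('v, 'k::field) fsum. F \<in> formal \<Phi> \<and> (\<forall>w\<in>weyl \<Phi>. tau \<Phi> F w = hzero \<Phi>)
            \<longrightarrow> F \<in> TRel \<Phi>)
   \<and> (\<forall>f::('v \<Rightarrow> 'v) \<Rightarrow> ('v, 'k) cel. (\<forall>w\<in>weyl \<Phi>. f w \<in> Rhat \<Phi>) \<longrightarrow>
        ((\<exists>F \<in> formal \<Phi>. \<forall>w\<in>weyl \<Phi>. tau \<Phi> F w = f w) \<longleftrightarrow>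
         (\<forall>w\<in>weyl \<Phi>. \<forall>\<alpha>\<in>\<Phi>. \<exists>g\<in>Rhat \<Phi>.
            hsub \<Phi> (f w) (f (w \<circ> root_refl \<alpha>)) =
            hmul \<Phi> (hsub \<Phi> (hone \<Phi>) (hemb \<Phi> (ex (coroot \<alpha>)))) g)))"
proof -
  interpret weyl_algebra \<Phi> "TYPE('k)"
    by standard (rule assms)
  show ?thesis using tau_injective image_iff by blast
qed

end
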